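(* Let $V\subseteq\overline{V}$ be transitive class models of ZFC, and suppose the pair $V\subseteq\overline{V}$ satisfies the $\delta$ approximation and $\delta$ cover properties, where $\delta$ is a regular cardinal. Let $\overline{M}$ be a transitive submodel of $\overline{V}$ such that $M=\overline{M}\cap V$ is also a model of set theory, and let $j:\overline{M}\to\overline{N}$ be a (possibly external) cofinal elementary embedding of $\overline{M}$ into a transitive class $\overline{N}\subseteq\overline{V}$. Suppose further that $\delta<\mathrm{cp}(j)$, $P(\delta)^{\overline{V}}\subseteq\overline{M}$, and that $\overline{M}^{<\delta}\subseteq\overline{M}$ and $\overline{N}^\delta\subseteq\overline{N}$ in $\overline{V}$. Let $N=\bigcup j[M]$ (the union of the pointwise image of $M$ under $j$), so that $j\restriction M:M\to N$. Then: (1) If $\overline{M}$ is a set in $\overline{V}$, then $M$ is a set in $V$. (2) $N\subseteq V$; indeed, $N=\overline{N}\cap V$. (3) If $j$ is amenable to $\overline{V}$, then $j\restriction M$ is amenable to $V$. In particular, if $j$ is a set in $\overline{V}$, then $j\restriction M$ is a set in $V$. (4) If $j$ and $M$ are classes in $\overline{V}$ and $V\subseteq\overline{V}$ satisfies the $\delta$ approximation property for classes, then $j\restriction M$ is a class of $V$.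
   Context: A "model of set theory" means a transitive model of a fixed large finite fragment of ZFC (for definiteness, the $\Sigma_{100}$ fragment). A pair of transitive classes $M\subseteq N$ satisfies the $\delta$ approximation property if whenever $A\subseteq M$ is a set in $N$ and $A\cap a\in M$ for every $a\in M$ of size less than $\delta$ in $M$, then $A\in M$. For models equipped with classes, $M\subseteq N$ satisfies the $\delta$ approximation property for classes if whenever $A\subseteq M$ is a class of $N$ and $A\cap a\in M$ for every $a\in M$ of size less than $\delta$ in $M$, then $A$ is a class of $M$. The pair $M\subseteq N$ satisfies the $\delta$ cover property if for every set $A\in N$ with $A\subseteq M$ and $|A|^N<\delta$ there is $B\in M$ with $A\subseteq B$ and $|B|^M<\delta$. The embedding $j$ is cofinal if for every $y\in\overline{N}$ there is $x\in\overline{M}$ with $y\in j(x)$. $\mathrm{cp}(j)$ denotes the critical point of $j$. A map $j$ (or a class) is amenable to a model $W$ if its restriction to (intersection with) each set of $W$ is an element of $W$. *)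

theory Defs
  imports Main
begin

text \<open>
  The background universe of sets is a type with a membership relation E that is extensional and
  well-founded.  Classes (possibly external to every model considered) are HOL sets of elements
  of this type; a map between classes that need not belong to any model is an HOL function.
  Well-foundedness is what makes a "transitive" class a standard one; the background
  universe itself is not required to satisfy any set existence axiom.
\<close>

definition set_universe :: "('a \<Rightarrow> 'a \<Rightarrow> bool) \<Rightarrow> bool" where
  "set_universe E \<longleftrightarrow> wfp E \<and> (\<forall>x y. (\<forall>z. E z x \<longleftrightarrow> E z y) \<longrightarrow> x = y)"

definition ext :: "('a \<Rightarrow> 'a \<Rightarrow> bool) \<Rightarrow> 'a \<Rightarrow> 'a set" where
  "ext E x = {y. E y x}"

definition transitive_class :: "('a \<Rightarrow> 'a \<Rightarrow> bool) \<Rightarrow> 'a set \<Rightarrow> bool" where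
  "transitive_class E W \<longleftrightarrow> (\<forall>x\<in>W. \<forall>y. E y x \<longrightarrow> y \<in> W)"

definition is_set_in :: "('a \<Rightarrow> 'a \<Rightarrow> bool) \<Rightarrow> 'a set \<Rightarrow> 'a set \<Rightarrow> bool" where
  "is_set_in E W A \<longleftrightarrow> (\<exists>a\<in>W. ext E a = A)"


subsection \<open>The language of set theory and the Levy hierarchy\<close>

datatype fm = Mem nat nat | Eq nat nat | Neg fm | And fm fm | Ex nat fm

primrec sat :: "('a \<Rightarrow> 'a \<Rightarrow> bool) \<Rightarrow> 'a set \<Rightarrow> (nat \<Rightarrow> 'a) \<Rightarrow> fm \<Rightarrow> bool" where
  "sat E W e (Mem m n) \<longleftrightarrow> E (e m) (e n)"
| "sat E W e (Eq m n) \<longleftrightarrow> e m = e n"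
| "sat E W e (Neg \<phi>) \<longleftrightarrow> \<not> sat E W e \<phi>"
| "sat E W e (And \<phi> \<psi>) \<longleftrightarrow> sat E W e \<phi> \<and> sat E W e \<psi>"
| "sat E W e (Ex n \<phi>) \<longleftrightarrow> (\<exists>x\<in>W. sat E W (e(n := x)) \<phi>)"

inductive is_Delta0 :: "fm \<Rightarrow> bool" where
  "is_Delta0 (Mem m n)"
| "is_Delta0 (Eq m n)"
| "is_Delta0 \<phi> \<Longrightarrow> is_Delta0 (Neg \<phi>)"
| "is_Delta0 \<phi> \<Longrightarrow> is_Delta0 \<psi> \<Longrightarrow> is_Delta0 (And \<phi> \<psi>)"
| "m \<noteq> n \<Longrightarrow> is_Delta0 \<phi> \<Longrightarrow> is_Delta0 (Ex m (And (Mem m n) \<phi>))"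

text \<open>
  Not only prenex formulas are admitted: the classes are closed under the purely logical
  operations that bring a formula into prenex form (conjunction, dualisation by negation, and
  blocks of like quantifiers), so that every member is logically equivalent to a formula
  with at most n alternating blocks of quantifiers in front of a Delta-0 matrix.
\<close>

inductive is_Sigma :: "nat \<Rightarrow> fm \<Rightarrow> bool" and is_Pi :: "nat \<Rightarrow> fm \<Rightarrow> bool" where
  "is_Delta0 \<phi> \<Longrightarrow> is_Sigma n \<phi>"
| "is_Delta0 \<phi> \<Longrightarrow> is_Pi n \<phi>"
| "is_Sigma n \<phi> \<Longrightarrow> is_Sigma (Suc n) \<phi>"
| "is_Pi n \<phi> \<Longrightarrow> is_Sigma (Suc n) \<phi>"
| "is_Sigma n \<phi> \<Longrightarrow> is_Pi (Suc n) \<phi>"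
| "is_Pi n \<phi> \<Longrightarrow> is_Pi (Suc n) \<phi>"
| "is_Pi n \<phi> \<Longrightarrow> is_Sigma n (Neg \<phi>)"
| "is_Sigma n \<phi> \<Longrightarrow> is_Pi n (Neg \<phi>)"
| "is_Sigma n \<phi> \<Longrightarrow> is_Sigma n \<psi> \<Longrightarrow> is_Sigma n (And \<phi> \<psi>)"
| "is_Pi n \<phi> \<Longrightarrow> is_Pi n \<psi> \<Longrightarrow> is_Pi n (And \<phi> \<psi>)"
| "is_Sigma (Suc n) \<phi> \<Longrightarrow> is_Sigma (Suc n) (Ex m \<phi>)"


subsection \<open>ZFC and its fragments\<close>

text \<open>
  The axioms are relativised to a class W that is meant to be transitive, so bounded
  quantifiers need no relativisation.  The formulas allowed in the Separation and
  Replacement schemes are those in \<open>\<Phi>\<close>; variables 0 and 1 are the distinguished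
  ones and all other variables are parameters.
\<close>

definition ax_extensionality :: "('a \<Rightarrow> 'a \<Rightarrow> bool) \<Rightarrow> 'a set \<Rightarrow> bool" where
  "ax_extensionality E W \<longleftrightarrow> (\<forall>x\<in>W. \<forall>y\<in>W. (\<forall>z\<in>W. E z x \<longleftrightarrow> E z y) \<longrightarrow> x = y)"

definition ax_foundation :: "('a \<Rightarrow> 'a \<Rightarrow> bool) \<Rightarrow> 'a set \<Rightarrow> bool" where
  "ax_foundation E W \<longleftrightarrow>
     (\<forall>x\<in>W. (\<exists>y\<in>W. E y x) \<longrightarrow> (\<exists>y\<in>W. E y x \<and> \<not> (\<exists>z\<in>W. E z x \<and> E z y)))"

definition ax_pairing :: "('a \<Rightarrow> 'a \<Rightarrow> bool) \<Rightarrow> 'a set \<Rightarrow> bool" where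
  "ax_pairing E W \<longleftrightarrow> (\<forall>x\<in>W. \<forall>y\<in>W. \<exists>u\<in>W. \<forall>z\<in>W. E z u \<longleftrightarrow> z = x \<or> z = y)"

definition ax_union :: "('a \<Rightarrow> 'a \<Rightarrow> bool) \<Rightarrow> 'a set \<Rightarrow> bool" where
  "ax_union E W \<longleftrightarrow> (\<forall>x\<in>W. \<exists>u\<in>W. \<forall>z\<in>W. E z u \<longleftrightarrow> (\<exists>y\<in>W. E y x \<and> E z y))"

definition ax_power :: "('a \<Rightarrow> 'a \<Rightarrow> bool) \<Rightarrow> 'a set \<Rightarrow> bool" where
  "ax_power E W \<longleftrightarrow> (\<forall>x\<in>W. \<exists>u\<in>W. \<forall>z\<in>W. E z u \<longleftrightarrow> (\<forall>y\<in>W. E y z \<longrightarrow> E y x))"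

definition ax_infinity :: "('a \<Rightarrow> 'a \<Rightarrow> bool) \<Rightarrow> 'a set \<Rightarrow> bool" where
  "ax_infinity E W \<longleftrightarrow>
     (\<exists>u\<in>W. (\<exists>x\<in>W. E x u \<and> (\<forall>z\<in>W. \<not> E z x)) \<and>
       (\<forall>x\<in>W. E x u \<longrightarrow> (\<exists>s\<in>W. E s u \<and> (\<forall>z\<in>W. E z s \<longleftrightarrow> E z x \<or> z = x))))"

definition ax_choice :: "('a \<Rightarrow> 'a \<Rightarrow> bool) \<Rightarrow> 'a set \<Rightarrow> bool" where
  "ax_choice E W \<longleftrightarrow>
     (\<forall>F\<in>W. (\<forall>x\<in>W. E x F \<longrightarrow> (\<exists>z\<in>W. E z x)) \<and>
        (\<forall>x\<in>W. \<forall>y\<in>W. E x F \<and> E y F \<and> x \<noteq> y \<longrightarrow> \<not> (\<exists>z\<in>W. E z x \<and> E z y)) \<longrightarrow>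
        (\<exists>c\<in>W. \<forall>x\<in>W. E x F \<longrightarrow> (\<exists>!z. z \<in> W \<and> E z x \<and> E z c)))"

definition ax_separation :: "('a \<Rightarrow> 'a \<Rightarrow> bool) \<Rightarrow> fm set \<Rightarrow> 'a set \<Rightarrow> bool" where
  "ax_separation E \<Phi> W \<longleftrightarrow>
     (\<forall>\<phi>\<in>\<Phi>. \<forall>e. range e \<subseteq> W \<longrightarrow>
       (\<forall>a\<in>W. \<exists>b\<in>W. \<forall>x\<in>W. E x b \<longleftrightarrow> E x a \<and> sat E W (e(0 := x)) \<phi>))"

definition ax_replacement :: "('a \<Rightarrow> 'a \<Rightarrow> bool) \<Rightarrow> fm set \<Rightarrow> 'a set \<Rightarrow> bool" where
  "ax_replacement E \<Phi> W \<longleftrightarrow>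
     (\<forall>\<phi>\<in>\<Phi>. \<forall>e. range e \<subseteq> W \<longrightarrow>
       (\<forall>a\<in>W.
         (\<forall>x\<in>W. E x a \<longrightarrow> (\<forall>y\<in>W. \<forall>y'\<in>W.
            sat E W (e(0 := x, 1 := y)) \<phi> \<and> sat E W (e(0 := x, 1 := y')) \<phi> \<longrightarrow> y = y')) \<longrightarrow>
         (\<exists>b\<in>W. \<forall>y\<in>W. E y b \<longleftrightarrow> (\<exists>x\<in>W. E x a \<and> sat E W (e(0 := x, 1 := y)) \<phi>))))"

definition zfc_axioms_for :: "('a \<Rightarrow> 'a \<Rightarrow> bool) \<Rightarrow> fm set \<Rightarrow> 'a set \<Rightarrow> bool" where
  "zfc_axioms_for E \<Phi> W \<longleftrightarrow>
     ax_extensionality E W \<and> ax_foundation E W \<and> ax_pairing E W \<and> ax_union E W \<and>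
     ax_power E W \<and> ax_infinity E W \<and> ax_choice E W \<and>
     ax_separation E \<Phi> W \<and> ax_replacement E \<Phi> W"

definition transitive_zfc_model :: "('a \<Rightarrow> 'a \<Rightarrow> bool) \<Rightarrow> 'a set \<Rightarrow> bool" where
  "transitive_zfc_model E W \<longleftrightarrow> transitive_class E W \<and> zfc_axioms_for E UNIV W"

text \<open>A "model of set theory" in the sense of the \<open>\<Sigma>\<close>-100 fragment of ZFC.\<close>

definition model_of_set_theory :: "('a \<Rightarrow> 'a \<Rightarrow> bool) \<Rightarrow> 'a set \<Rightarrow> bool" where
  "model_of_set_theory E W \<longleftrightarrow>
     transitive_class E W \<and> zfc_axioms_for E {\<phi>. is_Sigma 100 \<phi>} W"


subsection \<open>Pairs, functions, ordinals, cardinality\<close>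

text \<open>
  These notions are absolute for transitive models of pairing; ordered pairs are
  Kuratowski pairs.
\<close>

definition is_upair :: "('a \<Rightarrow> 'a \<Rightarrow> bool) \<Rightarrow> 'a \<Rightarrow> 'a \<Rightarrow> 'a \<Rightarrow> bool" where
  "is_upair E u x y \<longleftrightarrow> ext E u = {x, y}"

definition is_opair :: "('a \<Rightarrow> 'a \<Rightarrow> bool) \<Rightarrow> 'a \<Rightarrow> 'a \<Rightarrow> 'a \<Rightarrow> bool" where
  "is_opair E p x y \<longleftrightarrow> (\<exists>u v. is_upair E u x x \<and> is_upair E v x y \<and> is_upair E p u v)"

definition maps_to :: "('a \<Rightarrow> 'a \<Rightarrow> bool) \<Rightarrow> 'a \<Rightarrow> 'a \<Rightarrow> 'a \<Rightarrow> bool" where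
  "maps_to E f x y \<longleftrightarrow> (\<exists>p. E p f \<and> is_opair E p x y)"

definition is_function :: "('a \<Rightarrow> 'a \<Rightarrow> bool) \<Rightarrow> 'a \<Rightarrow> 'a \<Rightarrow> 'a set \<Rightarrow> bool" where
  "is_function E f a B \<longleftrightarrow>
     (\<forall>p. E p f \<longrightarrow> (\<exists>x y. E x a \<and> y \<in> B \<and> is_opair E p x y)) \<and>
     (\<forall>x. E x a \<longrightarrow> (\<exists>!y. maps_to E f x y))"

definition is_bijection :: "('a \<Rightarrow> 'a \<Rightarrow> bool) \<Rightarrow> 'a \<Rightarrow> 'a \<Rightarrow> 'a \<Rightarrow> bool" where
  "is_bijection E f a b \<longleftrightarrow>
     is_function E f a (ext E b) \<and> (\<forall>y. E y b \<longrightarrow> (\<exists>!x. maps_to E f x y))"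

definition is_ordinal :: "('a \<Rightarrow> 'a \<Rightarrow> bool) \<Rightarrow> 'a \<Rightarrow> bool" where
  "is_ordinal E \<alpha> \<longleftrightarrow>
     transitive_class E (ext E \<alpha>) \<and> (\<forall>x y. E x \<alpha> \<and> E y \<alpha> \<longrightarrow> E x y \<or> x = y \<or> E y x)"

definition equinumerous_in :: "('a \<Rightarrow> 'a \<Rightarrow> bool) \<Rightarrow> 'a set \<Rightarrow> 'a \<Rightarrow> 'a \<Rightarrow> bool" where
  "equinumerous_in E W a b \<longleftrightarrow> (\<exists>f\<in>W. is_bijection E f a b)"

definition is_cardinality_in :: "('a \<Rightarrow> 'a \<Rightarrow> bool) \<Rightarrow> 'a set \<Rightarrow> 'a \<Rightarrow> 'a \<Rightarrow> bool" where
  "is_cardinality_in E W \<kappa> a \<longleftrightarrow>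
     \<kappa> \<in> W \<and> is_ordinal E \<kappa> \<and> equinumerous_in E W \<kappa> a \<and>
     (\<forall>\<beta>. E \<beta> \<kappa> \<longrightarrow> \<not> equinumerous_in E W \<beta> a)"

definition size_less_in :: "('a \<Rightarrow> 'a \<Rightarrow> bool) \<Rightarrow> 'a set \<Rightarrow> 'a \<Rightarrow> 'a \<Rightarrow> bool" where
  "size_less_in E W a \<delta> \<longleftrightarrow> (\<exists>\<kappa>. is_cardinality_in E W \<kappa> a \<and> E \<kappa> \<delta>)"

definition is_regular_cardinal_in :: "('a \<Rightarrow> 'a \<Rightarrow> bool) \<Rightarrow> 'a set \<Rightarrow> 'a \<Rightarrow> bool" where
  "is_regular_cardinal_in E W \<delta> \<longleftrightarrow>
     is_cardinality_in E W \<delta> \<delta> \<and> infinite (ext E \<delta>) \<and>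
     (\<forall>\<beta>. E \<beta> \<delta> \<longrightarrow>
        \<not> (\<exists>f\<in>W. is_function E f \<beta> (ext E \<delta>) \<and>
             (\<forall>\<alpha>. E \<alpha> \<delta> \<longrightarrow> (\<exists>x y. maps_to E f x y \<and> (E \<alpha> y \<or> \<alpha> = y)))))"


subsection \<open>Approximation, cover, and closure under sequences\<close>

definition approximation_property ::
  "('a \<Rightarrow> 'a \<Rightarrow> bool) \<Rightarrow> 'a \<Rightarrow> 'a set \<Rightarrow> 'a set \<Rightarrow> bool" where
  "approximation_property E \<delta> M N \<longleftrightarrow>
     (\<forall>A\<in>N. ext E A \<subseteq> M \<and>
        (\<forall>a\<in>M. size_less_in E M a \<delta> \<longrightarrow> is_set_in E M (ext E A \<inter> ext E a)) \<longrightarrow> A \<in> M)"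

definition cover_property ::
  "('a \<Rightarrow> 'a \<Rightarrow> bool) \<Rightarrow> 'a \<Rightarrow> 'a set \<Rightarrow> 'a set \<Rightarrow> bool" where
  "cover_property E \<delta> M N \<longleftrightarrow>
     (\<forall>A\<in>N. ext E A \<subseteq> M \<and> size_less_in E N A \<delta> \<longrightarrow>
        (\<exists>B\<in>M. ext E A \<subseteq> ext E B \<and> size_less_in E M B \<delta>))"

text \<open>Here the models are equipped with the families \<open>CM\<close> and \<open>CN\<close> of their classes.\<close>

definition class_approximation_property ::
  "('a \<Rightarrow> 'a \<Rightarrow> bool) \<Rightarrow> 'a \<Rightarrow> 'a set \<Rightarrow> 'a set set \<Rightarrow> 'a set set \<Rightarrow> bool" where
  "class_approximation_property E \<delta> M CM CN \<longleftrightarrow>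
     (\<forall>A\<in>CN. A \<subseteq> M \<and>
        (\<forall>a\<in>M. size_less_in E M a \<delta> \<longrightarrow> is_set_in E M (A \<inter> ext E a)) \<longrightarrow> A \<in> CM)"

definition closed_under_sequences ::
  "('a \<Rightarrow> 'a \<Rightarrow> bool) \<Rightarrow> 'a set \<Rightarrow> 'a \<Rightarrow> 'a set \<Rightarrow> bool" where
  "closed_under_sequences E W \<beta> X \<longleftrightarrow> (\<forall>f\<in>W. is_function E f \<beta> X \<longrightarrow> f \<in> X)"


subsection \<open>Embeddings\<close>

definition elementary_embedding ::
  "('a \<Rightarrow> 'a \<Rightarrow> bool) \<Rightarrow> ('a \<Rightarrow> 'a) \<Rightarrow> 'a set \<Rightarrow> 'a set \<Rightarrow> bool" where
  "elementary_embedding E j M N \<longleftrightarrow>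
     j ` M \<subseteq> N \<and>
     (\<forall>\<phi> e. range e \<subseteq> M \<longrightarrow> (sat E M e \<phi> \<longleftrightarrow> sat E N (\<lambda>n. j (e n)) \<phi>))"

definition cofinal_map ::
  "('a \<Rightarrow> 'a \<Rightarrow> bool) \<Rightarrow> ('a \<Rightarrow> 'a) \<Rightarrow> 'a set \<Rightarrow> 'a set \<Rightarrow> bool" where
  "cofinal_map E j M N \<longleftrightarrow> (\<forall>y\<in>N. \<exists>x\<in>M. E y (j x))"

definition is_critical_point ::
  "('a \<Rightarrow> 'a \<Rightarrow> bool) \<Rightarrow> ('a \<Rightarrow> 'a) \<Rightarrow> 'a set \<Rightarrow> 'a \<Rightarrow> bool" where
  "is_critical_point E j M \<kappa> \<longleftrightarrow>
     \<kappa> \<in> M \<and> is_ordinal E \<kappa> \<and> j \<kappa> \<noteq> \<kappa> \<and> (\<forall>\<alpha>. E \<alpha> \<kappa> \<longrightarrow> j \<alpha> = \<alpha>)"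

text \<open>
  The restriction of j to D as a class of ordered pairs.  If D and its image under j are
  contained in a model of pairing, all these pairs exist.
\<close>

definition graph_on :: "('a \<Rightarrow> 'a \<Rightarrow> bool) \<Rightarrow> ('a \<Rightarrow> 'a) \<Rightarrow> 'a set \<Rightarrow> 'a set" where
  "graph_on E j D = {p. \<exists>x\<in>D. is_opair E p x (j x)}"

definition amenable_map ::
  "('a \<Rightarrow> 'a \<Rightarrow> bool) \<Rightarrow> ('a \<Rightarrow> 'a) \<Rightarrow> 'a set \<Rightarrow> 'a set \<Rightarrow> bool" where
  "amenable_map E j D W \<longleftrightarrow> (\<forall>a\<in>W. is_set_in E W (graph_on E j (D \<inter> ext E a)))"


subsection \<open>Models equipped with classes\<close>

text \<open>
  Formulas of the two-sorted language without class quantifiers; \<open>CIn m k\<close> says that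
  set variable m belongs to class variable k.
\<close>

datatype cfm = CMem nat nat | CEq nat nat | CIn nat nat | CNeg cfm | CAnd cfm cfm | CEx nat cfm

primrec csat ::
  "('a \<Rightarrow> 'a \<Rightarrow> bool) \<Rightarrow> 'a set \<Rightarrow> (nat \<Rightarrow> 'a set) \<Rightarrow> (nat \<Rightarrow> 'a) \<Rightarrow> cfm \<Rightarrow> bool" where
  "csat E W K e (CMem m n) \<longleftrightarrow> E (e m) (e n)"
| "csat E W K e (CEq m n) \<longleftrightarrow> e m = e n"
| "csat E W K e (CIn m k) \<longleftrightarrow> e m \<in> K k"
| "csat E W K e (CNeg \<phi>) \<longleftrightarrow> \<not> csat E W K e \<phi>"
| "csat E W K e (CAnd \<phi> \<psi>) \<longleftrightarrow> csat E W K e \<phi> \<and> csat E W K e \<psi>"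
| "csat E W K e (CEx n \<phi>) \<longleftrightarrow> (\<exists>x\<in>W. csat E W K (e(n := x)) \<phi>)"

definition class_comprehension :: "('a \<Rightarrow> 'a \<Rightarrow> bool) \<Rightarrow> 'a set \<Rightarrow> 'a set set \<Rightarrow> bool" where
  "class_comprehension E W C \<longleftrightarrow>
     (\<forall>\<phi> K e. range K \<subseteq> C \<and> range e \<subseteq> W \<longrightarrow> {x\<in>W. csat E W K (e(0 := x)) \<phi>} \<in> C)"

definition class_replacement :: "('a \<Rightarrow> 'a \<Rightarrow> bool) \<Rightarrow> 'a set \<Rightarrow> 'a set set \<Rightarrow> bool" where
  "class_replacement E W C \<longleftrightarrow>
     (\<forall>F\<in>C. \<forall>a\<in>W.
        (\<forall>x y y'. E x a \<and> (\<exists>p\<in>F. is_opair E p x y) \<and> (\<exists>p\<in>F. is_opair E p x y') \<longrightarrow> y = y') \<longrightarrow>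
        is_set_in E W {y. \<exists>x. E x a \<and> (\<exists>p\<in>F. is_opair E p x y)})"

text \<open>
  Goedel-Bernays set theory with the axiom of choice for sets.  Global choice is not
  demanded, so that the classes definable from parameters over any transitive model of
  ZFC qualify.
\<close>

definition model_with_classes :: "('a \<Rightarrow> 'a \<Rightarrow> bool) \<Rightarrow> 'a set \<Rightarrow> 'a set set \<Rightarrow> bool" where
  "model_with_classes E W C \<longleftrightarrow>
     transitive_zfc_model E W \<and> C \<subseteq> Pow W \<and> ext E ` W \<subseteq> C \<and>
     class_comprehension E W C \<and> class_replacement E W C"

end

theory Submission
  imports Defs
begin

text \<open>
  All four models are treated alike, as transitive models of the \<open>\<Sigma>\<close>-100 fragment.  For an ordinal
  \<open>\<theta>\<close> of \<open>M\<close>, the approximation and cover properties of \<open>V \<subseteq> Vbar\<close> restrict to subsets of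
  \<open>\<theta> \<times> \<theta>\<close> in \<open>M \<subseteq> Mbar\<close> and are carried by \<open>j\<close> to subsets of \<open>j \<theta> \<times> j \<theta>\<close> in \<open>N \<subseteq> Nbar\<close>.  Covering
  alternately in \<open>V\<close> and in \<open>N\<close> for \<open>\<delta>\<close> steps puts every small set of pairs of ordinals inside a set \<open>B\<close>
  of size at most \<open>\<delta>\<close> that belongs to both \<open>V\<close> and \<open>N\<close>.  The increasing enumeration of \<open>B\<close> identifies
  its subsets with subsets of an ordinal below the critical point, which are fixed by \<open>j\<close> and hence
  lie in \<open>V\<close> if and only if they lie in \<open>N\<close>.  By approximation \<open>V\<close> and \<open>N\<close> therefore have the same
  subsets of \<open>j \<theta> \<times> j \<theta>\<close> among the elements of \<open>Nbar\<close>, and coding sets by well-founded relations on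
  ordinals gives \<open>N = Nbar \<inter> V\<close>.  The remaining parts follow by approximation, since a small piece of
  \<open>j\<close> on \<open>M\<close> is computed from an enumeration \<open>k\<close> of its domain together with \<open>j k\<close>, which lies in \<open>V\<close>.
\<close>

section \<open>Definable predicates\<close>

text \<open>The obstacle is that \<open>M\<close> need not be definable in \<open>Mbar\<close>, so
  \<open>j\<close> restricted to \<open>M\<close> is not visibly elementary, and that
  \<open>N\<close> is only a union of values of \<open>j\<close>, not known to satisfy any axiom.
  Elementarity is applied on \<open>Mbar\<close> alone, with elements of \<open>M\<close> as
  parameters: if \<open>P\<close> is the power set of some \<open>X\<close> in the sense of
  \<open>M\<close>, then \<open>j P\<close> stands for the family of subsets of \<open>j X\<close>
  that belong to \<open>N\<close>.

  Because Separation and Replacement are available only up to a fixed complexity, each of their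
  instances needs a bound on its formula. The calculus \<open>dj\<close> tracks this bound and also
  supplies the formulas that are carried along \<open>j\<close>.

  The length \<delta> of the alternation lets regularity capture every small piece at one stage. Its
  price is a common cover of size \<delta> and not less, which is what closure of
  \<open>Nbar\<close> under \<delta>-sequences and the presence of all subsets of \<delta> in
  \<open>Mbar\<close> are for. Sets of pairs of ordinals are compared, and not sets of ordinals,
  because the code of a set is a relation; a plain subset of an ordinal is placed on the
  diagonal.\<close>

primrec ren :: "(nat \<Rightarrow> nat) \<Rightarrow> fm \<Rightarrow> fm" where
  "ren \<rho> (Mem m n) = Mem (\<rho> m) (\<rho> n)"
| "ren \<rho> (Eq m n) = Eq (\<rho> m) (\<rho> n)"
| "ren \<rho> (Neg \<phi>) = Neg (ren \<rho> \<phi>)"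
| "ren \<rho> (And \<phi> \<psi>) = And (ren \<rho> \<phi>) (ren \<rho> \<psi>)"
| "ren \<rho> (Ex n \<phi>) = Ex (\<rho> n) (ren \<rho> \<phi>)"

text \<open>Injectivity keeps a renamed quantifier from capturing another variable.\<close>

lemma sat_ren:
  assumes "inj \<rho>"
  shows "sat E W e (ren \<rho> \<phi>) \<longleftrightarrow> sat E W (e \<circ> \<rho>) \<phi>"
proof (induction \<phi> arbitrary: e)
  case (Ex n \<phi>)
  have "(e(\<rho> n := x)) \<circ> \<rho> = (e \<circ> \<rho>)(n := x)" for x
    using assms by (auto simp: fun_eq_iff inj_eq)
  then show ?case
    unfolding ren.simps sat.simps Ex.IH by (simp only:)
qed simp_all

lemma is_Delta0_ren:
  assumes "inj \<rho>"
  shows "is_Delta0 \<phi> \<Longrightarrow> is_Delta0 (ren \<rho> \<phi>)"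
  by (induction rule: is_Delta0.induct) (auto intro: is_Delta0.intros simp: inj_eq[OF assms])

lemma is_Sigma_ren:
  assumes "inj \<rho>"
  shows "(is_Sigma n \<phi> \<longrightarrow> is_Sigma n (ren \<rho> \<phi>)) \<and> (is_Pi n \<phi> \<longrightarrow> is_Pi n (ren \<rho> \<phi>))"
proof -
  have "(is_Sigma n \<phi> \<longrightarrow> is_Sigma n (ren \<rho> \<phi>)) \<and> (is_Pi n' \<phi>' \<longrightarrow> is_Pi n' (ren \<rho> \<phi>'))"
    for n n' \<phi> \<phi>'
    by (rule is_Sigma_is_Pi.induct)
      (auto intro: is_Sigma_is_Pi.intros is_Delta0_ren[OF assms])
  then show ?thesis by blast
qed

text \<open>Asking for Sigma and Pi at once makes each level closed under negation and conjunction,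
  so no formula has to be brought into prenex form. Level 0 is Delta-0 itself, because there a
  bounded quantifier can be added free of cost.\<close>

definition lev :: "nat \<Rightarrow> fm \<Rightarrow> bool" where
  "lev n \<phi> \<longleftrightarrow> (if n = 0 then is_Delta0 \<phi> else is_Sigma n \<phi> \<and> is_Pi n \<phi>)"

lemma lev_Delta0: "is_Delta0 \<phi> \<Longrightarrow> lev n \<phi>"
  by (simp add: lev_def is_Sigma_is_Pi.intros)

lemma lev_Suc: "lev n \<phi> \<Longrightarrow> lev (Suc n) \<phi>"
  by (auto simp: lev_def is_Sigma_is_Pi.intros split: if_splits)

lemma lev_mono: "lev m \<phi> \<Longrightarrow> m \<le> n \<Longrightarrow> lev n \<phi>"
  by (induction n) (auto simp: le_Suc_eq lev_Suc)

lemma lev_Neg: "lev n \<phi> \<Longrightarrow> lev n (Neg \<phi>)"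
  by (auto simp: lev_def intro: is_Sigma_is_Pi.intros is_Delta0.intros split: if_splits)

lemma lev_And: "lev n \<phi> \<Longrightarrow> lev n \<psi> \<Longrightarrow> lev n (And \<phi> \<psi>)"
  by (auto simp: lev_def intro: is_Sigma_is_Pi.intros is_Delta0.intros split: if_splits)

text \<open>From level \<open>n\<close> the body is Sigma at \<open>n + 1\<close>, where the
  quantifier is absorbed. One more level is needed to be Pi as well, so a quantifier costs two
  levels.\<close>

lemma lev_Ex: "lev n \<phi> \<Longrightarrow> lev (Suc (Suc n)) (Ex m \<phi>)"
proof -
  assume "lev n \<phi>"
  then have "is_Sigma (Suc n) \<phi>"
    by (auto simp: lev_def intro: is_Sigma_is_Pi.intros split: if_splits)
  then have "is_Sigma (Suc n) (Ex m \<phi>)"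
    by (rule is_Sigma_is_Pi.intros)
  then show ?thesis
    by (auto simp: lev_def intro: is_Sigma_is_Pi.intros)
qed

lemma lev_ren: "inj \<rho> \<Longrightarrow> lev n \<phi> \<Longrightarrow> lev n (ren \<rho> \<phi>)"
  by (auto simp: lev_def is_Delta0_ren is_Sigma_ren split: if_splits)

text \<open>
  A formula variable is, according to its residue modulo 3, an argument, a parameter or a
  bound variable.
\<close>

definition mrg :: "(nat \<Rightarrow> 'a) \<Rightarrow> (nat \<Rightarrow> 'a) \<Rightarrow> (nat \<Rightarrow> 'a) \<Rightarrow> nat \<Rightarrow> 'a" where
  "mrg e p s k = (if k mod 3 = 0 then e (k div 3) else if k mod 3 = 1 then p (k div 3) else s (k div 3))"

lemma mrg_simps [simp]:
  "mrg e p s (3 * k) = e k" "mrg e p s (Suc (3 * k)) = p k" "mrg e p s (Suc (Suc (3 * k))) = s k"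
proof -
  have "(3 * k) mod 3 = 0" "(3 * k) div 3 = k" "Suc (3 * k) mod 3 = 1" "Suc (3 * k) div 3 = k"
    "Suc (Suc (3 * k)) mod 3 = 2" "Suc (Suc (3 * k)) div 3 = k"
    by presburger+
  then show "mrg e p s (3 * k) = e k" "mrg e p s (Suc (3 * k)) = p k"
    "mrg e p s (Suc (Suc (3 * k))) = s k"
    by (simp_all add: mrg_def)
qed

lemma mod3_cases: obtains k where "n = 3 * k" | k where "n = Suc (3 * k)" | k where "n = Suc (Suc (3 * k))"
proof -
  have "n = 3 * (n div 3) \<or> n = Suc (3 * (n div 3)) \<or> n = Suc (Suc (3 * (n div 3)))"
    by presburger
  then show ?thesis using that by blast
qed

lemma mrg_eqI:
  assumes "\<And>k. f (3 * k) = e k" "\<And>k. f (Suc (3 * k)) = p k" "\<And>k. f (Suc (Suc (3 * k))) = s k"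
  shows "f = mrg e p s"
proof
  fix n show "f n = mrg e p s n"
    by (cases n rule: mod3_cases) (auto simp: assms)
qed

definition par_map :: "(nat \<Rightarrow> nat) \<Rightarrow> nat \<Rightarrow> nat" where
  "par_map f = mrg (\<lambda>k. 3 * k) (\<lambda>k. Suc (3 * f k)) (\<lambda>k. Suc (Suc (3 * k)))"

lemma inj_par_map:
  assumes "inj f"
  shows "inj (par_map f)"
proof (rule injI)
  fix m n assume "par_map f m = par_map f n"
  then show "m = n"
    by (cases m rule: mod3_cases; cases n rule: mod3_cases)
      (use assms in \<open>auto simp: par_map_def inj_eq\<close>, presburger+)
qed

lemma mrg_par_map: "mrg e p s \<circ> par_map f = mrg e (p \<circ> f) s"
  by (rule mrg_eqI) (simp_all add: par_map_def)

text \<open>A de Bruijn shift: argument 0 of the inner formula goes to variable 2, the first slot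
  for bound variables; the other arguments move down by one, and the old bound variables move up to
  free that slot.\<close>

definition ex_map :: "nat \<Rightarrow> nat" where
  "ex_map = mrg (\<lambda>k. if k = 0 then 2 else 3 * (k - 1)) (\<lambda>k. Suc (3 * k)) (\<lambda>k. Suc (Suc (3 * Suc k)))"

lemma inj_ex_map: "inj ex_map"
proof (rule injI)
  fix m n assume "ex_map m = ex_map n"
  then show "m = n"
    by (cases m rule: mod3_cases; cases n rule: mod3_cases)
      (auto simp: ex_map_def split: if_splits, presburger+)
qed

lemma mrg_ex_map:
  "(mrg e p s)(2 := x) \<circ> ex_map = mrg (case_nat x e) p (s \<circ> Suc)"
proof (rule mrg_eqI)
  fix k
  have [simp]: "3 * m \<noteq> 2" "Suc (3 * m) \<noteq> 2" "Suc (Suc (3 * Suc m)) \<noteq> 2" for m :: nat by presburger+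
  show "((mrg e p s)(2 := x) \<circ> ex_map) (3 * k) = case_nat x e k"
    by (auto simp: ex_map_def split: nat.splits)
  show "((mrg e p s)(2 := x) \<circ> ex_map) (Suc (3 * k)) = p k"
    by (simp add: ex_map_def)
  have "ex_map (Suc (Suc (3 * k))) = Suc (Suc (3 * Suc k))"
    by (simp add: ex_map_def)
  moreover have "((mrg e p s)(2 := x)) (Suc (Suc (3 * Suc k))) = s (Suc k)"
    by (simp only: fun_upd_apply \<open>Suc (Suc (3 * Suc k)) \<noteq> 2\<close> if_False mrg_simps)
  ultimately show "((mrg e p s)(2 := x) \<circ> ex_map) (Suc (Suc (3 * k))) = (s \<circ> Suc) k"
    by simp
qed

text \<open>
  A predicate is treated uniformly over a family \<open>Wf\<close> of models; \<open>C\<close> is the set of families of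
  elements that are admitted as parameters.  A singleton family serves for Separation and
  Replacement; for an elementary embedding \<open>j\<close> the family is \<open>M, N\<close> and the admitted parameters
  are the pairs \<open>x, j x\<close>.
\<close>

definition dj :: "('a \<Rightarrow> 'a \<Rightarrow> bool) \<Rightarrow> ('i \<Rightarrow> 'a set) \<Rightarrow> ('i \<Rightarrow> 'a) set \<Rightarrow> nat \<Rightarrow>
    ('i \<Rightarrow> (nat \<Rightarrow> 'a) \<Rightarrow> bool) \<Rightarrow> bool" where
  "dj E Wf C n P \<longleftrightarrow>
     (\<exists>\<phi> p. lev n \<phi> \<and> range p \<subseteq> C \<and>
        (\<forall>i e s. range e \<subseteq> Wf i \<and> range s \<subseteq> Wf i \<longrightarrow>
           (sat E (Wf i) (mrg e (\<lambda>k. p k i) s) \<phi> \<longleftrightarrow> P i e)))"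

lemma djI:
  assumes "lev n \<phi>" "range p \<subseteq> C"
    and "\<And>i e s. range e \<subseteq> Wf i \<Longrightarrow> range s \<subseteq> Wf i \<Longrightarrow>
      sat E (Wf i) (mrg e (\<lambda>k. p k i) s) \<phi> \<longleftrightarrow> P i e"
  shows "dj E Wf C n P"
  unfolding dj_def by (intro exI[of _ \<phi>] exI[of _ p]) (simp add: assms)

lemma djE:
  assumes "dj E Wf C n P"
  obtains \<phi> p where "lev n \<phi>" "range p \<subseteq> C"
    "\<And>i e s. range e \<subseteq> Wf i \<Longrightarrow> range s \<subseteq> Wf i \<Longrightarrow>
      sat E (Wf i) (mrg e (\<lambda>k. p k i) s) \<phi> \<longleftrightarrow> P i e"
  using assms unfolding dj_def by (elim exE conjE) (rule that, assumption+, simp)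

definition trm :: "('i \<Rightarrow> 'a) set \<Rightarrow> ('i \<Rightarrow> (nat \<Rightarrow> 'a) \<Rightarrow> 'a) \<Rightarrow> bool" where
  "trm C t \<longleftrightarrow> (\<exists>m. t = (\<lambda>i e. e m)) \<or> (\<exists>c\<in>C. t = (\<lambda>i e. c i))"

lemma trm_var: "trm C (\<lambda>i e. e m)"
  by (auto simp: trm_def)

lemma trm_const: "c \<in> C \<Longrightarrow> trm C (\<lambda>i e. c i)"
  by (auto simp: trm_def)

locale univ =
  fixes E :: "'a \<Rightarrow> 'a \<Rightarrow> bool"
  assumes univ: "set_universe E"

locale dj_family = univ E
  for E :: "'a \<Rightarrow> 'a \<Rightarrow> bool" +
  fixes Wf :: "'i \<Rightarrow> 'a set" and C :: "('i \<Rightarrow> 'a) set"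
  assumes fam_trans: "transitive_class E (Wf i)"
    and fam_const: "c \<in> C \<Longrightarrow> c i \<in> Wf i"
    and fam_nonempty: "C \<noteq> {}"
begin

lemma trm_in: "trm C t \<Longrightarrow> range e \<subseteq> Wf i \<Longrightarrow> t i e \<in> Wf i"
  by (auto simp: trm_def fam_const)

text \<open>A term becomes the formula variable \<open>v\<close> as soon as slot \<open>k\<close> of
  the parameter list holds \<open>c\<close>; for an argument any \<open>c\<close> will do. The
  variable avoids 2, which \<open>dj_bex0\<close> binds.\<close>

lemma trm_index:
  assumes "trm C t"
  obtains v c where "c \<in> C" "\<And>p i e s. p k = c \<Longrightarrow> mrg e (\<lambda>k. p k i) s v = t i e"
    "v \<noteq> 2"
proof -
  have n2: "3 * m \<noteq> 2" "Suc (3 * m) \<noteq> 2" for m :: nat by presburger+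
  from assms consider m where "t = (\<lambda>i e. e m)" | c where "c \<in> C" "t = (\<lambda>i e. c i)"
    by (auto simp: trm_def)
  then show ?thesis
  proof cases
    case 1
    obtain c where "c \<in> C" using fam_nonempty by blast
    then show ?thesis using 1 n2 by (intro that[of c "3 * m"]) auto
  next
    case 2
    then show ?thesis using n2 by (intro that[of c "Suc (3 * k)"]) auto
  qed
qed

lemma dj_atom:
  assumes "trm C t1" "trm C t2"
    and "\<And>v1 v2 e W. sat E W e (at v1 v2) \<longleftrightarrow> R (e v1) (e v2)" "\<And>v1 v2. is_Delta0 (at v1 v2)"
  shows "dj E Wf C n (\<lambda>i e. R (t1 i e) (t2 i e))"
proof -
  obtain v1 c1 where c1: "c1 \<in> C" and v1: "\<And>p i e s. p (0::nat) = c1 \<Longrightarrow> mrg e (\<lambda>k. p k i) s v1 = t1 i e"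
    using trm_index[OF assms(1), of 0] by metis
  obtain v2 c2 where c2: "c2 \<in> C" and v2: "\<And>p i e s. p (1::nat) = c2 \<Longrightarrow> mrg e (\<lambda>k. p k i) s v2 = t2 i e"
    using trm_index[OF assms(2), of 1] by metis
  define p where "p = (\<lambda>k::nat. if k = 0 then c1 else c2)"
  have "range p \<subseteq> C" using c1 c2 by (auto simp: p_def)
  moreover have "sat E (Wf i) (mrg e (\<lambda>k. p k i) s) (at v1 v2) \<longleftrightarrow> R (t1 i e) (t2 i e)" for i e s
    using v1[of p e i s] v2[of p e i s] by (simp add: assms(3) p_def)
  ultimately show ?thesis
    using lev_Delta0[OF assms(4)] by (intro djI)
qed

lemma dj_mem: "trm C t1 \<Longrightarrow> trm C t2 \<Longrightarrow> dj E Wf C n (\<lambda>i e. E (t1 i e) (t2 i e))"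
  by (rule dj_atom[of t1 t2 Mem E]) (simp_all add: is_Delta0.intros)

lemma dj_eq: "trm C t1 \<Longrightarrow> trm C t2 \<Longrightarrow> dj E Wf C n (\<lambda>i e. t1 i e = t2 i e)"
  by (rule dj_atom[of t1 t2 Eq "(=)"]) (simp_all add: is_Delta0.intros)

lemma dj_mono: "dj E Wf C m P \<Longrightarrow> m \<le> n \<Longrightarrow> dj E Wf C n P"
  by (erule djE, rule djI, erule (1) lev_mono, assumption) blast

lemma dj_not: "dj E Wf C n P \<Longrightarrow> dj E Wf C n (\<lambda>i e. \<not> P i e)"
  by (erule djE, rule djI, erule lev_Neg, assumption) simp

lemma dj_rename_params:
  assumes "inj f"
    and "\<And>i e s. range e \<subseteq> Wf i \<Longrightarrow> range s \<subseteq> Wf i \<Longrightarrow> sat E (Wf i) (mrg e (\<lambda>k. p k i) s) \<phi> \<longleftrightarrow> P i e"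
    and "q \<circ> f = p" "range e \<subseteq> Wf i" "range s \<subseteq> Wf i"
  shows "sat E (Wf i) (mrg e (\<lambda>k. q k i) s) (ren (par_map f) \<phi>) \<longleftrightarrow> P i e"
proof -
  have "(\<lambda>k. q k i) \<circ> f = (\<lambda>k. p k i)" using assms(3) by (auto simp: fun_eq_iff)
  then show ?thesis
    unfolding sat_ren[OF inj_par_map[OF assms(1)]] mrg_par_map
    using assms(2)[OF assms(4,5)] by (simp only:)
qed

lemma dj_and:
  assumes "dj E Wf C n P" "dj E Wf C n Q"
  shows "dj E Wf C n (\<lambda>i e. P i e \<and> Q i e)"
proof -
  obtain \<phi> p where p: "lev n \<phi>" "range p \<subseteq> C"
    "\<And>i e s. range e \<subseteq> Wf i \<Longrightarrow> range s \<subseteq> Wf i \<Longrightarrow> sat E (Wf i) (mrg e (\<lambda>k. p k i) s) \<phi> \<longleftrightarrow> P i e"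
    by (erule djE[OF assms(1)])
  obtain \<psi> q where q: "lev n \<psi>" "range q \<subseteq> C"
    "\<And>i e s. range e \<subseteq> Wf i \<Longrightarrow> range s \<subseteq> Wf i \<Longrightarrow> sat E (Wf i) (mrg e (\<lambda>k. q k i) s) \<psi> \<longleftrightarrow> Q i e"
    by (erule djE[OF assms(2)])
  \<comment> \<open>The two parameter lists are interleaved on even and odd slots, while arguments
    and bound variables stay where they are.\<close>
  define f g where "f = (\<lambda>k::nat. 2 * k)" and "g = (\<lambda>k::nat. Suc (2 * k))"
  define r where "r = (\<lambda>k. if even k then p (k div 2) else q (k div 2))"
  have fg: "inj f" "inj g" "r \<circ> f = p" "r \<circ> g = q"
    by (auto simp: f_def g_def r_def inj_def)
  have "range r \<subseteq> C" using p(2) q(2) by (auto simp: r_def)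
  moreover have "lev n (And (ren (par_map f) \<phi>) (ren (par_map g) \<psi>))"
    by (intro lev_And lev_ren inj_par_map fg(1,2) p(1) q(1))
  moreover have "sat E (Wf i) (mrg e (\<lambda>k. r k i) s) (And (ren (par_map f) \<phi>) (ren (par_map g) \<psi>))
      \<longleftrightarrow> P i e \<and> Q i e" if "range e \<subseteq> Wf i" "range s \<subseteq> Wf i" for i e s
    using dj_rename_params[where P = P, OF fg(1) p(3) fg(3)] dj_rename_params[where P = Q, OF fg(2) q(3) fg(4)] that
    by simp
  ultimately show ?thesis by (intro djI)
qed

lemma dj_or: "dj E Wf C n P \<Longrightarrow> dj E Wf C n Q \<Longrightarrow> dj E Wf C n (\<lambda>i e. P i e \<or> Q i e)"
  using dj_not[OF dj_and[OF dj_not dj_not, of n P Q]] by simp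

lemma dj_imp: "dj E Wf C n P \<Longrightarrow> dj E Wf C n Q \<Longrightarrow> dj E Wf C n (\<lambda>i e. P i e \<longrightarrow> Q i e)"
  using dj_not[OF dj_and[OF _ dj_not, of n P Q]] by simp

lemma dj_iff: "dj E Wf C n P \<Longrightarrow> dj E Wf C n Q \<Longrightarrow> dj E Wf C n (\<lambda>i e. P i e \<longleftrightarrow> Q i e)"
  using dj_and[OF dj_imp[of n P Q] dj_imp[of n Q P]] by (simp add: iff_conv_conj_imp)

lemma range_case_nat: "x \<in> A \<Longrightarrow> range e \<subseteq> A \<Longrightarrow> range (case_nat x e) \<subseteq> A"
  by (fastforce split: nat.splits)

lemma sat_shift:
  assumes "\<And>i e s. range e \<subseteq> Wf i \<Longrightarrow> range s \<subseteq> Wf i \<Longrightarrow>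
      sat E (Wf i) (mrg e (\<lambda>k. p k i) s) \<phi> \<longleftrightarrow> Q i (e 0) (\<lambda>k. e (Suc k))"
    and "range e \<subseteq> Wf i" "range s \<subseteq> Wf i" "x \<in> Wf i"
  shows "sat E (Wf i) ((mrg e (\<lambda>k. p k i) s)(2 := x)) (ren ex_map \<phi>) \<longleftrightarrow> Q i x e"
proof -
  have "range (s \<circ> Suc) \<subseteq> Wf i" using assms(3) by auto
  then show ?thesis
    using assms(1)[OF range_case_nat[OF assms(4,2)]]
    unfolding sat_ren[OF inj_ex_map] mrg_ex_map by simp
qed

text \<open>The witness is argument 0 of the inner predicate and the outer arguments are shifted, so
  that quantifiers nest without any choice of names.\<close>

lemma dj_ex:
  assumes "dj E Wf C n (\<lambda>i e. Q i (e 0) (\<lambda>k. e (Suc k)))"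
  shows "dj E Wf C (Suc (Suc n)) (\<lambda>i e. \<exists>x\<in>Wf i. Q i x e)"
proof -
  obtain \<phi> p where p: "lev n \<phi>" "range p \<subseteq> C"
    "\<And>i e s. range e \<subseteq> Wf i \<Longrightarrow> range s \<subseteq> Wf i \<Longrightarrow>
      sat E (Wf i) (mrg e (\<lambda>k. p k i) s) \<phi> \<longleftrightarrow> Q i (e 0) (\<lambda>k. e (Suc k))"
    by (erule djE[OF assms])
  have "lev (Suc (Suc n)) (Ex 2 (ren ex_map \<phi>))"
    by (intro lev_Ex lev_ren inj_ex_map p(1))
  moreover have "sat E (Wf i) (mrg e (\<lambda>k. p k i) s) (Ex 2 (ren ex_map \<phi>)) \<longleftrightarrow> (\<exists>x\<in>Wf i. Q i x e)"
    if "range e \<subseteq> Wf i" "range s \<subseteq> Wf i" for i e s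
    using sat_shift[where Q = Q, OF p(3) that] by (simp cong: bex_cong)
  ultimately show ?thesis using p(2) by (intro djI)
qed

lemma dj_bex0:
  assumes "dj E Wf C 0 (\<lambda>i e. Q i (e 0) (\<lambda>k. e (Suc k)))" "trm C t"
  shows "dj E Wf C 0 (\<lambda>i e. \<exists>x. E x (t i e) \<and> Q i x e)"
proof -
  obtain \<phi> p where p: "lev 0 \<phi>" "range p \<subseteq> C"
    "\<And>i e s. range e \<subseteq> Wf i \<Longrightarrow> range s \<subseteq> Wf i \<Longrightarrow>
      sat E (Wf i) (mrg e (\<lambda>k. p k i) s) \<phi> \<longleftrightarrow> Q i (e 0) (\<lambda>k. e (Suc k))"
    by (erule djE[OF assms(1)])
  obtain v c where c: "c \<in> C" and v: "\<And>p i e s. p (0::nat) = c \<Longrightarrow> mrg e (\<lambda>k. p k i) s v = t i e"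
    and v2: "v \<noteq> 2"
    using trm_index[OF assms(2), of 0] by metis
  define q where "q = case_nat c p"
  have q: "range q \<subseteq> C" "q \<circ> Suc = p" "q 0 = c" using range_case_nat[OF c p(2)] by (auto simp: q_def fun_eq_iff)
  have S: "inj Suc" by simp
  let ?\<psi> = "ren ex_map (ren (par_map Suc) \<phi>)"
  have "lev 0 (Ex 2 (And (Mem 2 v) ?\<psi>))"
    using v2 lev_ren[OF inj_ex_map lev_ren[OF inj_par_map[OF S] p(1)]]
    by (auto simp: lev_def intro: is_Delta0.intros)
  moreover have "sat E (Wf i) (mrg e (\<lambda>k. q k i) s) (Ex 2 (And (Mem 2 v) ?\<psi>)) \<longleftrightarrow>
      (\<exists>x. E x (t i e) \<and> Q i x e)"
    if es: "range e \<subseteq> Wf i" "range s \<subseteq> Wf i" for i e s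
  proof -
    have "sat E (Wf i) ((mrg e (\<lambda>k. q k i) s)(2 := x)) ?\<psi> \<longleftrightarrow> Q i x e" if "x \<in> Wf i" for x
      using sat_shift[where Q = Q, OF dj_rename_params[where P = "\<lambda>i e. Q i (e 0) (\<lambda>k. e (Suc k))", OF S p(3) q(2)] es that] by simp
    moreover have "mrg e (\<lambda>k. q k i) s v = t i e" by (rule v[where p = q, OF q(3)])
    moreover have "x \<in> Wf i" if "E x (t i e)" for x
      using that trm_in[OF assms(2) es(1)] fam_trans[of i] by (auto simp: transitive_class_def)
    ultimately show ?thesis using v2 by auto
  qed
  ultimately show ?thesis using q(1) by (intro djI)
qed

text \<open>Truncated subtraction merges two cases into one rule. Below level 2 the body has level 0
  and the bounded quantifier is free; from level 2 on it is treated like an unbounded one and costs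
  two levels.\<close>

lemma dj_bex:
  assumes "dj E Wf C (n - 2) (\<lambda>i e. Q i (e 0) (\<lambda>k. e (Suc k)))" "trm C t"
  shows "dj E Wf C n (\<lambda>i e. \<exists>x. E x (t i e) \<and> Q i x e)"
proof (cases "n < 2")
  case True
  then have "n - 2 = 0" by simp
  with assms show ?thesis by (auto intro: dj_mono dj_bex0)
next
  case False
  then have n: "n = Suc (Suc (n - 2))" by simp
  have m: "trm C (\<lambda>i e. t i (\<lambda>k. e (Suc k)))"
    using assms(2) by (auto simp: trm_def)
  have "dj E Wf C (n - 2) (\<lambda>i e. E (e 0) (t i (\<lambda>k. e (Suc k))) \<and> Q i (e 0) (\<lambda>k. e (Suc k)))"
    by (intro dj_and dj_mem trm_var m assms)
  from dj_ex[where Q = "\<lambda>i x e. E x (t i e) \<and> Q i x e", OF this] have "dj E Wf C n (\<lambda>i e. \<exists>x\<in>Wf i. E x (t i e) \<and> Q i x e)"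
    using n by simp
  moreover have "(\<exists>x\<in>Wf i. E x (t i e) \<and> Q i x e) \<longleftrightarrow> (\<exists>x. E x (t i e) \<and> Q i x e)"
    if "range e \<subseteq> Wf i" for i e
    using trm_in[OF assms(2) that] fam_trans[of i] by (auto simp: transitive_class_def)
  ultimately show ?thesis unfolding dj_def by simp
qed

lemma dj_ball:
  assumes "dj E Wf C (n - 2) (\<lambda>i e. Q i (e 0) (\<lambda>k. e (Suc k)))" "trm C t"
  shows "dj E Wf C n (\<lambda>i e. \<forall>x. E x (t i e) \<longrightarrow> Q i x e)"
  using dj_not[OF dj_bex[where Q = "\<lambda>i x e. \<not> Q i x e", OF dj_not[OF assms(1)] assms(2)]] by simp

lemma dj_Bex:
  assumes "2 \<le> n" "dj E Wf C (n - 2) (\<lambda>i e. Q i (e 0) (\<lambda>k. e (Suc k)))"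
  shows "dj E Wf C n (\<lambda>i e. \<exists>x\<in>Wf i. Q i x e)"
proof -
  have "Suc (Suc (n - 2)) = n" using assms(1) by simp
  then show ?thesis using dj_ex[where Q = Q, OF assms(2)] by simp
qed

lemma dj_Ball:
  assumes "2 \<le> n" "dj E Wf C (n - 2) (\<lambda>i e. Q i (e 0) (\<lambda>k. e (Suc k)))"
  shows "dj E Wf C n (\<lambda>i e. \<forall>x\<in>Wf i. Q i x e)"
  using dj_not[OF dj_Bex[where Q = "\<lambda>i x e. \<not> Q i x e", OF assms(1) dj_not[OF assms(2)]]] by simp

lemma dj_true: "dj E Wf C n (\<lambda>i e. True)"
  using dj_eq[OF trm_var trm_var, of n 0 0] by simp

lemmas dj_base = dj_mem dj_eq dj_not dj_and dj_or dj_imp dj_iff dj_bex dj_ball dj_Bex dj_Ball dj_true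
  trm_var trm_const

end

section \<open>Pairs, functions and ordinals\<close>

context univ
begin

lemma E_ext: "(\<And>z. E z x \<longleftrightarrow> E z y) \<Longrightarrow> x = y"
  using univ by (auto simp: set_universe_def)

lemma E_wf: "wfp E"
  using univ by (auto simp: set_universe_def)

lemma E_induct [case_names mem]: "(\<And>x. (\<And>y. E y x \<Longrightarrow> P y) \<Longrightarrow> P x) \<Longrightarrow> P x"
  by (rule wfp_induct_rule[OF E_wf]) blast

lemma E_minimal:
  assumes "P x"
  obtains m where "P m" "\<And>y. E y m \<Longrightarrow> \<not> P y"
proof -
  have "\<exists>m. P m \<and> (\<forall>y. E y m \<longrightarrow> \<not> P y)"
    using wfp_induct_rule[OF E_wf, of "\<lambda>x. \<not> P x" x] assms by blast
  then show ?thesis using that by blast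
qed

lemma E_asym: "E x y \<Longrightarrow> \<not> E y x"
  by (induction x arbitrary: y rule: E_induct) blast

lemma E_irrefl: "\<not> E x x"
  using E_asym by blast

lemma is_upair_iff: "is_upair E u x y \<longleftrightarrow> E x u \<and> E y u \<and> (\<forall>z. E z u \<longrightarrow> z = x \<or> z = y)"
  by (auto simp: is_upair_def ext_def)

lemma is_opair_iff: "is_opair E p x y \<longleftrightarrow>
    (\<exists>u. E u p \<and> (\<exists>v. E v p \<and> is_upair E u x x \<and> is_upair E v x y \<and> is_upair E p u v))"
  unfolding is_opair_def by (auto simp: is_upair_iff)

lemma is_upair_fun: "is_upair E u x y \<Longrightarrow> is_upair E v x y \<Longrightarrow> u = v"
  by (rule E_ext) (auto simp: is_upair_def ext_def)

lemma is_opair_fun: "is_opair E p x y \<Longrightarrow> is_opair E q x y \<Longrightarrow> p = q"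
  unfolding is_opair_def using is_upair_fun by blast

lemma is_opair_inj:
  assumes "is_opair E p x y" "is_opair E p x' y'"
  shows "x = x' \<and> y = y'"
proof -
  from assms obtain u v u' v' where
    "ext E u = {x}" "ext E v = {x, y}" "ext E p = {u, v}"
    "ext E u' = {x'}" "ext E v' = {x', y'}" "ext E p = {u', v'}"
    by (auto simp: is_opair_def is_upair_def)
  then show ?thesis by (metis doubleton_eq_iff singleton_insert_inj_eq)
qed

lemma is_ordinal_iff: "is_ordinal E \<alpha> \<longleftrightarrow>
    (\<forall>x. E x \<alpha> \<longrightarrow> (\<forall>y. E y x \<longrightarrow> E y \<alpha>)) \<and>
    (\<forall>x. E x \<alpha> \<longrightarrow> (\<forall>y. E y \<alpha> \<longrightarrow> E x y \<or> x = y \<or> E y x))"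
  by (auto simp: is_ordinal_def transitive_class_def ext_def)

lemma ordinal_trans: "is_ordinal E \<alpha> \<Longrightarrow> E x \<alpha> \<Longrightarrow> E y x \<Longrightarrow> E y \<alpha>"
  by (auto simp: is_ordinal_iff)

lemma ordinal_linear: "is_ordinal E \<alpha> \<Longrightarrow> E x \<alpha> \<Longrightarrow> E y \<alpha> \<Longrightarrow> E x y \<or> x = y \<or> E y x"
  by (auto simp: is_ordinal_iff)

lemma ordinal_mem:
  assumes \<alpha>: "is_ordinal E \<alpha>" and "E \<beta> \<alpha>"
  shows "is_ordinal E \<beta>"
proof -
  \<comment> \<open>Otherwise linearity of \<alpha> gives \<open>y = \<beta>\<close> or
    \<open>E \<beta> y\<close>, a membership cycle of length two or three, which well-foundedness
    excludes.\<close>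
  have "E y \<beta>" if "E x \<beta>" "E y x" for x y
    using ordinal_linear[OF \<alpha>, of y \<beta>] ordinal_trans[OF \<alpha>] assms that E_asym E_irrefl
      wfp_induct_rule[OF E_wf, of "\<lambda>b. \<not> (\<exists>x y. E x b \<and> E y x \<and> E b y)"]
    by (metis E_minimal)
  then show ?thesis
    using ordinal_linear[OF \<alpha>] ordinal_trans[OF \<alpha> assms(2)] by (auto simp: is_ordinal_iff)
qed

lemma ordinal_subset_mem:
  assumes \<alpha>: "is_ordinal E \<alpha>" and \<beta>: "is_ordinal E \<beta>" and sub: "\<And>x. E x \<alpha> \<Longrightarrow> E x \<beta>"
  shows "\<alpha> = \<beta> \<or> E \<alpha> \<beta>"
proof (cases "\<alpha> = \<beta>")
  case False
  then obtain x where "E x \<beta> \<and> \<not> E x \<alpha>" using E_ext sub by blast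
  then obtain m where m: "E m \<beta> \<and> \<not> E m \<alpha>" "\<And>y. E y m \<Longrightarrow> \<not> (E y \<beta> \<and> \<not> E y \<alpha>)"
    using E_minimal[of "\<lambda>x. E x \<beta> \<and> \<not> E x \<alpha>"] by blast
  have "m = \<alpha>"
  proof (rule E_ext)
    fix z show "E z m \<longleftrightarrow> E z \<alpha>"
    proof
      assume "E z m" then show "E z \<alpha>" using m ordinal_trans[OF \<beta>] by blast
    next
      assume "E z \<alpha>"
      then show "E z m" using ordinal_linear[OF \<beta>, of z m] sub m ordinal_trans[OF \<alpha>] by blast
    qed
  qed
  then show ?thesis using m by blast
qed simp

lemma ordinal_total:
  assumes "is_ordinal E \<alpha>" "is_ordinal E \<beta>"
  shows "E \<alpha> \<beta> \<or> \<alpha> = \<beta> \<or> E \<beta> \<alpha>"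
  using assms
proof (induction \<alpha> arbitrary: \<beta> rule: E_induct)
  case (mem \<alpha>)
  show ?case
  proof (cases "\<forall>x. E x \<alpha> \<longrightarrow> E x \<beta>")
    case True then show ?thesis using ordinal_subset_mem mem.prems by blast
  next
    case False
    then obtain x where "E x \<alpha>" "\<not> E x \<beta>" by blast
    then show ?thesis
      using mem.IH[OF \<open>E x \<alpha>\<close> ordinal_mem[OF mem.prems(1) \<open>E x \<alpha>\<close>] mem.prems(2)]
        ordinal_trans[OF mem.prems(1)] by blast
  qed
qed

lemma ordinalI:
  assumes "\<And>x. E x \<alpha> \<Longrightarrow> is_ordinal E x" "\<And>x y. E x \<alpha> \<Longrightarrow> E y x \<Longrightarrow> E y \<alpha>"
  shows "is_ordinal E \<alpha>"
  unfolding is_ordinal_iff[of \<alpha>] using assms(2) ordinal_total[OF assms(1) assms(1)] by metis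

text \<open>Forms of the basic notions with bounded quantifiers only, which show that they are \<open>\<Delta>\<close>-0.\<close>

lemma maps_toI: "E p f \<Longrightarrow> is_opair E p x y \<Longrightarrow> maps_to E f x y"
  by (auto simp: maps_to_def)

lemma is_function_iff: "is_function E f a (ext E b) \<longleftrightarrow>
    (\<forall>p. E p f \<longrightarrow> (\<exists>x. E x a \<and> (\<exists>y. E y b \<and> is_opair E p x y))) \<and>
    (\<forall>x. E x a \<longrightarrow> (\<exists>y. E y b \<and> maps_to E f x y \<and> (\<forall>y'. E y' b \<longrightarrow> maps_to E f x y' \<longrightarrow> y' = y)))"
  (is "?L \<longleftrightarrow> ?R1 \<and> ?R2")
proof -
  have *: "E x a \<and> E y b" if "?R1" "maps_to E f x y" for x y
    using that is_opair_inj unfolding maps_to_def by metis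
  show ?thesis
  proof
    assume ?L
    then have 1: ?R1 by (auto simp: is_function_def ext_def)
    moreover have ?R2
      using \<open>?L\<close> *[OF 1] unfolding is_function_def by metis
    ultimately show "?R1 \<and> ?R2" by blast
  next
    assume R: "?R1 \<and> ?R2"
    then have "\<exists>!y. maps_to E f x y" if "E x a" for x
      using *[of x] that by metis
    then show ?L using R by (auto simp: is_function_def ext_def)
  qed
qed

lemma is_function_maps: "is_function E f a B \<Longrightarrow> maps_to E f x y \<Longrightarrow> E x a \<and> y \<in> B"
  unfolding is_function_def maps_to_def using is_opair_inj by metis

lemma is_function_unique: "is_function E f a B \<Longrightarrow> maps_to E f x y \<Longrightarrow> maps_to E f x y' \<Longrightarrow> y = y'"
  using is_function_maps[of f a B x y] unfolding is_function_def by metis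

lemma is_function_ex: "is_function E f a B \<Longrightarrow> E x a \<Longrightarrow> \<exists>y. maps_to E f x y \<and> y \<in> B"
proof -
  assume f: "is_function E f a B" and "E x a"
  then have "\<exists>!y. maps_to E f x y" by (simp add: is_function_def)
  then show ?thesis using is_function_maps[OF f] by blast
qed

lemma is_functionI:
  assumes "\<And>p. E p f \<Longrightarrow> \<exists>x y. E x a \<and> y \<in> B \<and> is_opair E p x y"
    and "\<And>x. E x a \<Longrightarrow> \<exists>y. maps_to E f x y"
    and "\<And>x y y'. maps_to E f x y \<Longrightarrow> maps_to E f x y' \<Longrightarrow> y = y'"
  shows "is_function E f a B"
  using assms unfolding is_function_def by blast

lemma is_bijection_iff: "is_bijection E f a b \<longleftrightarrow> is_function E f a (ext E b) \<and>
    (\<forall>y. E y b \<longrightarrow> (\<exists>x. E x a \<and> maps_to E f x y \<and> (\<forall>x'. E x' a \<longrightarrow> maps_to E f x' y \<longrightarrow> x' = x)))"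
proof -
  have "is_function E f a (ext E b) \<Longrightarrow> maps_to E f x y \<Longrightarrow> E x a" for x y
    using is_function_maps by blast
  then show ?thesis unfolding is_bijection_def by metis
qed

definition is_rel :: "'a \<Rightarrow> bool" where
  "is_rel f \<longleftrightarrow> (\<forall>p. E p f \<longrightarrow> (\<exists>x y. is_opair E p x y))"

lemma is_rel_eqI:
  assumes "is_rel f" "is_rel g" "\<And>x y. maps_to E f x y \<longleftrightarrow> maps_to E g x y"
  shows "f = g"
proof (rule E_ext)
  fix p show "E p f \<longleftrightarrow> E p g"
    using assms is_opair_fun unfolding is_rel_def maps_to_def by metis
qed

end

context dj_family
begin

lemma trm_shift: "trm C t \<Longrightarrow> trm C (\<lambda>i e. t i (\<lambda>k. e (Suc k)))"
  by (auto simp: trm_def)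

lemma dj_upair:
  assumes "trm C t1" "trm C t2" "trm C t3"
  shows "dj E Wf C n (\<lambda>i e. is_upair E (t1 i e) (t2 i e) (t3 i e))"
  unfolding is_upair_iff using assms
  by (intro dj_base trm_shift)

lemma dj_opair:
  assumes "trm C t1" "trm C t2" "trm C t3"
  shows "dj E Wf C n (\<lambda>i e. is_opair E (t1 i e) (t2 i e) (t3 i e))"
  unfolding is_opair_iff using assms
  by (intro dj_base dj_upair trm_shift)

lemma dj_maps:
  assumes "trm C t1" "trm C t2" "trm C t3"
  shows "dj E Wf C n (\<lambda>i e. maps_to E (t1 i e) (t2 i e) (t3 i e))"
  unfolding maps_to_def using assms
  by (intro dj_base dj_opair trm_shift)

lemma dj_ordinal:
  assumes "trm C t1"
  shows "dj E Wf C n (\<lambda>i e. is_ordinal E (t1 i e))"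
  unfolding is_ordinal_iff using assms
  by (intro dj_base trm_shift)

lemma dj_function:
  assumes "trm C t1" "trm C t2" "trm C t3"
  shows "dj E Wf C n (\<lambda>i e. is_function E (t1 i e) (t2 i e) (ext E (t3 i e)))"
  unfolding is_function_iff using assms
  by (intro dj_base dj_opair dj_maps trm_shift)

lemma dj_bijection:
  assumes "trm C t1" "trm C t2" "trm C t3"
  shows "dj E Wf C n (\<lambda>i e. is_bijection E (t1 i e) (t2 i e) (t3 i e))"
  unfolding is_bijection_iff using assms
  by (intro dj_base dj_function dj_maps trm_shift)

lemmas dj_rules = dj_opair dj_maps dj_ordinal dj_function dj_bijection dj_base

end

section \<open>Transitive models of the fragment\<close>

locale mst = univ E
  for E :: "'a \<Rightarrow> 'a \<Rightarrow> bool" +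
  fixes W :: "'a set"
  assumes model: "model_of_set_theory E W"
begin

lemma W_trans: "x \<in> W \<Longrightarrow> E y x \<Longrightarrow> y \<in> W"
  using model by (auto simp: model_of_set_theory_def transitive_class_def)

lemma zfc: "zfc_axioms_for E {\<phi>. is_Sigma 100 \<phi>} W"
  using model by (auto simp: model_of_set_theory_def)

sublocale dj_family E "\<lambda>_::unit. W" "{c. c () \<in> W}"
proof
  show "transitive_class E W" using model by (simp add: model_of_set_theory_def)
  obtain w where "w \<in> W" using zfc by (auto simp: zfc_axioms_for_def ax_infinity_def)
  then show "{c::unit \<Rightarrow> 'a. c () \<in> W} \<noteq> {}" by (auto intro: exI[of _ "\<lambda>_. w"])
qed auto

abbreviation df :: "nat \<Rightarrow> ((nat \<Rightarrow> 'a) \<Rightarrow> bool) \<Rightarrow> bool" where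
  "df n P \<equiv> dj E (\<lambda>_::unit. W) {c. c () \<in> W} n (\<lambda>_. P)"

lemma lev_Sigma_100: "lev n \<phi> \<Longrightarrow> n \<le> 100 \<Longrightarrow> is_Sigma 100 \<phi>"
  using lev_mono[of n \<phi> 100] by (simp add: lev_def)

text \<open>
  The level 60 here, and the smaller levels demanded of predicates further on, only leave room below
  100 for the quantifiers that each construction adds.
\<close>

lemma sep:
  assumes "df 60 (\<lambda>e. Q (e 0))" "a \<in> W"
  shows "\<exists>b\<in>W. \<forall>x. E x b \<longleftrightarrow> E x a \<and> Q x"
proof -
  obtain \<phi> p where p: "lev 60 \<phi>" "range p \<subseteq> {c. c () \<in> W}"
    "\<And>i e s. range e \<subseteq> W \<Longrightarrow> range s \<subseteq> W \<Longrightarrow>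
      sat E W (mrg e (\<lambda>k. p k i) s) \<phi> \<longleftrightarrow> Q (e 0)"
    by (erule djE[OF assms(1)])
  define e where "e = mrg (\<lambda>_. a) (\<lambda>k. p k ()) (\<lambda>_. a)"
  have "range e \<subseteq> W"
    using p(2) assms(2) by (auto simp: e_def mrg_def)
  moreover have "\<phi> \<in> {\<phi>. is_Sigma 100 \<phi>}" using lev_Sigma_100[OF p(1)] by simp
  moreover have "ax_separation E {\<phi>. is_Sigma 100 \<phi>} W" using zfc by (simp add: zfc_axioms_for_def)
  ultimately obtain b where b: "b \<in> W" "\<forall>x\<in>W. E x b \<longleftrightarrow> E x a \<and> sat E W (e(0 := x)) \<phi>"
    using assms(2) unfolding ax_separation_def by blast
  have "e(0 := x) = mrg ((\<lambda>_. a)(0 := x)) (\<lambda>k. p k ()) (\<lambda>_. a)" for x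
    by (auto simp: e_def mrg_def fun_eq_iff)
  then have "sat E W (e(0 := x)) \<phi> \<longleftrightarrow> Q x" if "x \<in> W" for x
    using p(3)[of "(\<lambda>_. a)(0 := x)" "\<lambda>_. a" "()"] that assms(2) by auto
  then show ?thesis using b W_trans assms(2) by blast
qed

lemma repl:
  assumes "df 60 (\<lambda>e. Q (e 0) (e 1))" "a \<in> W"
    and func: "\<And>x y y'. E x a \<Longrightarrow> y \<in> W \<Longrightarrow> y' \<in> W \<Longrightarrow> Q x y \<Longrightarrow> Q x y' \<Longrightarrow> y = y'"
  shows "\<exists>b\<in>W. \<forall>y. E y b \<longleftrightarrow> y \<in> W \<and> (\<exists>x. E x a \<and> Q x y)"
proof -
  obtain \<phi> p where p: "lev 60 \<phi>" "range p \<subseteq> {c. c () \<in> W}"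
    "\<And>i e s. range e \<subseteq> W \<Longrightarrow> range s \<subseteq> W \<Longrightarrow>
      sat E W (mrg e (\<lambda>k. p k i) s) \<phi> \<longleftrightarrow> Q (e 0) (e 1)"
    by (erule djE[OF assms(1)])
  \<comment> \<open>Replacement reads its second argument from variable 1, whereas argument 1 of a
    merged assignment sits at variable 3; \<tau> exchanges the two.\<close>
  define \<tau> where "\<tau> = (\<lambda>k::nat. if k = 1 then 3 else if k = 3 then 1 else k)"
  have inj: "inj \<tau>" by (auto simp: \<tau>_def inj_def)
  define e where "e = mrg (\<lambda>_. a) (\<lambda>k. p k ()) (\<lambda>_. a) \<circ> \<tau>"
  have "range e \<subseteq> W"
    using p(2) assms(2) by (auto simp: e_def mrg_def)
  moreover have "ren \<tau> \<phi> \<in> {\<phi>. is_Sigma 100 \<phi>}" using lev_Sigma_100[OF lev_ren[OF inj p(1)]] by simp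
  moreover have "ax_replacement E {\<phi>. is_Sigma 100 \<phi>} W" using zfc by (simp add: zfc_axioms_for_def)
  ultimately have *: "(\<forall>x\<in>W. E x a \<longrightarrow> (\<forall>y\<in>W. \<forall>y'\<in>W.
            sat E W (e(0 := x, 1 := y)) (ren \<tau> \<phi>) \<and> sat E W (e(0 := x, 1 := y')) (ren \<tau> \<phi>) \<longrightarrow> y = y')) \<longrightarrow>
         (\<exists>b\<in>W. \<forall>y\<in>W. E y b \<longleftrightarrow> (\<exists>x\<in>W. E x a \<and> sat E W (e(0 := x, 1 := y)) (ren \<tau> \<phi>)))"
    using assms(2) unfolding ax_replacement_def by blast
  have eq: "(e(0 := x, 1 := y)) \<circ> \<tau> = mrg ((\<lambda>_. a)(0 := x, 1 := y)) (\<lambda>k. p k ()) (\<lambda>_. a)" for x y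
  proof (rule mrg_eqI)
    fix k
    have *: "((e(0 := x, 1 := y)) \<circ> \<tau>) n =
        (if n = 0 then x else if n = 3 then y else mrg (\<lambda>_. a) (\<lambda>k. p k ()) (\<lambda>_. a) n)" for n
      by (auto simp: e_def \<tau>_def)
    have n3: "Suc (3 * k) \<noteq> 3" "Suc (Suc (3 * k)) \<noteq> 3" by presburger+
    show "((e(0 := x, 1 := y)) \<circ> \<tau>) (3 * k) = ((\<lambda>_. a)(0 := x, 1 := y)) k"
      unfolding * by simp
    show "((e(0 := x, 1 := y)) \<circ> \<tau>) (Suc (3 * k)) = p k ()"
      unfolding * using n3 by simp
    show "((e(0 := x, 1 := y)) \<circ> \<tau>) (Suc (Suc (3 * k))) = a"
      unfolding * using n3 by simp
  qed
  have "sat E W (e(0 := x, 1 := y)) (ren \<tau> \<phi>) \<longleftrightarrow> Q x y" if "x \<in> W" "y \<in> W" for x y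
    unfolding sat_ren[OF inj] eq
    using p(3)[of "(\<lambda>_. a)(0 := x, 1 := y)" "\<lambda>_. a" "()"] that assms(2) by auto
  with * func have "\<exists>b\<in>W. \<forall>y\<in>W. E y b \<longleftrightarrow> (\<exists>x\<in>W. E x a \<and> Q x y)" by auto
  then obtain b where b: "b \<in> W" "\<And>y. y \<in> W \<Longrightarrow> E y b \<longleftrightarrow> (\<exists>x\<in>W. E x a \<and> Q x y)" by blast
  have "E y b \<longleftrightarrow> y \<in> W \<and> (\<exists>x. E x a \<and> Q x y)" for y
    using b W_trans[OF b(1), of y] W_trans[OF assms(2)] by metis
  then show ?thesis using b(1) by blast
qed

end

section \<open>Definable binary relations\<close>

context dj_family
begin

text \<open>Stated for all terms, so that a relation handed to a construction can be used under
  further quantifiers, where its arguments have been shifted.\<close>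

definition def2 :: "nat \<Rightarrow> ('a \<Rightarrow> 'a \<Rightarrow> bool) \<Rightarrow> bool" where
  "def2 n Q \<longleftrightarrow> (\<forall>t1 t2. trm C t1 \<longrightarrow> trm C t2 \<longrightarrow> dj E Wf C n (\<lambda>i e. Q (t1 i e) (t2 i e)))"

lemma def2I: "(\<And>t1 t2. trm C t1 \<Longrightarrow> trm C t2 \<Longrightarrow> dj E Wf C n (\<lambda>i e. Q (t1 i e) (t2 i e))) \<Longrightarrow> def2 n Q"
  by (simp add: def2_def)

lemma def2D: "def2 n Q \<Longrightarrow> n \<le> m \<Longrightarrow> trm C t1 \<Longrightarrow> trm C t2 \<Longrightarrow> dj E Wf C m (\<lambda>i e. Q (t1 i e) (t2 i e))"
  unfolding def2_def by (rule dj_mono) simp_all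

end

section \<open>Elementary set constructions inside a model\<close>

context mst
begin

lemma W_eqI: "x \<in> W \<Longrightarrow> y \<in> W \<Longrightarrow> (\<And>z. z \<in> W \<Longrightarrow> E z x \<longleftrightarrow> E z y) \<Longrightarrow> x = y"
  using E_ext W_trans by meson

lemma ex_empty: "\<exists>z\<in>W. \<forall>x. \<not> E x z"
proof -
  have "ax_infinity E W" using zfc by (simp add: zfc_axioms_for_def)
  then obtain x where "x \<in> W" "\<forall>z\<in>W. \<not> E z x" unfolding ax_infinity_def by blast
  then show ?thesis using W_trans by blast
qed

lemma ex_pair:
  assumes "x \<in> W" "y \<in> W"
  shows "\<exists>u\<in>W. \<forall>z. E z u \<longleftrightarrow> z = x \<or> z = y"
proof -
  have "ax_pairing E W" using zfc by (simp add: zfc_axioms_for_def)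
  then obtain u where "u \<in> W" "\<forall>z\<in>W. E z u \<longleftrightarrow> z = x \<or> z = y"
    using assms unfolding ax_pairing_def by blast
  then show ?thesis using W_trans assms by blast
qed

lemma ex_union:
  assumes "x \<in> W"
  shows "\<exists>u\<in>W. \<forall>z. E z u \<longleftrightarrow> (\<exists>y. E y x \<and> E z y)"
proof -
  have "ax_union E W" using zfc by (simp add: zfc_axioms_for_def)
  then obtain u where u: "u \<in> W" "\<forall>z\<in>W. E z u \<longleftrightarrow> (\<exists>y\<in>W. E y x \<and> E z y)"
    using assms unfolding ax_union_def by blast
  have "E z u \<longleftrightarrow> (\<exists>y. E y x \<and> E z y)" for z
    using u W_trans[OF u(1)] W_trans[OF assms] W_trans by metis
  then show ?thesis using u(1) by blast
qed

lemma ex_power: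
  assumes "x \<in> W"
  shows "\<exists>u\<in>W. \<forall>z. E z u \<longleftrightarrow> z \<in> W \<and> (\<forall>y. E y z \<longrightarrow> E y x)"
proof -
  have "ax_power E W" using zfc by (simp add: zfc_axioms_for_def)
  then obtain u where u: "u \<in> W" "\<forall>z\<in>W. E z u \<longleftrightarrow> (\<forall>y\<in>W. E y z \<longrightarrow> E y x)"
    using assms unfolding ax_power_def by blast
  have "E z u \<longleftrightarrow> z \<in> W \<and> (\<forall>y. E y z \<longrightarrow> E y x)" for z
    using u W_trans[OF u(1)] W_trans[of z] by metis
  then show ?thesis using u(1) by blast
qed

lemma ex_un:
  assumes "x \<in> W" "y \<in> W"
  shows "\<exists>u\<in>W. \<forall>z. E z u \<longleftrightarrow> E z x \<or> E z y"
proof -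
  obtain p where "p \<in> W" "\<forall>z. E z p \<longleftrightarrow> z = x \<or> z = y" using ex_pair[OF assms] by blast
  then show ?thesis using ex_union[of p] by metis
qed

lemma ex_singleton: "x \<in> W \<Longrightarrow> \<exists>u\<in>W. \<forall>z. E z u \<longleftrightarrow> z = x"
  using ex_pair[of x x] by auto

lemma ex_insert:
  assumes "x \<in> W" "y \<in> W"
  shows "\<exists>u\<in>W. \<forall>z. E z u \<longleftrightarrow> E z x \<or> z = y"
  using ex_singleton[OF assms(2)] ex_un[OF assms(1)] by metis

lemma ex_opair:
  assumes "x \<in> W" "y \<in> W"
  shows "\<exists>p\<in>W. is_opair E p x y"
proof -
  obtain u where u: "u \<in> W" "\<forall>z. E z u \<longleftrightarrow> z = x \<or> z = x" using ex_pair[OF assms(1,1)] by blast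
  obtain v where v: "v \<in> W" "\<forall>z. E z v \<longleftrightarrow> z = x \<or> z = y" using ex_pair[OF assms] by blast
  obtain p where p: "p \<in> W" "\<forall>z. E z p \<longleftrightarrow> z = u \<or> z = v" using ex_pair[OF u(1) v(1)] by blast
  have "is_opair E p x y"
    unfolding is_opair_def by (rule exI[of _ u], rule exI[of _ v]) (use u v p in \<open>auto simp: is_upair_iff\<close>)
  then show ?thesis using p by blast
qed

lemma opair_in: "is_opair E p x y \<Longrightarrow> x \<in> W \<Longrightarrow> y \<in> W \<Longrightarrow> p \<in> W"
  using ex_opair is_opair_fun by blast

lemma opair_comp:
  assumes "is_opair E p x y" "p \<in> W"
  shows "x \<in> W \<and> y \<in> W"
proof -
  obtain u v where "E u p" "E v p" "E x v" "E y v"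
    using assms(1) unfolding is_opair_iff is_upair_iff by blast
  then show ?thesis using W_trans[OF W_trans[OF assms(2)]] by blast
qed

lemma maps_to_in:
  assumes "maps_to E f x y" "f \<in> W"
  shows "x \<in> W \<and> y \<in> W"
proof -
  obtain p where "E p f" "is_opair E p x y" using assms(1) unfolding maps_to_def by blast
  then show ?thesis using opair_comp W_trans[OF assms(2)] by blast
qed

lemma ex_prod:
  assumes "a \<in> W" "b \<in> W"
  shows "\<exists>u\<in>W. \<forall>p. E p u \<longleftrightarrow> (\<exists>x. E x a \<and> (\<exists>y. E y b \<and> is_opair E p x y))"
proof -
  obtain c where c: "c \<in> W" "\<forall>z. E z c \<longleftrightarrow> E z a \<or> E z b" using ex_un[OF assms] by blast
  obtain d where d: "d \<in> W" "\<forall>z. E z d \<longleftrightarrow> z \<in> W \<and> (\<forall>y. E y z \<longrightarrow> E y c)" using ex_power[OF c(1)] by blast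
  obtain d' where d': "d' \<in> W" "\<forall>z. E z d' \<longleftrightarrow> z \<in> W \<and> (\<forall>y. E y z \<longrightarrow> E y d)" using ex_power[OF d(1)] by blast
  have "\<exists>u\<in>W. \<forall>p. E p u \<longleftrightarrow> E p d' \<and> (\<exists>x. E x a \<and> (\<exists>y. E y b \<and> is_opair E p x y))"
    by (rule sep[OF _ d'(1)]) (intro dj_rules | simp add: assms)+
  moreover have "E p d'" if xy: "E x a" "E y b" "is_opair E p x y" for p x y
  proof -
    have W: "x \<in> W" "y \<in> W" "p \<in> W" using that W_trans assms opair_in by blast+
    obtain u v where uv: "is_upair E u x x" "is_upair E v x y" "is_upair E p u v"
      using xy(3) unfolding is_opair_def by blast
    then have "u \<in> W" "v \<in> W" using W W_trans unfolding is_upair_iff by blast+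
    then have "E u d" "E v d" using d(2) c(2) uv xy(1,2) by (auto simp: is_upair_iff)
    then show ?thesis using d'(2) uv W by (auto simp: is_upair_iff)
  qed
  ultimately show ?thesis by blast
qed

lemma ex_rel:
  assumes "def2 40 Q" "a \<in> W" "b \<in> W"
  shows "\<exists>f\<in>W. (\<forall>p. E p f \<longrightarrow> (\<exists>x y. E x a \<and> E y b \<and> is_opair E p x y)) \<and>
    (\<forall>x y. maps_to E f x y \<longleftrightarrow> E x a \<and> E y b \<and> Q x y)"
proof -
  obtain u where u: "u \<in> W" "\<forall>p. E p u \<longleftrightarrow> (\<exists>x. E x a \<and> (\<exists>y. E y b \<and> is_opair E p x y))"
    using ex_prod[OF assms(2,3)] by blast
  have "\<exists>f\<in>W. \<forall>p. E p f \<longleftrightarrow> E p u \<and> (\<exists>x. E x a \<and> (\<exists>y. E y b \<and> (is_opair E p x y \<and> Q x y)))"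
    by (rule sep[OF _ u(1)]) (intro dj_rules def2D[OF assms(1)] | simp add: assms)+
  then obtain f where f: "f \<in> W"
    "\<And>p. E p f \<longleftrightarrow> E p u \<and> (\<exists>x. E x a \<and> (\<exists>y. E y b \<and> (is_opair E p x y \<and> Q x y)))" by blast
  have "maps_to E f x y \<longleftrightarrow> E x a \<and> E y b \<and> Q x y" for x y
  proof
    assume "maps_to E f x y"
    then show "E x a \<and> E y b \<and> Q x y" using f(2) is_opair_inj unfolding maps_to_def by metis
  next
    assume A: "E x a \<and> E y b \<and> Q x y"
    then obtain p where "is_opair E p x y" using ex_opair W_trans assms(2,3) by blast
    then show "maps_to E f x y" using f(2) u(2) A unfolding maps_to_def by blast
  qed
  moreover have "\<exists>x y. E x a \<and> E y b \<and> is_opair E p x y" if "E p f" for p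
    using that f(2)[of p] by auto
  ultimately show ?thesis by (intro bexI[OF _ f(1)]) auto
qed

lemma ex_dom:
  assumes "f \<in> W"
  shows "\<exists>d\<in>W. \<forall>x. E x d \<longleftrightarrow> (\<exists>y. maps_to E f x y)"
proof -
  have "\<exists>d\<in>W. \<forall>x. E x d \<longleftrightarrow> x \<in> W \<and> (\<exists>p. E p f \<and> (\<exists>y\<in>W. is_opair E p x y))"
  proof (rule repl[OF _ assms])
    show "df 60 (\<lambda>e. \<exists>y\<in>W. is_opair E (e 0) (e 1) y)"
      by (intro dj_rules | simp)+
    show "x = x'" if "\<exists>y\<in>W. is_opair E p x y" "\<exists>y\<in>W. is_opair E p x' y" for p x x'
      using that is_opair_inj by blast
  qed
  then obtain d where d: "d \<in> W" "\<And>x. E x d \<longleftrightarrow> x \<in> W \<and> (\<exists>p. E p f \<and> (\<exists>y\<in>W. is_opair E p x y))" by blast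
  have "E x d \<longleftrightarrow> (\<exists>y. maps_to E f x y)" for x
  proof
    assume "E x d" then show "\<exists>y. maps_to E f x y" using d(2) unfolding maps_to_def by blast
  next
    assume "\<exists>y. maps_to E f x y"
    then obtain y p where "E p f" "is_opair E p x y" "x \<in> W" "y \<in> W"
      using maps_to_in[OF _ assms] unfolding maps_to_def by blast
    then show "E x d" using d(2) by blast
  qed
  then show ?thesis using d(1) by blast
qed

lemma ex_ran:
  assumes "f \<in> W"
  shows "\<exists>d\<in>W. \<forall>y. E y d \<longleftrightarrow> (\<exists>x. maps_to E f x y)"
proof -
  have "\<exists>d\<in>W. \<forall>y. E y d \<longleftrightarrow> y \<in> W \<and> (\<exists>p. E p f \<and> (\<exists>x\<in>W. is_opair E p x y))"
  proof (rule repl[OF _ assms])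
    show "df 60 (\<lambda>e. \<exists>x\<in>W. is_opair E (e 0) x (e 1))"
      by (intro dj_rules | simp)+
    show "y = y'" if "\<exists>x\<in>W. is_opair E p x y" "\<exists>x\<in>W. is_opair E p x y'" for p y y'
      using that is_opair_inj by blast
  qed
  then obtain d where d: "d \<in> W" "\<And>y. E y d \<longleftrightarrow> y \<in> W \<and> (\<exists>p. E p f \<and> (\<exists>x\<in>W. is_opair E p x y))" by blast
  have "E y d \<longleftrightarrow> (\<exists>x. maps_to E f x y)" for y
  proof
    assume "E y d" then show "\<exists>x. maps_to E f x y" using d(2) unfolding maps_to_def by blast
  next
    assume "\<exists>x. maps_to E f x y"
    then obtain x p where "E p f" "is_opair E p x y" "x \<in> W" "y \<in> W"
      using maps_to_in[OF _ assms] unfolding maps_to_def by blast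
    then show "E y d" using d(2) by blast
  qed
  then show ?thesis using d(1) by blast
qed

section \<open>Recursion\<close>

text \<open>The value \<open>y\<close> is the union of the sets \<open>{v. H v q}\<close> over the
  values \<open>q\<close> of \<open>f\<close> at the \<open>r\<close>-predecessors of
  \<open>x\<close> in \<open>D\<close>.\<close>

definition rec_step :: "'a \<Rightarrow> ('a \<Rightarrow> 'a \<Rightarrow> bool) \<Rightarrow> ('a \<Rightarrow> 'a \<Rightarrow> bool) \<Rightarrow> 'a \<Rightarrow> 'a \<Rightarrow> 'a \<Rightarrow> bool" where
  "rec_step D r H f x y \<longleftrightarrow>
     (\<forall>v\<in>W. E v y \<longleftrightarrow> (\<exists>z. E z D \<and> (r z x \<and> (\<exists>q\<in>W. maps_to E f z q \<and> H v q))))"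

text \<open>An attempt in the usual proof of recursion: its domain is closed under
  \<open>r\<close>-predecessors in \<open>D\<close>. Single-valuedness is not demanded, as it
  follows from \<open>rec_good_agree\<close> with both attempts equal.\<close>

definition rec_good :: "'a \<Rightarrow> ('a \<Rightarrow> 'a \<Rightarrow> bool) \<Rightarrow> ('a \<Rightarrow> 'a \<Rightarrow> bool) \<Rightarrow> 'a \<Rightarrow> bool" where
  "rec_good D r H f \<longleftrightarrow> (\<forall>x\<in>W. \<forall>y\<in>W. maps_to E f x y \<longrightarrow>
     E x D \<and> rec_step D r H f x y \<and> (\<forall>z. E z D \<longrightarrow> r z x \<longrightarrow> (\<exists>q\<in>W. maps_to E f z q)))"

lemma rec_goodD:
  assumes "rec_good D r H f" "f \<in> W" "maps_to E f x y"
  shows "E x D" "rec_step D r H f x y" "\<And>z. E z D \<Longrightarrow> r z x \<Longrightarrow> \<exists>q\<in>W. maps_to E f z q"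
  using assms maps_to_in[OF assms(3,2)] unfolding rec_good_def by blast+

lemma rec_step_fun:
  assumes "rec_step D r H f x y" "rec_step D r H f' x y'" "y \<in> W" "y' \<in> W"
    and "\<And>z q. E z D \<Longrightarrow> r z x \<Longrightarrow> maps_to E f z q \<longleftrightarrow> maps_to E f' z q"
  shows "y = y'"
proof (rule W_eqI[OF assms(3,4)])
  fix v assume "v \<in> W"
  then show "E v y \<longleftrightarrow> E v y'" using assms(1,2,5) unfolding rec_step_def by auto
qed

lemma rec_good_agree:
  assumes wf: "wfp (\<lambda>x y. E x D \<and> E y D \<and> r x y)"
    and f: "rec_good D r H f" "f \<in> W" and g: "rec_good D r H g" "g \<in> W"
  shows "maps_to E f x y \<Longrightarrow> maps_to E g x y' \<Longrightarrow> y = y'"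
proof (induction x arbitrary: y y' rule: wfp_induct_rule[OF wf])
  case (1 x)
  note fD = rec_goodD[OF f 1(2)] and gD = rec_goodD[OF g 1(3)]
  have "maps_to E f z q \<longleftrightarrow> maps_to E g z q" if z: "E z D" "r z x" for z q
  proof -
    obtain a b where ab: "maps_to E f z a" "maps_to E g z b"
      using fD(3)[OF z] gD(3)[OF z] by blast
    have IH: "c = d" if "maps_to E f z c" "maps_to E g z d" for c d
      using 1(1)[of z c d] z fD(1) that by blast
    show ?thesis using IH[of a b] IH[of q b] IH[of a q] ab by auto
  qed
  then show ?case
    using rec_step_fun[OF fD(2) gD(2)] maps_to_in[OF 1(2) f(2)] maps_to_in[OF 1(3) g(2)] by blast
qed

text \<open>
  The operation \<open>q \<mapsto> {v. H v q}\<close> is \<open>{q}\<close> for the Mostowski collapse, \<open>q \<union> {q}\<close> for the rank and the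
  power set of \<open>q\<close> for the cumulative hierarchy.
\<close>

theorem recursion:
  assumes D: "D \<in> W" and wf: "wfp (\<lambda>x y. E x D \<and> E y D \<and> r x y)"
    and r: "def2 20 r" and H: "def2 20 H"
    and Hset: "\<And>q. q \<in> W \<Longrightarrow> \<exists>h\<in>W. \<forall>v\<in>W. E v h \<longleftrightarrow> H v q"
  shows "\<exists>g G. G \<in> W \<and> is_rel G \<and> (\<forall>x y. maps_to E G x y \<longleftrightarrow> E x D \<and> y = g x) \<and>
    (\<forall>x. E x D \<longrightarrow> g x \<in> W \<and> (\<forall>v\<in>W. E v (g x) \<longleftrightarrow> (\<exists>z. E z D \<and> r z x \<and> H v (g z))))"
proof -
  let ?good = "rec_good D r H"
  define R where "R x y \<longleftrightarrow> (\<exists>f\<in>W. ?good f \<and> maps_to E f x y)" for x y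
  have Rfun: "y = y'" if "R x y" "R x y'" for x y y'
    using that rec_good_agree[OF wf] unfolding R_def by blast
  have RW: "x \<in> W" "y \<in> W" "E x D" if "R x y" for x y
    using that maps_to_in rec_goodD(1) unfolding R_def by blast+
  have "\<exists>G\<in>W. \<forall>p. E p G \<longleftrightarrow> p \<in> W \<and> (\<exists>x. E x D \<and> (\<exists>y\<in>W. is_opair E p x y \<and> R x y))"
  proof (rule repl[OF _ D])
    show "df 60 (\<lambda>e. \<exists>y\<in>W. is_opair E (e 1) (e 0) y \<and> R (e 0) y)"
      unfolding R_def rec_good_def rec_step_def
      by (intro dj_rules def2D[OF r] def2D[OF H] | simp add: D)+
    show "p = p'" if "\<exists>y\<in>W. is_opair E p x y \<and> R x y" "\<exists>y\<in>W. is_opair E p' x y \<and> R x y" for x p p'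
      using that Rfun is_opair_fun by blast
  qed
  then obtain G where G: "G \<in> W"
    and GI: "\<And>p. E p G \<longleftrightarrow> p \<in> W \<and> (\<exists>x. E x D \<and> (\<exists>y\<in>W. is_opair E p x y \<and> R x y))" by blast
  have Gmap: "maps_to E G x y \<longleftrightarrow> R x y" for x y
  proof
    assume "maps_to E G x y"
    then obtain p where "E p G" "is_opair E p x y" unfolding maps_to_def by blast
    then show "R x y" using GI[of p] is_opair_inj by blast
  next
    assume R: "R x y"
    obtain p where p: "p \<in> W" "is_opair E p x y" using ex_opair RW[OF R] by blast
    then have "E p G" using GI[of p] RW[OF R] R by blast
    then show "maps_to E G x y" using p(2) by (rule maps_toI)
  qed
  have Ggood: "?good G"
    unfolding rec_good_def
  proof (intro ballI impI conjI allI)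
    fix x y assume "maps_to E G x y"
    then obtain f where f: "f \<in> W" "?good f" "maps_to E f x y"
      unfolding Gmap R_def by blast
    note fD = rec_goodD[OF f(2,1,3)]
    show "E x D" by (rule fD(1))
    have eq: "maps_to E f z q \<longleftrightarrow> maps_to E G z q" if z: "E z D" "r z x" for z q
    proof
      assume "maps_to E f z q" then show "maps_to E G z q" using f unfolding Gmap R_def by blast
    next
      assume q: "maps_to E G z q"
      obtain q' where q': "maps_to E f z q'" using fD(3)[OF z] by blast
      then have "R z q'" using f unfolding R_def by blast
      then have "q = q'" using q Rfun unfolding Gmap by blast
      then show "maps_to E f z q" using q' by simp
    qed
    then show "\<exists>q\<in>W. maps_to E G z q" if "E z D" "r z x" for z
      using fD(3)[OF that] that by blast
    show "rec_step D r H G x y"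
      using fD(2) eq unfolding rec_step_def by (metis (no_types, lifting))
  qed
  have total: "\<exists>y. maps_to E G x y" if "E x D" for x
    using that
  proof (induction x rule: wfp_induct_rule[OF wf])
    case (1 x)
    show ?case
    proof (rule ccontr)
      assume no: "\<not> (\<exists>y. maps_to E G x y)"
      have IH: "\<exists>q. maps_to E G z q" if "E z D" "r z x" for z
        using 1 that by blast
      have xW: "x \<in> W" using 1(2) W_trans D by blast
      \<comment> \<open>All predecessors of \<open>x\<close> have values by the induction
        hypothesis. Replacement collects their sets \<open>{v. H v q}\<close>, the union is a value
        \<open>y\<close> for \<open>x\<close>, and \<open>G\<close> with the new pair is an attempt
        defined at \<open>x\<close>.\<close>
      have "\<exists>b\<in>W. \<forall>h. E h b \<longleftrightarrow> h \<in> W \<and>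
          (\<exists>z. E z D \<and> (r z x \<and> (\<exists>q\<in>W. maps_to E G z q \<and> (\<forall>v\<in>W. E v h \<longleftrightarrow> H v q))))"
      proof (rule repl[OF _ D])
        show "df 60 (\<lambda>e. r (e 0) x \<and> (\<exists>q\<in>W. maps_to E G (e 0) q \<and> (\<forall>v\<in>W. E v (e 1) \<longleftrightarrow> H v q)))"
          by (intro dj_rules def2D[OF r] def2D[OF H] | simp add: D xW G)+
        fix z h h' assume h: "h \<in> W" "h' \<in> W"
          and "r z x \<and> (\<exists>q\<in>W. maps_to E G z q \<and> (\<forall>v\<in>W. E v h \<longleftrightarrow> H v q))"
          and "r z x \<and> (\<exists>q\<in>W. maps_to E G z q \<and> (\<forall>v\<in>W. E v h' \<longleftrightarrow> H v q))"
        then obtain q q' where "maps_to E G z q" "\<forall>v\<in>W. E v h \<longleftrightarrow> H v q"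
          "maps_to E G z q'" "\<forall>v\<in>W. E v h' \<longleftrightarrow> H v q'" by blast
        moreover then have "q = q'" using Rfun Gmap by blast
        ultimately show "h = h'" by (intro W_eqI h) auto
      qed
      then obtain b where b: "b \<in> W" "\<And>h. E h b \<longleftrightarrow> h \<in> W \<and>
          (\<exists>z. E z D \<and> (r z x \<and> (\<exists>q\<in>W. maps_to E G z q \<and> (\<forall>v\<in>W. E v h \<longleftrightarrow> H v q))))"
        by blast
      obtain y where y: "y \<in> W" "\<And>v. E v y \<longleftrightarrow> (\<exists>h. E h b \<and> E v h)"
        using ex_union[OF b(1)] by blast
      have step: "rec_step D r H G x y"
        unfolding rec_step_def
      proof (intro ballI iffI)
        fix v assume v: "v \<in> W" "E v y"
        then obtain h where h: "E h b" "E v h" using y(2) by blast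
        then show "\<exists>z. E z D \<and> r z x \<and> (\<exists>q\<in>W. maps_to E G z q \<and> H v q)"
          using b(2)[of h] v(1) by blast
      next
        fix v assume v: "v \<in> W" "\<exists>z. E z D \<and> r z x \<and> (\<exists>q\<in>W. maps_to E G z q \<and> H v q)"
        then obtain z q where z: "E z D" "r z x" "q \<in> W" "maps_to E G z q" "H v q" by blast
        obtain h where h: "h \<in> W" "\<forall>v\<in>W. E v h \<longleftrightarrow> H v q" using Hset[OF z(3)] by blast
        have "E h b" using b(2)[of h] h z by blast
        then show "E v y" using y(2)[of v] h v z by blast
      qed
      obtain p where p: "p \<in> W" "is_opair E p x y" using ex_opair[OF xW y(1)] by blast
      obtain G' where G': "G' \<in> W" "\<And>z. E z G' \<longleftrightarrow> E z G \<or> z = p" using ex_insert[OF G p(1)] by blast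
      have G'map: "maps_to E G' a c \<longleftrightarrow> maps_to E G a c \<or> a = x \<and> c = y" for a c
      proof -
        have "is_opair E p a c \<longleftrightarrow> a = x \<and> c = y" using p(2) is_opair_inj by blast
        then show ?thesis unfolding maps_to_def G'(2) by blast
      qed
      have eq: "maps_to E G' z q \<longleftrightarrow> maps_to E G z q" if "\<exists>q. maps_to E G z q" for z q
        using that no unfolding G'map by blast
      have "?good G'"
        unfolding rec_good_def
      proof (intro ballI impI)
        fix a c assume "maps_to E G' a c"
        then have *: "E a D \<and> rec_step D r H G a c \<and> (\<forall>z. E z D \<longrightarrow> r z a \<longrightarrow> (\<exists>q. maps_to E G z q))"
          unfolding G'map using rec_goodD[OF Ggood G, of a c] step 1(2) IH by blast
        then have "rec_step D r H G' a c"
          using eq unfolding rec_step_def by (metis (no_types, lifting))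
        then show "E a D \<and> rec_step D r H G' a c \<and> (\<forall>z. E z D \<longrightarrow> r z a \<longrightarrow> (\<exists>q\<in>W. maps_to E G' z q))"
          using * G'map maps_to_in[OF _ G] by blast
      qed
      then have "R x y" unfolding R_def using G'(1) G'map by blast
      then show False using no Gmap by blast
    qed
  qed
  define g where "g x = (THE y. maps_to E G x y)" for x
  have gmap: "maps_to E G x y \<longleftrightarrow> E x D \<and> y = g x" for x y
  proof -
    have u: "y = y'" if "maps_to E G x y" "maps_to E G x y'" for x y y'
      using that Rfun Gmap by blast
    have "maps_to E G x (g x)" if "E x D"
      unfolding g_def using total[OF that] u by (metis theI)
    then show ?thesis using u rec_goodD(1)[OF Ggood G] by blast
  qed
  have "g x \<in> W \<and> (\<forall>v\<in>W. E v (g x) \<longleftrightarrow> (\<exists>z. E z D \<and> r z x \<and> H v (g z)))" if "E x D" for x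
  proof -
    have m: "maps_to E G x (g x)" using gmap that by blast
    have "g z \<in> W" if "E z D" for z
      using gmap that maps_to_in[OF _ G] by blast
    then show ?thesis
      using rec_goodD(2)[OF Ggood G m] that gmap unfolding rec_step_def by auto
  qed
  moreover have "is_rel G" using GI unfolding is_rel_def by blast
  ultimately show ?thesis using G gmap by blast
qed

section \<open>Well-ordering\<close>

text \<open>Choice is given for disjoint families, so each nonempty \<open>s\<close> is replaced by
  the set of pairs with first component \<open>s\<close> and second component in \<open>s\<close>;
  this is what \<open>T\<close> expresses. A selector for these sets, read as a relation, chooses in
  each \<open>s\<close>. It may contain further pairs, hence uniqueness is claimed only inside
  \<open>s\<close>.\<close>

lemma ex_choice:
  assumes U: "U \<in> W"
  shows "\<exists>c\<in>W. \<forall>s\<in>W. (\<forall>v. E v s \<longrightarrow> E v U) \<longrightarrow> (\<exists>v. E v s) \<longrightarrow> (\<exists>!v. E v s \<and> maps_to E c s v)"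
proof -
  obtain P where P: "P \<in> W" "\<And>z. E z P \<longleftrightarrow> z \<in> W \<and> (\<forall>y. E y z \<longrightarrow> E y U)"
    using ex_power[OF U] by blast
  have "\<exists>b\<in>W. \<forall>x. E x b \<longleftrightarrow> E x P \<and> (\<exists>v. E v x \<and> True)"
    by (rule sep[OF _ P(1)]) (intro dj_rules)
  then obtain P1 where P1: "P1 \<in> W" "\<And>s. E s P1 \<longleftrightarrow> E s P \<and> (\<exists>v. E v s \<and> True)" by blast
  obtain PR where PR: "PR \<in> W" "\<And>p. E p PR \<longleftrightarrow> (\<exists>x. E x P \<and> (\<exists>y. E y U \<and> is_opair E p x y))"
    using ex_prod[OF P(1) U] by blast
  define T where "T s y \<longleftrightarrow> (\<forall>p\<in>W. E p y \<longleftrightarrow> (\<exists>v. E v s \<and> is_opair E p s v))" for s y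
  have T_fun: "y = y'" if "T s y" "T s y'" "y \<in> W" "y' \<in> W" for s y y'
    using that unfolding T_def by (intro W_eqI) auto
  have "\<exists>b\<in>W. \<forall>y. E y b \<longleftrightarrow> y \<in> W \<and> (\<exists>s. E s P1 \<and> T s y)"
  proof (rule repl[OF _ P1(1)])
    show "df 60 (\<lambda>e. T (e 0) (e 1))" unfolding T_def by (intro dj_rules | simp)+
  qed (rule T_fun)
  then obtain F where F: "F \<in> W" "\<And>y. E y F \<longleftrightarrow> y \<in> W \<and> (\<exists>s. E s P1 \<and> T s y)" by blast
  have T_ex: "\<exists>y\<in>W. T s y" if "E s P1" for s
  proof -
    have s: "s \<in> W" using that P1 W_trans by blast
    have "\<exists>y\<in>W. \<forall>p. E p y \<longleftrightarrow> E p PR \<and> (\<exists>v. E v s \<and> is_opair E p s v)"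
      by (rule sep[OF _ PR(1)]) (intro dj_rules | simp add: s)+
    then obtain y where y: "y \<in> W" "\<And>p. E p y \<longleftrightarrow> E p PR \<and> (\<exists>v. E v s \<and> is_opair E p s v)" by blast
    have "E p PR" if "E v s" "is_opair E p s v" for p v
      using PR(2)[of p] that P(2) P1(2)[of s] \<open>E s P1\<close> by blast
    then have "T s y" unfolding T_def using y(2) by blast
    then show ?thesis using y(1) by blast
  qed
  have T_mem: "\<exists>v. E v s \<and> is_opair E p s v" if "T s y" "y \<in> W" "E p y" for p s y
    using that W_trans unfolding T_def by blast
  have "ax_choice E W" using zfc by (simp add: zfc_axioms_for_def)
  moreover have "\<exists>p\<in>W. E p y" if y: "E y F" for y
  proof -
    obtain s where s: "E s P1" "T s y" using F(2) y by blast
    obtain v where v: "E v s" using P1(2) s(1) by blast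
    have "s \<in> W" using P1(1) W_trans s(1) by blast
    moreover then have "v \<in> W" using W_trans v by blast
    ultimately obtain p where "p \<in> W" "is_opair E p s v" using ex_opair by blast
    then show ?thesis using s(2) v unfolding T_def by blast
  qed
  moreover have "x = y" if xy: "E x F" "E y F" "E p x" "E p y" for x y p
  proof -
    obtain s t where st: "T s x" "T t y" "x \<in> W" "y \<in> W" using F(2) xy(1,2) by blast
    then have "s = t" using T_mem[OF st(1,3) xy(3)] T_mem[OF st(2,4) xy(4)] is_opair_inj by blast
    then show ?thesis using T_fun st by blast
  qed
  ultimately have "\<exists>c\<in>W. \<forall>x\<in>W. E x F \<longrightarrow> (\<exists>!z. z \<in> W \<and> E z x \<and> E z c)"
    unfolding ax_choice_def
    by (elim ballE[of _ _ F] impE) (simp_all add: F(1), blast)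
  then obtain c where c: "c \<in> W" "\<And>x. x \<in> W \<Longrightarrow> E x F \<Longrightarrow> \<exists>!z. z \<in> W \<and> E z x \<and> E z c" by blast
  have "\<exists>!v. E v s \<and> maps_to E c s v" if s: "s \<in> W" "\<forall>v. E v s \<longrightarrow> E v U" "\<exists>v. E v s" for s
  proof -
    have "E s P1" using s P(2) P1(2) by blast
    then obtain y where y: "y \<in> W" "T s y" using T_ex by blast
    then have "E y F" using F(2) \<open>E s P1\<close> by blast
    then obtain p where p: "E p y" "E p c" "\<And>q. q \<in> W \<Longrightarrow> E q y \<Longrightarrow> E q c \<Longrightarrow> q = p"
      using c(2)[OF y(1)] by blast
    obtain v where v: "E v s" "is_opair E p s v" using T_mem[OF y(2,1) p(1)] by blast
    have "w = v" if w: "E w s" "maps_to E c s w" for w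
    proof -
      obtain q where q: "E q c" "is_opair E q s w" using w(2) unfolding maps_to_def by blast
      have "q \<in> W" using q(1) c(1) W_trans by blast
      then have "E q y" using y(2) q(2) w(1) unfolding T_def by blast
      then have "q = p" using p(3) q(1) \<open>q \<in> W\<close> by blast
      then show ?thesis using q(2) v(2) is_opair_inj by blast
    qed
    moreover have "maps_to E c s v" using p(2) v(2) by (rule maps_toI)
    ultimately show ?thesis using v(1) by blast
  qed
  then show ?thesis using c(1) by blast
qed

text \<open>One step of Zermelo's enumeration: \<open>c\<close> chooses among the members of
  \<open>U\<close> that have no index below \<xi>. The length of the enumeration is not known in
  advance, whereas \<open>recursion\<close> needs a set as its domain.\<close>

definition wo_next :: "'a \<Rightarrow> 'a \<Rightarrow> 'a \<Rightarrow> 'a \<Rightarrow> 'a \<Rightarrow> bool" where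
  "wo_next U c f \<xi> y \<longleftrightarrow> (\<exists>s\<in>W. (\<forall>u\<in>W. E u s \<longleftrightarrow> E u U \<and> \<not> (\<exists>\<eta>. E \<eta> \<xi> \<and> maps_to E f \<eta> u)) \<and>
     E y s \<and> maps_to E c s y)"

definition wo_good :: "'a \<Rightarrow> 'a \<Rightarrow> 'a \<Rightarrow> 'a \<Rightarrow> bool" where
  "wo_good U c f \<alpha> \<longleftrightarrow> is_ordinal E \<alpha> \<and>
     (\<forall>p. E p f \<longrightarrow> (\<exists>\<xi>. E \<xi> \<alpha> \<and> (\<exists>y. E y U \<and> is_opair E p \<xi> y))) \<and>
     (\<forall>\<xi>. E \<xi> \<alpha> \<longrightarrow> (\<exists>y. E y U \<and> maps_to E f \<xi> y)) \<and>
     (\<forall>\<xi>. E \<xi> \<alpha> \<longrightarrow> (\<forall>y. E y U \<longrightarrow> maps_to E f \<xi> y \<longrightarrow> wo_next U c f \<xi> y))"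

lemma wo_good_maps: "wo_good U c f \<alpha> \<Longrightarrow> maps_to E f \<xi> y \<Longrightarrow> E \<xi> \<alpha> \<and> E y U \<and> wo_next U c f \<xi> y"
proof -
  assume g: "wo_good U c f \<alpha>" and m: "maps_to E f \<xi> y"
  obtain p where p: "E p f" "is_opair E p \<xi> y" using m unfolding maps_to_def by blast
  then obtain \<xi>' y' where "E \<xi>' \<alpha>" "E y' U" "is_opair E p \<xi>' y'" using g unfolding wo_good_def by blast
  then have "E \<xi> \<alpha>" "E y U" using p is_opair_inj by blast+
  then show ?thesis using g m unfolding wo_good_def by blast
qed

lemma wo_next_not: "wo_next U c f \<xi> y \<Longrightarrow> E \<eta> \<xi> \<Longrightarrow> \<not> maps_to E f \<eta> y"
  unfolding wo_next_def using W_trans by blast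

lemma wo_next_fun:
  assumes c: "\<forall>s\<in>W. (\<forall>v. E v s \<longrightarrow> E v U) \<longrightarrow> (\<exists>v. E v s) \<longrightarrow> (\<exists>!v. E v s \<and> maps_to E c s v)"
    and f: "wo_next U c f \<xi> y" and g: "wo_next U c g \<xi> y'"
    and eq: "\<And>\<eta> u. E \<eta> \<xi> \<Longrightarrow> maps_to E f \<eta> u \<longleftrightarrow> maps_to E g \<eta> u"
  shows "y = y'"
proof -
  obtain s where s: "s \<in> W" "\<And>u. u \<in> W \<Longrightarrow> E u s \<longleftrightarrow> E u U \<and> \<not> (\<exists>\<eta>. E \<eta> \<xi> \<and> maps_to E f \<eta> u)"
    "E y s" "maps_to E c s y" using f unfolding wo_next_def by blast
  obtain t where t: "t \<in> W" "\<And>u. u \<in> W \<Longrightarrow> E u t \<longleftrightarrow> E u U \<and> \<not> (\<exists>\<eta>. E \<eta> \<xi> \<and> maps_to E g \<eta> u)"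
    "E y' t" "maps_to E c t y'" using g unfolding wo_next_def by blast
  have "s = t" by (rule W_eqI[OF s(1) t(1)]) (use s(2) t(2) eq in blast)
  moreover have "\<forall>v. E v s \<longrightarrow> E v U" using s(2) W_trans[OF s(1)] by blast
  ultimately show ?thesis using c s t by blast
qed

lemma wo_good_agree:
  assumes c: "\<forall>s\<in>W. (\<forall>v. E v s \<longrightarrow> E v U) \<longrightarrow> (\<exists>v. E v s) \<longrightarrow> (\<exists>!v. E v s \<and> maps_to E c s v)"
    and f: "wo_good U c f \<alpha>" and g: "wo_good U c g \<beta>"
  shows "maps_to E f \<xi> y \<Longrightarrow> maps_to E g \<xi> y' \<Longrightarrow> y = y'"
proof (induction \<xi> arbitrary: y y' rule: E_induct)
  case (mem \<xi>)
  have \<xi>: "E \<xi> \<alpha>" "E \<xi> \<beta>" using mem.prems wo_good_maps f g by blast+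
  have "maps_to E f \<eta> u \<longleftrightarrow> maps_to E g \<eta> u" if "E \<eta> \<xi>" for \<eta> u
  proof -
    have "E \<eta> \<alpha>" "E \<eta> \<beta>" using \<xi> that f g ordinal_trans unfolding wo_good_def by blast+
    then obtain a b where "maps_to E f \<eta> a" "maps_to E g \<eta> b" using f g unfolding wo_good_def by blast
    then show ?thesis using mem.IH[OF that] by metis
  qed
  then show ?case
    using wo_next_fun[OF c] wo_good_maps[OF f mem.prems(1)] wo_good_maps[OF g mem.prems(2)] by blast
qed

lemma wo_good_inj:
  assumes c: "\<forall>s\<in>W. (\<forall>v. E v s \<longrightarrow> E v U) \<longrightarrow> (\<exists>v. E v s) \<longrightarrow> (\<exists>!v. E v s \<and> maps_to E c s v)"
    and f: "wo_good U c f \<alpha>" and m: "maps_to E f \<xi> y" "maps_to E f \<eta> y"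
  shows "\<xi> = \<eta>"
  using ordinal_linear[of \<alpha> \<xi> \<eta>] wo_good_maps[OF f m(1)] wo_good_maps[OF f m(2)] m wo_next_not f
  unfolding wo_good_def by blast

text \<open>Partial enumerations are indexed by their ranges. Each is determined by its range, a
  subset of \<open>U\<close>, so replacement over the power set collects all of them, without any
  prior bound on the ordinals. Their union is again one, and it must exhaust
  \<open>U\<close>.\<close>

theorem well_ordering:
  assumes U: "U \<in> W"
  shows "\<exists>\<theta>\<in>W. \<exists>k\<in>W. is_ordinal E \<theta> \<and> is_bijection E k \<theta> U"
proof -
  obtain c where cW: "c \<in> W"
    and c: "\<forall>s\<in>W. (\<forall>v. E v s \<longrightarrow> E v U) \<longrightarrow> (\<exists>v. E v s) \<longrightarrow> (\<exists>!v. E v s \<and> maps_to E c s v)"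
    using ex_choice[OF U] by blast
  let ?good = "wo_good U c"
  obtain P where P: "P \<in> W" "\<And>z. E z P \<longleftrightarrow> z \<in> W \<and> (\<forall>y. E y z \<longrightarrow> E y U)"
    using ex_power[OF U] by blast
  define R where "R s f \<longleftrightarrow> (\<exists>\<alpha>\<in>W. ?good f \<alpha> \<and> (\<forall>u. E u U \<longrightarrow> (E u s \<longleftrightarrow> (\<exists>\<xi>. E \<xi> \<alpha> \<and> maps_to E f \<xi> u))))" for s f
  \<comment> \<open>Enumerations of different length have different ranges: the value of the longer
    one at \<alpha> would have to occur at an earlier index as well, against injectivity.\<close>
  have Rlt: False if fg: "?good f \<alpha>" "?good g \<beta>" "E \<alpha> \<beta>"
    "\<forall>u. E u U \<longrightarrow> (\<exists>\<xi>. E \<xi> \<alpha> \<and> maps_to E f \<xi> u) = (\<exists>\<xi>. E \<xi> \<beta> \<and> maps_to E g \<xi> u)" for f g \<alpha> \<beta>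
  proof -
    obtain y where y: "maps_to E g \<alpha> y" "E y U" using fg(2,3) unfolding wo_good_def by blast
    then obtain \<xi> where \<xi>: "E \<xi> \<alpha>" "maps_to E f \<xi> y" using fg(3,4) by blast
    have "E \<xi> \<beta>" using \<xi>(1) fg(2,3) ordinal_trans unfolding wo_good_def by blast
    then obtain y' where "maps_to E g \<xi> y'" using fg(2) unfolding wo_good_def by blast
    then have "maps_to E g \<xi> y" using wo_good_agree[OF c fg(1,2) \<xi>(2)] by blast
    then have "\<xi> = \<alpha>" using wo_good_inj[OF c fg(2)] y(1) by blast
    then show False using \<xi>(1) E_irrefl by blast
  qed
  have good_eq: "f = g" if f: "?good f \<alpha>" and g: "?good g \<alpha>" for f g \<alpha>
  proof (rule is_rel_eqI)
    show "is_rel f" "is_rel g" using f g unfolding is_rel_def wo_good_def by blast+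
    fix x y
    show "maps_to E f x y \<longleftrightarrow> maps_to E g x y"
    proof (cases "E x \<alpha>")
      case True
      then obtain a b where "maps_to E f x a" "maps_to E g x b" using f g unfolding wo_good_def by blast
      then show ?thesis using wo_good_agree[OF c f g] by metis
    next
      case False
      then show ?thesis using wo_good_maps f g by blast
    qed
  qed
  have Rfun: "f = g" if fg: "R s f" "R s g" for s f g
  proof -
    obtain \<alpha> where a: "?good f \<alpha>" "\<forall>u. E u U \<longrightarrow> (E u s \<longleftrightarrow> (\<exists>\<xi>. E \<xi> \<alpha> \<and> maps_to E f \<xi> u))"
      using fg(1) unfolding R_def by blast
    obtain \<beta> where b: "?good g \<beta>" "\<forall>u. E u U \<longrightarrow> (E u s \<longleftrightarrow> (\<exists>\<xi>. E \<xi> \<beta> \<and> maps_to E g \<xi> u))"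
      using fg(2) unfolding R_def by blast
    have "is_ordinal E \<alpha>" "is_ordinal E \<beta>" using a b unfolding wo_good_def by blast+
    then have "\<alpha> = \<beta>" using ordinal_total[of \<alpha> \<beta>] Rlt[OF a(1) b(1)] Rlt[OF b(1) a(1)] a(2) b(2) by auto
    then show ?thesis using good_eq a(1) b(1) by blast
  qed
  have "\<exists>b\<in>W. \<forall>f. E f b \<longleftrightarrow> f \<in> W \<and> (\<exists>s. E s P \<and> R s f)"
  proof (rule repl[OF _ P(1)])
    show "df 60 (\<lambda>e. R (e 0) (e 1))"
      unfolding R_def wo_good_def wo_next_def by (intro dj_rules | simp add: U cW)+
  qed (rule Rfun)
  then obtain b where b: "b \<in> W" "\<And>f. E f b \<longleftrightarrow> f \<in> W \<and> (\<exists>s. E s P \<and> R s f)" by blast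
  have bI: "E f b" if f: "f \<in> W" "\<alpha> \<in> W" "?good f \<alpha>" for f \<alpha>
  proof -
    have "\<exists>s\<in>W. \<forall>u. E u s \<longleftrightarrow> E u U \<and> (\<exists>\<xi>. E \<xi> \<alpha> \<and> maps_to E f \<xi> u)"
      by (rule sep[OF _ U]) (intro dj_rules | simp add: f)+
    then obtain s where s: "s \<in> W" "\<And>u. E u s \<longleftrightarrow> E u U \<and> (\<exists>\<xi>. E \<xi> \<alpha> \<and> maps_to E f \<xi> u)" by blast
    then have "E s P" using P(2) by blast
    moreover have "R s f" unfolding R_def using f s(2) by blast
    ultimately show ?thesis using b(2) f(1) by blast
  qed
  obtain K where K: "K \<in> W" "\<And>p. E p K \<longleftrightarrow> (\<exists>f. E f b \<and> E p f)" using ex_union[OF b(1)] by blast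
  have Kmap: "maps_to E K \<xi> y \<longleftrightarrow> (\<exists>f\<in>W. \<exists>\<alpha>\<in>W. ?good f \<alpha> \<and> maps_to E f \<xi> y)" for \<xi> y
  proof
    assume "maps_to E K \<xi> y"
    then obtain f p where "E f b" "E p f" "is_opair E p \<xi> y" using K(2) unfolding maps_to_def by blast
    then show "\<exists>f\<in>W. \<exists>\<alpha>\<in>W. ?good f \<alpha> \<and> maps_to E f \<xi> y"
      using b(2)[of f] unfolding R_def maps_to_def by blast
  next
    assume "\<exists>f\<in>W. \<exists>\<alpha>\<in>W. ?good f \<alpha> \<and> maps_to E f \<xi> y"
    then obtain f \<alpha> p where "f \<in> W" "\<alpha> \<in> W" "?good f \<alpha>" "E p f" "is_opair E p \<xi> y"
      unfolding maps_to_def by blast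
    then show "maps_to E K \<xi> y" using bI K(2) unfolding maps_to_def by blast
  qed
  obtain \<theta> where l: "\<theta> \<in> W" "\<And>\<xi>. E \<xi> \<theta> \<longleftrightarrow> (\<exists>y. maps_to E K \<xi> y)" using ex_dom[OF K(1)] by blast
  have l_iff: "E \<xi> \<theta> \<longleftrightarrow> (\<exists>f\<in>W. \<exists>\<alpha>\<in>W. ?good f \<alpha> \<and> E \<xi> \<alpha>)" for \<xi>
    unfolding l(2) Kmap using wo_good_maps unfolding wo_good_def by blast
  have l_ord: "is_ordinal E \<theta>"
  proof (rule ordinalI)
    show "is_ordinal E x" if "E x \<theta>" for x
      using that ordinal_mem unfolding l_iff wo_good_def by blast
    show "E y \<theta>" if "E x \<theta>" "E y x" for x y
      using that ordinal_trans unfolding l_iff wo_good_def by blast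
  qed
  have K_eq: "maps_to E K \<eta> u \<longleftrightarrow> maps_to E f \<eta> u" if f: "f \<in> W" "\<alpha> \<in> W" "?good f \<alpha>" "E \<eta> \<alpha>" for f \<alpha> \<eta> u
  proof
    show "maps_to E f \<eta> u \<Longrightarrow> maps_to E K \<eta> u" using Kmap f by blast
    assume "maps_to E K \<eta> u"
    then obtain g \<beta> where g: "?good g \<beta>" "maps_to E g \<eta> u" using Kmap by blast
    obtain u' where "maps_to E f \<eta> u'" using f(3,4) unfolding wo_good_def by blast
    then show "maps_to E f \<eta> u" using wo_good_agree[OF c g(1) f(3) g(2)] by blast
  qed
  have K_step: "E \<xi> \<theta> \<and> E y U \<and> wo_next U c K \<xi> y" if "maps_to E K \<xi> y" for \<xi> y
  proof -
    obtain f \<alpha> where f: "f \<in> W" "\<alpha> \<in> W" "?good f \<alpha>" "maps_to E f \<xi> y" using Kmap \<open>maps_to E K \<xi> y\<close> by blast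
    note fm = wo_good_maps[OF f(3,4)]
    have "maps_to E K \<eta> u \<longleftrightarrow> maps_to E f \<eta> u" if "E \<eta> \<xi>" for \<eta> u
      using K_eq[OF f(1-3)] that fm ordinal_trans f(3) unfolding wo_good_def by blast
    then have "(\<exists>\<eta>. E \<eta> \<xi> \<and> maps_to E K \<eta> u) = (\<exists>\<eta>. E \<eta> \<xi> \<and> maps_to E f \<eta> u)" for u by blast
    then have "wo_next U c K \<xi> y" using fm unfolding wo_next_def by simp
    then show ?thesis using fm f l_iff by blast
  qed
  have K_rel: "\<exists>\<xi>. E \<xi> \<theta> \<and> (\<exists>y. E y U \<and> is_opair E p \<xi> y)" if p: "E p K" for p
  proof -
    obtain f where f: "E f b" "E p f" using p K(2) by blast
    then obtain \<alpha> where "?good f \<alpha>" using b(2)[of f] unfolding R_def by blast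
    then obtain \<xi> y where "is_opair E p \<xi> y" using f(2) unfolding wo_good_def by blast
    moreover then have "maps_to E K \<xi> y" using p by (rule maps_toI[rotated])
    ultimately show ?thesis using K_step by blast
  qed
  have K_good: "?good K \<theta>"
    unfolding wo_good_def using l_ord K_rel K_step l(2) by blast
  have onto: "\<exists>\<xi>. maps_to E K \<xi> u" if u: "E u U" for u
  proof (rule ccontr)
    assume no: "\<not> (\<exists>\<xi>. maps_to E K \<xi> u)"
    have "\<exists>s\<in>W. \<forall>u. E u s \<longleftrightarrow> E u U \<and> \<not> (\<exists>\<eta>. E \<eta> \<theta> \<and> maps_to E K \<eta> u)"
      by (rule sep[OF _ U]) (intro dj_rules | simp add: l(1) K(1))+
    then obtain s where s: "s \<in> W" "\<And>u. E u s \<longleftrightarrow> E u U \<and> \<not> (\<exists>\<eta>. E \<eta> \<theta> \<and> maps_to E K \<eta> u)" by blast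
    have "E u s" using s(2) u no by blast
    then obtain y where y: "E y s" "maps_to E c s y" using c s by blast
    have yW: "y \<in> W" using y(1) s(1) W_trans by blast
    obtain p where p: "p \<in> W" "is_opair E p \<theta> y" using ex_opair[OF l(1) yW] by blast
    \<comment> \<open>One more choice gives an enumeration of length \<theta> + 1. By
      \<open>l_iff\<close> all its indices belong to \<theta>, so \<theta> would be a member of
      itself.\<close>
    obtain K' where K': "K' \<in> W" "\<And>z. E z K' \<longleftrightarrow> E z K \<or> z = p" using ex_insert[OF K(1) p(1)] by blast
    have K'map: "maps_to E K' a d \<longleftrightarrow> maps_to E K a d \<or> a = \<theta> \<and> d = y" for a d
    proof -
      have "is_opair E p a d \<longleftrightarrow> a = \<theta> \<and> d = y" using p(2) is_opair_inj by blast
      then show ?thesis unfolding maps_to_def K'(2) by blast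
    qed
    obtain \<theta>' where l': "\<theta>' \<in> W" "\<And>z. E z \<theta>' \<longleftrightarrow> E z \<theta> \<or> z = \<theta>" using ex_insert[OF l(1,1)] by blast
    have below: "maps_to E K' \<eta> u \<longleftrightarrow> maps_to E K \<eta> u" if "E \<eta> \<xi>" "E \<xi> \<theta>'" for \<xi> \<eta> u
      using that K'map l'(2) ordinal_trans[OF l_ord] E_irrefl by blast
    have next_eq: "wo_next U c K' \<xi> v \<longleftrightarrow> wo_next U c K \<xi> v" if "E \<xi> \<theta>'" for \<xi> v
    proof -
      have "(\<exists>\<eta>. E \<eta> \<xi> \<and> maps_to E K' \<eta> u) = (\<exists>\<eta>. E \<eta> \<xi> \<and> maps_to E K \<eta> u)" for u
        using below that by blast
      then show ?thesis unfolding wo_next_def by simp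
    qed
    have "wo_next U c K \<theta> y" unfolding wo_next_def using s y by blast
    then have K'step: "E \<xi> \<theta>' \<and> E v U \<and> wo_next U c K' \<xi> v" if "maps_to E K' \<xi> v" for \<xi> v
      using that K_step next_eq y s(2) l'(2) unfolding K'map by blast
    have "is_ordinal E \<theta>'"
    proof (rule ordinalI)
      show "is_ordinal E x" if "E x \<theta>'" for x
        using that l'(2)[of x] ordinal_mem[OF l_ord] l_ord by blast
      show "E y \<theta>'" if "E x \<theta>'" "E y x" for x y
        using that l'(2)[of x] l'(2)[of y] ordinal_trans[OF l_ord] by blast
    qed
    moreover have "\<exists>\<xi>. E \<xi> \<theta>' \<and> (\<exists>v. E v U \<and> is_opair E q \<xi> v)" if "E q K'" for q
      using that K_rel p(2) y(1) s(2) l'(2) unfolding K'(2) by blast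
    moreover have "\<exists>v. E v U \<and> maps_to E K' \<xi> v" if "E \<xi> \<theta>'" for \<xi>
      using that l'(2) l(2) K_step K'map y(1) s(2) by blast
    ultimately have "?good K' \<theta>'" unfolding wo_good_def using K'step by blast
    then have "E \<theta> \<theta>" using l_iff K'(1) l'(1) l'(2) by blast
    then show False using E_irrefl by blast
  qed
  have K_fun: "y = y'" if "maps_to E K \<xi> y" "maps_to E K \<xi> y'" for \<xi> y y'
    using wo_good_agree[OF c K_good K_good] that by blast
  have "is_function E K \<theta> (ext E U)"
  proof (rule is_functionI)
    show "\<exists>x y. E x \<theta> \<and> y \<in> ext E U \<and> is_opair E p x y" if "E p K" for p
      using K_rel[OF that] by (auto simp: ext_def)
  qed (use l(2) K_fun in blast)+
  then have "is_bijection E K \<theta> U"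
    unfolding is_bijection_def using onto wo_good_inj[OF c K_good] by blast
  then show ?thesis using l(1) K(1) l_ord by blast
qed

end

section \<open>Small sets\<close>

context univ
begin

definition inj_into :: "'a \<Rightarrow> 'a \<Rightarrow> 'a \<Rightarrow> bool" where
  "inj_into i a b \<longleftrightarrow> is_function E i a (ext E b) \<and>
     (\<forall>x x' y. maps_to E i x y \<longrightarrow> maps_to E i x' y \<longrightarrow> x = x')"

lemma inj_intoD:
  assumes "inj_into i a b"
  shows "maps_to E i x y \<Longrightarrow> E x a \<and> E y b" "maps_to E i x y \<Longrightarrow> maps_to E i x y' \<Longrightarrow> y = y'"
    "maps_to E i x y \<Longrightarrow> maps_to E i x' y \<Longrightarrow> x = x'" "E x a \<Longrightarrow> \<exists>y. maps_to E i x y \<and> E y b"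
proof -
  have f: "is_function E i a (ext E b)" and "\<And>x x' y. maps_to E i x y \<Longrightarrow> maps_to E i x' y \<Longrightarrow> x = x'"
    using assms by (auto simp: inj_into_def)
  then show "maps_to E i x y \<Longrightarrow> maps_to E i x' y \<Longrightarrow> x = x'" by blast
  show "maps_to E i x y \<Longrightarrow> E x a \<and> E y b"
    using is_function_maps[OF f] by (auto simp: ext_def)
  show "maps_to E i x y \<Longrightarrow> maps_to E i x y' \<Longrightarrow> y = y'"
    by (rule is_function_unique[OF f])
  show "E x a \<Longrightarrow> \<exists>y. maps_to E i x y \<and> E y b"
    using is_function_ex[OF f] by (auto simp: ext_def)
qed

lemma is_bijectionD:
  assumes "is_bijection E k a b"
  shows "maps_to E k x y \<Longrightarrow> E x a \<and> E y b" "maps_to E k x y \<Longrightarrow> maps_to E k x y' \<Longrightarrow> y = y'"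
    "maps_to E k x y \<Longrightarrow> maps_to E k x' y \<Longrightarrow> x = x'" "E x a \<Longrightarrow> \<exists>y. maps_to E k x y"
    "E y b \<Longrightarrow> \<exists>x. maps_to E k x y"
proof -
  have f: "is_function E k a (ext E b)" and b: "\<And>y. E y b \<Longrightarrow> \<exists>!x. maps_to E k x y"
    using assms by (auto simp: is_bijection_def)
  show *: "maps_to E k x y \<Longrightarrow> E x a \<and> E y b" for x y
    using is_function_maps[OF f] by (auto simp: ext_def)
  show "maps_to E k x y \<Longrightarrow> maps_to E k x y' \<Longrightarrow> y = y'"
    by (rule is_function_unique[OF f])
  show "maps_to E k x y \<Longrightarrow> maps_to E k x' y \<Longrightarrow> x = x'" using b *[of x y] by blast
  show "E x a \<Longrightarrow> \<exists>y. maps_to E k x y" using is_function_ex[OF f] by blast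
  show "E y b \<Longrightarrow> \<exists>x. maps_to E k x y" using b by blast
qed

end

text \<open>Regularity is expressed through functions of the model being bounded, a form inherited
  by every transitive submodel that contains \<delta>, where fewer functions have to be considered
  (\<open>reg_down\<close>).\<close>

locale reg = mst E W
  for E :: "'a \<Rightarrow> 'a \<Rightarrow> bool" and W :: "'a set" +
  fixes \<delta> :: 'a
  assumes d_in: "\<delta> \<in> W" and d_ord: "is_ordinal E \<delta>" and d_inf: "infinite (ext E \<delta>)"
    and d_reg: "\<And>\<beta> f. E \<beta> \<delta> \<Longrightarrow> f \<in> W \<Longrightarrow> is_function E f \<beta> (ext E \<delta>) \<Longrightarrow>
      \<exists>\<gamma>. E \<gamma> \<delta> \<and> (\<forall>x y. maps_to E f x y \<longrightarrow> \<not> E \<gamma> y \<and> \<gamma> \<noteq> y)"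
begin

definition sm :: "'a \<Rightarrow> bool" where
  "sm a \<longleftrightarrow> (\<exists>\<xi>. E \<xi> \<delta> \<and> (\<exists>k\<in>W. is_bijection E k \<xi> a))"

lemma d_mem_ord: "E \<xi> \<delta> \<Longrightarrow> is_ordinal E \<xi>"
  by (rule ordinal_mem[OF d_ord])

lemma d_mem_in: "E \<xi> \<delta> \<Longrightarrow> \<xi> \<in> W"
  by (rule W_trans[OF d_in])

lemma sm_iff: "size_less_in E W a \<delta> \<longleftrightarrow> sm a"
proof
  assume "size_less_in E W a \<delta>"
  then show "sm a"
    unfolding size_less_in_def is_cardinality_in_def equinumerous_in_def sm_def by blast
next
  assume "sm a"
  then obtain \<xi> where "E \<xi> \<delta> \<and> equinumerous_in E W \<xi> a"
    unfolding sm_def equinumerous_in_def by blast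
  then obtain \<kappa> where "E \<kappa> \<delta> \<and> equinumerous_in E W \<kappa> a"
    and min: "\<And>\<beta>. E \<beta> \<kappa> \<Longrightarrow> \<not> (E \<beta> \<delta> \<and> equinumerous_in E W \<beta> a)"
    using E_minimal[of "\<lambda>\<xi>. E \<xi> \<delta> \<and> equinumerous_in E W \<xi> a"] by blast
  then show "size_less_in E W a \<delta>"
    unfolding size_less_in_def is_cardinality_in_def
    using d_mem_in d_mem_ord ordinal_trans[OF d_ord] by blast
qed

lemma bounded_ordinal:
  assumes Q: "def2 35 Q" and \<xi>: "E \<xi> \<delta>"
    and func: "\<And>\<eta> \<alpha> \<alpha>'. E \<eta> \<xi> \<Longrightarrow> E \<alpha> \<delta> \<Longrightarrow> E \<alpha>' \<delta> \<Longrightarrow> Q \<eta> \<alpha> \<Longrightarrow> Q \<eta> \<alpha>' \<Longrightarrow> \<alpha> = \<alpha>'"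
  shows "\<exists>\<gamma>. E \<gamma> \<delta> \<and> (\<forall>\<eta> \<alpha>. E \<eta> \<xi> \<longrightarrow> E \<alpha> \<delta> \<longrightarrow> Q \<eta> \<alpha> \<longrightarrow> E \<alpha> \<gamma>)"
proof -
  have "ext E \<delta> \<noteq> {}" using d_inf by auto
  then obtain z where z: "E z \<delta>" by (auto simp: ext_def)
  \<comment> \<open>\<open>Q\<close> may be partial, so \<open>z\<close> serves as default value;
    the bound obtained for the total map still applies to the genuine values.\<close>
  define Q' where "Q' \<eta> \<alpha> \<longleftrightarrow> Q \<eta> \<alpha> \<or> \<not> (\<exists>\<beta>. E \<beta> \<delta> \<and> Q \<eta> \<beta>) \<and> \<alpha> = z" for \<eta> \<alpha>
  have "def2 40 Q'"
    unfolding Q'_def by (rule def2I) (intro dj_rules def2D[OF Q] trm_shift | simp add: d_in d_mem_in z)+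
  from ex_rel[OF this d_mem_in[OF \<xi>] d_in] obtain f where f: "f \<in> W"
    "\<And>p. E p f \<Longrightarrow> \<exists>x y. E x \<xi> \<and> E y \<delta> \<and> is_opair E p x y"
    "\<And>x y. maps_to E f x y \<longleftrightarrow> E x \<xi> \<and> E y \<delta> \<and> Q' x y" by blast
  have "is_function E f \<xi> (ext E \<delta>)"
  proof (rule is_functionI)
    show "\<exists>x y. E x \<xi> \<and> y \<in> ext E \<delta> \<and> is_opair E p x y" if "E p f" for p
      using f(2)[OF that] by (simp add: ext_def)
    show "\<exists>y. maps_to E f x y" if "E x \<xi>" for x
      unfolding f(3) Q'_def using that z by blast
    show "y = y'" if "maps_to E f x y" "maps_to E f x y'" for x y y'
      using that func unfolding f(3) Q'_def by blast
  qed
  from d_reg[OF \<xi> f(1) this] obtain \<gamma> where g: "E \<gamma> \<delta>" "\<And>x y. maps_to E f x y \<Longrightarrow> \<not> E \<gamma> y \<and> \<gamma> \<noteq> y"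
    by blast
  have "E \<alpha> \<gamma>" if a: "E \<eta> \<xi>" "E \<alpha> \<delta>" "Q \<eta> \<alpha>" for \<eta> \<alpha>
  proof -
    have "maps_to E f \<eta> \<alpha>" unfolding f(3) Q'_def using a by blast
    then show ?thesis using g(2) ordinal_linear[OF d_ord g(1) a(2)] by blast
  qed
  then show ?thesis using g(1) by blast
qed

lemma bounded:
  assumes Q: "def2 30 Q" and c: "sm c" "c \<in> W"
    and func: "\<And>x \<alpha> \<alpha>'. E x c \<Longrightarrow> E \<alpha> \<delta> \<Longrightarrow> E \<alpha>' \<delta> \<Longrightarrow> Q x \<alpha> \<Longrightarrow> Q x \<alpha>' \<Longrightarrow> \<alpha> = \<alpha>'"
  shows "\<exists>\<gamma>. E \<gamma> \<delta> \<and> (\<forall>x \<alpha>. E x c \<longrightarrow> E \<alpha> \<delta> \<longrightarrow> Q x \<alpha> \<longrightarrow> E \<alpha> \<gamma>)"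
proof -
  obtain \<xi> k where k: "E \<xi> \<delta>" "k \<in> W" "is_bijection E k \<xi> c" using c unfolding sm_def by blast
  define Q' where "Q' \<eta> \<alpha> \<longleftrightarrow> (\<exists>x. E x c \<and> (maps_to E k \<eta> x \<and> Q x \<alpha>))" for \<eta> \<alpha>
  have "def2 35 Q'"
    unfolding Q'_def by (rule def2I) (intro dj_rules def2D[OF Q] trm_shift | simp add: k c)+
  moreover have "\<alpha> = \<alpha>'" if "E \<eta> \<xi>" "E \<alpha> \<delta>" "E \<alpha>' \<delta>" "Q' \<eta> \<alpha>" "Q' \<eta> \<alpha>'" for \<eta> \<alpha> \<alpha>'
    using that is_bijectionD(2)[OF k(3)] func unfolding Q'_def by blast
  ultimately obtain \<gamma> where g: "E \<gamma> \<delta>" "\<And>\<eta> \<alpha>. E \<eta> \<xi> \<Longrightarrow> E \<alpha> \<delta> \<Longrightarrow> Q' \<eta> \<alpha> \<Longrightarrow> E \<alpha> \<gamma>"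
    using bounded_ordinal[OF _ k(1), of Q'] by blast
  have "E \<alpha> \<gamma>" if x: "E x c" "E \<alpha> \<delta>" "Q x \<alpha>" for x \<alpha>
  proof -
    obtain \<eta> where "maps_to E k \<eta> x" using is_bijectionD(5)[OF k(3) x(1)] by blast
    then show ?thesis using g(2) is_bijectionD(1)[OF k(3)] x unfolding Q'_def by blast
  qed
  then show ?thesis using g(1) by blast
qed

text \<open>
  By the well-ordering theorem a set that is not small contains an injective image of
  \<open>\<delta>\<close>, so smallness follows once every such injection has bounded domain.
\<close>

lemma smI:
  assumes U: "U \<in> W"
    and bd: "\<And>e. e \<in> W \<Longrightarrow> (\<And>\<zeta>. E \<zeta> \<delta> \<Longrightarrow> \<exists>u. E u U \<and> maps_to E e \<zeta> u) \<Longrightarrow>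
      (\<And>\<zeta> \<zeta>' u. maps_to E e \<zeta> u \<Longrightarrow> maps_to E e \<zeta>' u \<Longrightarrow> \<zeta> = \<zeta>') \<Longrightarrow>
      (\<And>\<zeta> u u'. maps_to E e \<zeta> u \<Longrightarrow> maps_to E e \<zeta> u' \<Longrightarrow> u = u') \<Longrightarrow>
      \<exists>\<gamma>. E \<gamma> \<delta> \<and> (\<forall>\<zeta>. E \<zeta> \<delta> \<longrightarrow> E \<zeta> \<gamma>)"
  shows "sm U"
proof -
  obtain \<theta> k where k: "\<theta> \<in> W" "k \<in> W" "is_ordinal E \<theta>" "is_bijection E k \<theta> U"
    using well_ordering[OF U] by blast
  note kD = is_bijectionD[OF k(4)]
  show ?thesis
  proof (cases "E \<theta> \<delta>")
    case True
    then show ?thesis unfolding sm_def using k by blast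
  next
    case False
    then have le: "E \<zeta> \<theta>" if "E \<zeta> \<delta>" for \<zeta>
      using ordinal_total[OF k(3) d_ord] ordinal_trans[OF k(3)] that by blast
    have "\<exists>\<gamma>. E \<gamma> \<delta> \<and> (\<forall>\<zeta>. E \<zeta> \<delta> \<longrightarrow> E \<zeta> \<gamma>)"
    proof (rule bd[OF k(2)])
      show "\<exists>u. E u U \<and> maps_to E k \<zeta> u" if "E \<zeta> \<delta>" for \<zeta>
        using kD(4)[OF le[OF that]] kD(1) by blast
    qed (use kD in blast)+
    then show ?thesis using E_irrefl by blast
  qed
qed

text \<open>An injection of \<delta> into \<open>U\<close>, pulled back along \<open>Q\<close>, is a
  partial map from \<open>s\<close> into \<delta> that takes every index as a value. Since
  \<open>s\<close> is small, \<open>bounded\<close> limits these values below \<delta>.\<close>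

lemma sm_image:
  assumes s: "sm s" "s \<in> W" and U: "U \<in> W" and Q: "def2 20 Q"
    and func: "\<And>x u u'. E x s \<Longrightarrow> E u U \<Longrightarrow> E u' U \<Longrightarrow> Q x u \<Longrightarrow> Q x u' \<Longrightarrow> u = u'"
    and onto: "\<And>u. E u U \<Longrightarrow> \<exists>x. E x s \<and> Q x u"
  shows "sm U"
proof (rule smI[OF U])
  fix e assume e: "e \<in> W" "\<And>\<zeta>. E \<zeta> \<delta> \<Longrightarrow> \<exists>u. E u U \<and> maps_to E e \<zeta> u"
    "\<And>\<zeta> \<zeta>' u. maps_to E e \<zeta> u \<Longrightarrow> maps_to E e \<zeta>' u \<Longrightarrow> \<zeta> = \<zeta>'"
  define Q' where "Q' x \<zeta> \<longleftrightarrow> (\<exists>u. E u U \<and> (maps_to E e \<zeta> u \<and> Q x u))" for x \<zeta>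
  have "def2 30 Q'"
    unfolding Q'_def by (rule def2I) (intro dj_rules def2D[OF Q] trm_shift | simp add: e U)+
  moreover have "\<alpha> = \<alpha>'" if "E x s" "E \<alpha> \<delta>" "E \<alpha>' \<delta>" "Q' x \<alpha>" "Q' x \<alpha>'" for x \<alpha> \<alpha>'
    using that func e(3) unfolding Q'_def by blast
  ultimately obtain \<gamma> where g: "E \<gamma> \<delta>" "\<And>x \<zeta>. E x s \<Longrightarrow> E \<zeta> \<delta> \<Longrightarrow> Q' x \<zeta> \<Longrightarrow> E \<zeta> \<gamma>"
    using bounded[OF _ s, of Q'] by blast
  have "E \<zeta> \<gamma>" if z: "E \<zeta> \<delta>" for \<zeta>
  proof -
    obtain u where "E u U" "maps_to E e \<zeta> u" using e(2)[OF z] by blast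
    then show ?thesis using onto g(2) z unfolding Q'_def by blast
  qed
  then show "\<exists>\<gamma>. E \<gamma> \<delta> \<and> (\<forall>\<zeta>. E \<zeta> \<delta> \<longrightarrow> E \<zeta> \<gamma>)" using g(1) by blast
qed

lemma sm_subset:
  assumes "sm s" "s \<in> W" "U \<in> W" "\<And>u. E u U \<Longrightarrow> E u s"
  shows "sm U"
proof (rule sm_image[OF assms(1-3), of "(=)"])
  show "def2 20 (=)" by (rule def2I) (intro dj_rules)
qed (use assms(4) in auto)

lemma inj_bounded:
  assumes s: "sm s" "s \<in> W" and e: "e \<in> W"
    "\<forall>\<zeta> \<zeta>' u. maps_to E e \<zeta> u \<longrightarrow> maps_to E e \<zeta>' u \<longrightarrow> \<zeta> = \<zeta>'"
  shows "\<exists>\<gamma>. E \<gamma> \<delta> \<and> (\<forall>u \<zeta>. E u s \<longrightarrow> E \<zeta> \<delta> \<longrightarrow> maps_to E e \<zeta> u \<longrightarrow> E \<zeta> \<gamma>)"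
proof (rule bounded[OF _ s])
  show "def2 30 (\<lambda>u \<zeta>. maps_to E e \<zeta> u)" by (rule def2I) (intro dj_rules | simp add: e)+
qed (use e(2) in blast)

lemma sm_un:
  assumes a: "sm a" "a \<in> W" and b: "sm b" "b \<in> W" and U: "U \<in> W" "\<And>u. E u U \<Longrightarrow> E u a \<or> E u b"
  shows "sm U"
proof (rule smI[OF U(1)])
  fix e assume e: "e \<in> W" "\<And>\<zeta>. E \<zeta> \<delta> \<Longrightarrow> \<exists>u. E u U \<and> maps_to E e \<zeta> u"
    "\<And>\<zeta> \<zeta>' u. maps_to E e \<zeta> u \<Longrightarrow> maps_to E e \<zeta>' u \<Longrightarrow> \<zeta> = \<zeta>'"
  have e3: "\<forall>\<zeta> \<zeta>' u. maps_to E e \<zeta> u \<longrightarrow> maps_to E e \<zeta>' u \<longrightarrow> \<zeta> = \<zeta>'"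
    using e(3) by blast
  obtain \<beta> where \<beta>: "E \<beta> \<delta>" "\<And>u \<zeta>. E u a \<Longrightarrow> E \<zeta> \<delta> \<Longrightarrow> maps_to E e \<zeta> u \<Longrightarrow> E \<zeta> \<beta>"
    using inj_bounded[OF a e(1) e3] by blast
  obtain \<gamma> where \<gamma>: "E \<gamma> \<delta>" "\<And>u \<zeta>. E u b \<Longrightarrow> E \<zeta> \<delta> \<Longrightarrow> maps_to E e \<zeta> u \<Longrightarrow> E \<zeta> \<gamma>"
    using inj_bounded[OF b e(1) e3] by blast
  have *: "E \<zeta> \<beta> \<or> E \<zeta> \<gamma>" if "E \<zeta> \<delta>" for \<zeta>
    using e(2)[OF that] U(2) \<beta>(2) \<gamma>(2) that by blast
  show "\<exists>\<gamma>. E \<gamma> \<delta> \<and> (\<forall>\<zeta>. E \<zeta> \<delta> \<longrightarrow> E \<zeta> \<gamma>)"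
    using ordinal_linear[OF d_ord \<beta>(1) \<gamma>(1)] * \<beta>(1) \<gamma>(1)
      ordinal_trans[OF d_mem_ord[OF \<beta>(1)]] ordinal_trans[OF d_mem_ord[OF \<gamma>(1)]] by blast
qed

text \<open>Given an injection of \<delta> into \<open>U\<close>, every piece bounds the indices
  that land in it, because it is covered by a small set. The least such bounds form a map on
  \<open>c\<close> and are bounded once more, by regularity.\<close>

lemma sm_Union:
  assumes c: "sm c" "c \<in> W" and U: "U \<in> W" and F: "def2 10 F"
    and s: "\<And>x. E x c \<Longrightarrow> \<exists>s\<in>W. sm s \<and> (\<forall>u. E u U \<longrightarrow> F u x \<longrightarrow> E u s)"
    and onto: "\<And>u. E u U \<Longrightarrow> \<exists>x. E x c \<and> F u x"
  shows "sm U"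
proof (rule smI[OF U])
  fix e assume e: "e \<in> W" "\<And>\<zeta>. E \<zeta> \<delta> \<Longrightarrow> \<exists>u. E u U \<and> maps_to E e \<zeta> u"
    "\<And>\<zeta> \<zeta>' u. maps_to E e \<zeta> u \<Longrightarrow> maps_to E e \<zeta>' u \<Longrightarrow> \<zeta> = \<zeta>'"
  have e3: "\<forall>\<zeta> \<zeta>' u. maps_to E e \<zeta> u \<longrightarrow> maps_to E e \<zeta>' u \<longrightarrow> \<zeta> = \<zeta>'"
    using e(3) by blast
  define B where "B x \<gamma> \<longleftrightarrow> (\<forall>\<zeta>. E \<zeta> \<delta> \<longrightarrow> (\<exists>u. E u U \<and> (maps_to E e \<zeta> u \<and> F u x)) \<longrightarrow> E \<zeta> \<gamma>)" for x \<gamma>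
  define Q where "Q x \<gamma> \<longleftrightarrow> B x \<gamma> \<and> (\<forall>\<beta>. E \<beta> \<gamma> \<longrightarrow> \<not> B x \<beta>)" for x \<gamma>
  have "def2 30 Q"
    unfolding Q_def B_def
    by (rule def2I) (intro dj_rules def2D[OF F] trm_shift | simp add: e U d_in)+
  moreover have "\<alpha> = \<alpha>'" if "E x c" "E \<alpha> \<delta>" "E \<alpha>' \<delta>" "Q x \<alpha>" "Q x \<alpha>'" for x \<alpha> \<alpha>'
    using that ordinal_linear[OF d_ord that(2,3)] unfolding Q_def by blast
  ultimately obtain \<gamma> where g: "E \<gamma> \<delta>" "\<And>x \<alpha>. E x c \<Longrightarrow> E \<alpha> \<delta> \<Longrightarrow> Q x \<alpha> \<Longrightarrow> E \<alpha> \<gamma>"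
    using bounded[OF _ c, of Q] by blast
  have "E \<zeta> \<gamma>" if z: "E \<zeta> \<delta>" for \<zeta>
  proof -
    obtain u where u: "E u U" "maps_to E e \<zeta> u" using e(2)[OF z] by blast
    then obtain x where x: "E x c" "F u x" using onto by blast
    obtain s where s': "s \<in> W" "sm s" "\<And>u. E u U \<Longrightarrow> F u x \<Longrightarrow> E u s" using s[OF x(1)] by blast
    obtain \<beta> where \<beta>: "E \<beta> \<delta>" "\<And>u \<zeta>. E u s \<Longrightarrow> E \<zeta> \<delta> \<Longrightarrow> maps_to E e \<zeta> u \<Longrightarrow> E \<zeta> \<beta>"
      using inj_bounded[OF s'(2,1) e(1) e3] by blast
    then have "E \<beta> \<delta> \<and> B x \<beta>" unfolding B_def using s'(3) by blast
    then obtain \<alpha> where \<alpha>: "E \<alpha> \<delta> \<and> B x \<alpha>" "\<And>y. E y \<alpha> \<Longrightarrow> \<not> (E y \<delta> \<and> B x y)"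
      using E_minimal[of "\<lambda>\<beta>. E \<beta> \<delta> \<and> B x \<beta>"] by blast
    then have "Q x \<alpha>" unfolding Q_def using ordinal_trans[OF d_ord] by blast
    then have "E \<alpha> \<gamma>" using g(2)[OF x(1)] \<alpha>(1) by blast
    moreover have "E \<zeta> \<alpha>" using \<alpha>(1) z u x(2) unfolding B_def by blast
    ultimately show ?thesis using ordinal_trans[OF d_mem_ord[OF g(1)]] by blast
  qed
  then show "\<exists>\<gamma>. E \<gamma> \<delta> \<and> (\<forall>\<zeta>. E \<zeta> \<delta> \<longrightarrow> E \<zeta> \<gamma>)" using g(1) by blast
qed

text \<open>An infinite \<delta> has a nonempty member. Regularity, applied to the constant map with
  value \<gamma> on that member, gives something above \<gamma>.\<close>

lemma d_limit:
  assumes "E \<gamma> \<delta>"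
  shows "\<exists>\<gamma>'. E \<gamma>' \<delta> \<and> E \<gamma> \<gamma>'"
proof -
  have "\<exists>\<beta> x. E \<beta> \<delta> \<and> E x \<beta>"
  proof (rule ccontr)
    assume "\<not> (\<exists>\<beta> x. E \<beta> \<delta> \<and> E x \<beta>)"
    then have "x = y" if "E x \<delta>" "E y \<delta>" for x y using ordinal_linear[OF d_ord that] that by blast
    then have "ext E \<delta> \<subseteq> {\<gamma>}" using assms by (auto simp: ext_def)
    then show False using d_inf finite_subset by blast
  qed
  then obtain \<beta> x where \<beta>: "E \<beta> \<delta>" "E x \<beta>" by blast
  have "def2 35 (\<lambda>\<eta> \<alpha>. \<alpha> = \<gamma>)"
    by (rule def2I) (intro dj_rules | simp add: d_mem_in assms)+
  from bounded_ordinal[OF this \<beta>(1)] show ?thesis using \<beta>(2) assms by blast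
qed

lemma sm_mem: assumes "E \<xi> \<delta>" shows "sm \<xi>"
proof -
  have "def2 40 (=)" by (rule def2I) (intro dj_rules)
  from ex_rel[OF this d_mem_in[OF assms] d_mem_in[OF assms]] obtain f where f: "f \<in> W"
    "\<And>p. E p f \<Longrightarrow> \<exists>x y. E x \<xi> \<and> E y \<xi> \<and> is_opair E p x y"
    "\<And>x y. maps_to E f x y \<longleftrightarrow> E x \<xi> \<and> E y \<xi> \<and> x = y" by blast
  have "is_function E f \<xi> (ext E \<xi>)"
    by (rule is_functionI) (use f(2,3) in \<open>auto simp: ext_def\<close>)
  then have "is_bijection E f \<xi> \<xi>" unfolding is_bijection_def using f(3) by auto
  then show ?thesis unfolding sm_def using assms f(1) by blast
qed

text \<open>Order \<open>U\<close> by the stage of first appearance and, within a stage, by a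
  well-order. Each element then has only a small set of predecessors, so by regularity its rank
  stays below \<delta>; the rank is injective since the order is total.\<close>

theorem chain_injects:
  assumes U: "U \<in> W" and F: "def2 10 F"
    and mono: "\<And>u \<xi> \<xi>'. E u U \<Longrightarrow> F u \<xi> \<Longrightarrow> E \<xi> \<xi>' \<Longrightarrow> E \<xi>' \<delta> \<Longrightarrow> F u \<xi>'"
    and onto: "\<And>u. E u U \<Longrightarrow> \<exists>\<xi>. E \<xi> \<delta> \<and> F u \<xi>"
    and small: "\<And>\<xi>. E \<xi> \<delta> \<Longrightarrow> \<exists>s\<in>W. sm s \<and> (\<forall>u. E u U \<longrightarrow> F u \<xi> \<longrightarrow> E u s)"
  shows "\<exists>i\<in>W. inj_into i U \<delta>"
proof -
  obtain \<theta> k where k: "\<theta> \<in> W" "k \<in> W" "is_ordinal E \<theta>" "is_bijection E k \<theta> U"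
    using well_ordering[OF U] by blast
  note kD = is_bijectionD[OF k(4)]
  define A where "A u \<xi> \<longleftrightarrow> F u \<xi> \<and> (\<forall>\<eta>. E \<eta> \<xi> \<longrightarrow> \<not> F u \<eta>)" for u \<xi>
  define r where "r u v \<longleftrightarrow> (\<exists>\<xi>. E \<xi> \<delta> \<and> (\<exists>\<zeta>. E \<zeta> \<delta> \<and> (A u \<xi> \<and> A v \<zeta> \<and> (E \<xi> \<zeta> \<or> \<xi> = \<zeta> \<and>
      (\<exists>a. E a \<theta> \<and> (\<exists>b. E b \<theta> \<and> (E a b \<and> maps_to E k a u \<and> maps_to E k b v)))))))" for u v
  have "\<exists>\<xi>. E \<xi> \<delta> \<and> A u \<xi>" if u: "E u U" for u
  proof -
    obtain \<xi> where "E \<xi> \<delta> \<and> F u \<xi>" using onto[OF u] by blast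
    then obtain m where "E m \<delta> \<and> F u m" "\<And>y. E y m \<Longrightarrow> \<not> (E y \<delta> \<and> F u y)"
      using E_minimal[of "\<lambda>\<xi>. E \<xi> \<delta> \<and> F u \<xi>"] by blast
    then show ?thesis unfolding A_def using ordinal_trans[OF d_ord] by blast
  qed
  then obtain fa where fa: "\<And>u. E u U \<Longrightarrow> E (fa u) \<delta> \<and> A u (fa u)" by metis
  have A_fa: "\<xi> = fa u" if "E u U" "E \<xi> \<delta>" "A u \<xi>" for u \<xi>
    using fa[OF that(1)] ordinal_linear[OF d_ord that(2), of "fa u"] that(3) unfolding A_def by blast
  obtain kk where kk: "\<And>u. E u U \<Longrightarrow> maps_to E k (kk u) u" using kD(5) by metis
  have k_kk: "a = kk u" if "maps_to E k a u" for a u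
    using kk[of u] kD(1,3)[OF that] by blast
  have r_iff: "r u v \<longleftrightarrow> E (fa u) (fa v) \<or> fa u = fa v \<and> E (kk u) (kk v)" if uv: "E u U" "E v U" for u v
  proof
    assume "r u v"
    then show "E (fa u) (fa v) \<or> fa u = fa v \<and> E (kk u) (kk v)"
      using A_fa[OF uv(1)] A_fa[OF uv(2)] k_kk unfolding r_def by blast
  next
    assume "E (fa u) (fa v) \<or> fa u = fa v \<and> E (kk u) (kk v)"
    then show "r u v"
      using fa[OF uv(1)] fa[OF uv(2)] kk[OF uv(1)] kk[OF uv(2)] kD(1) unfolding r_def by blast
  qed
  have wf: "wfp (\<lambda>x y. E x U \<and> E y U \<and> r x y)"
  proof -
    have "wf {(x, y). E x y}" using E_wf by (simp add: wfp_def)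
    then have "wf (inv_image ({(x, y). E x y} <*lex*> {(x, y). E x y}) (\<lambda>u. (fa u, kk u)))"
      by (intro wf_inv_image wf_lex_prod)
    then show ?thesis
      unfolding wfp_def by (rule wf_subset) (auto simp: r_iff)
  qed
  have r_def2: "def2 20 r"
    unfolding r_def A_def
    by (rule def2I) (intro dj_rules def2D[OF F] trm_shift | simp add: d_in k)+
  have H_def2: "def2 20 (\<lambda>v q. E v q \<or> v = q)"
    by (rule def2I) (intro dj_rules trm_shift)
  have "\<exists>h\<in>W. \<forall>v\<in>W. E v h \<longleftrightarrow> E v q \<or> v = q" if "q \<in> W" for q
    using ex_insert[OF that that] by blast
  from recursion[OF U wf r_def2 H_def2 this] obtain g G where G: "G \<in> W" "is_rel G"
    "\<And>x y. maps_to E G x y \<longleftrightarrow> E x U \<and> y = g x"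
    and g: "\<And>x. E x U \<Longrightarrow> g x \<in> W"
    and gmem: "\<And>x v. E x U \<Longrightarrow> v \<in> W \<Longrightarrow> E v (g x) \<longleftrightarrow> (\<exists>z. E z U \<and> r z x \<and> (E v (g z) \<or> v = g z))"
    by (smt (verit))
  have gmem': "E v (g x) \<longleftrightarrow> (\<exists>z. E z U \<and> r z x \<and> (E v (g z) \<or> v = g z))" if x: "E x U" for v x
    using gmem[OF x, of v] g W_trans x by metis
  have gd: "E (g u) \<delta>" if "E u U" for u
    using that
  proof (induction u rule: wfp_induct_rule[OF wf])
    case (1 u)
    note u = \<open>E u U\<close>
    have IH: "E (g z) \<delta>" if "E z U" "r z u" for z using 1 that by blast
    \<comment> \<open>Every predecessor of \<open>u\<close> has appeared by stage
      \<open>fa u\<close>, hence lies in the small set \<open>s\<close>, and one \<gamma> below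
      \<delta> bounds the ranks of them all.\<close>
    obtain s where s: "s \<in> W" "sm s" "\<And>z. E z U \<Longrightarrow> F z (fa u) \<Longrightarrow> E z s"
      using small fa[OF u] by blast
    have zs: "E z s" if z: "E z U" "r z u" for z
    proof -
      have "E (fa z) (fa u) \<or> fa z = fa u" using z r_iff u by blast
      moreover have "F z (fa z)" using fa[OF z(1)] unfolding A_def by blast
      ultimately have "F z (fa u)" using mono[OF z(1)] fa[OF u] by auto
      then show ?thesis using s(3) z(1) by blast
    qed
    have "def2 30 (\<lambda>z \<alpha>. maps_to E G z \<alpha>)"
      by (rule def2I) (intro dj_rules | simp add: G)+
    from bounded[OF this s(2,1)] obtain \<gamma> where \<gamma>: "E \<gamma> \<delta>"
      "\<And>z. E z s \<Longrightarrow> E z U \<Longrightarrow> E (g z) \<delta> \<Longrightarrow> E (g z) \<gamma>"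
      unfolding G(3) by blast
    have sub: "E v \<gamma>" if v: "E v (g u)" for v
    proof -
      obtain z where z: "E z U" "r z u" "E v (g z) \<or> v = g z" using gmem'[OF u] v by blast
      then have "E (g z) \<gamma>" using \<gamma>(2) zs IH by blast
      then show ?thesis using z(3) ordinal_trans[OF d_mem_ord[OF \<gamma>(1)]] by blast
    qed
    have "is_ordinal E (g u)"
    proof (rule ordinalI)
      show "is_ordinal E x" if "E x (g u)" for x
        using sub[OF that] ordinal_mem d_mem_ord \<gamma>(1) by blast
      show "E y (g u)" if "E x (g u)" "E y x" for x y
        using that IH ordinal_trans[OF d_mem_ord] unfolding gmem'[OF u] by blast
    qed
    then have "g u = \<gamma> \<or> E (g u) \<gamma>"
      using ordinal_subset_mem[OF _ d_mem_ord[OF \<gamma>(1)]] sub by blast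
    then show ?case using \<gamma>(1) ordinal_trans[OF d_ord] by blast
  qed
  have "is_function E G U (ext E \<delta>)"
  proof (rule is_functionI)
    fix p assume "E p G"
    then obtain x y where "is_opair E p x y" "maps_to E G x y"
      using G(2) maps_toI unfolding is_rel_def by metis
    then show "\<exists>x y. E x U \<and> y \<in> ext E \<delta> \<and> is_opair E p x y"
      using gd unfolding G(3) ext_def by blast
  qed (simp_all add: G(3))
  moreover have "x = x'" if "maps_to E G x y" "maps_to E G x' y" for x x' y
  proof (rule ccontr)
    assume "x \<noteq> x'"
    have x: "E x U" "E x' U" "g x = g x'" using that unfolding G(3) by auto
    have "fa x \<in> ext E \<delta>" "fa x' \<in> ext E \<delta>" using fa x by (auto simp: ext_def)
    then have "E (fa x) (fa x') \<or> fa x = fa x' \<or> E (fa x') (fa x)"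
      using ordinal_linear[OF d_ord] by (auto simp: ext_def)
    moreover have "kk x \<noteq> kk x'" using kk[OF x(1)] kk[OF x(2)] kD(2) \<open>x \<noteq> x'\<close> by metis
    moreover have "E (kk x) (kk x') \<or> kk x = kk x' \<or> E (kk x') (kk x)"
      using ordinal_linear[OF k(3)] kk x kD(1) by blast
    ultimately have "r x x' \<or> r x' x" using r_iff[OF x(1,2)] r_iff[OF x(2,1)] by auto
    then have "E (g x) (g x') \<or> E (g x') (g x)" using gmem' x by blast
    then show False using x(3) E_irrefl by simp
  qed
  ultimately have "inj_into G U \<delta>" unfolding inj_into_def by blast
  then show ?thesis using G(1) by blast
qed

text \<open>The square of \<delta> is the increasing union of the squares of its members, each of
  them small. This gives a pairing inside every model that satisfies \<open>reg\<close>, without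
  cardinal arithmetic.\<close>

lemma d_pairing:
  assumes Y: "Y \<in> W" "\<And>p. E p Y \<longleftrightarrow> (\<exists>a. E a \<delta> \<and> (\<exists>b. E b \<delta> \<and> is_opair E p a b))"
  shows "\<exists>i\<in>W. inj_into i Y \<delta>"
proof -
  define F where "F p \<xi> \<longleftrightarrow> (\<exists>a. E a \<xi> \<and> (\<exists>b. E b \<xi> \<and> is_opair E p a b))" for p \<xi>
  show ?thesis
  proof (rule chain_injects[OF Y(1)])
    show "def2 10 F" unfolding F_def by (rule def2I) (intro dj_rules trm_shift)
    show "F u \<xi>'" if "F u \<xi>" "E \<xi> \<xi>'" "E \<xi>' \<delta>" for u \<xi> \<xi>'
      using that ordinal_trans[OF d_mem_ord[OF that(3)]] unfolding F_def by blast
    show "\<exists>\<xi>. E \<xi> \<delta> \<and> F p \<xi>" if p: "E p Y" for p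
    proof -
      obtain a b where ab: "E a \<delta>" "E b \<delta>" "is_opair E p a b" using p Y(2) by blast
      obtain a' b' where ab': "E a' \<delta>" "E a a'" "E b' \<delta>" "E b b'" using d_limit ab by blast
      then show ?thesis
        using ordinal_linear[OF d_ord ab'(1,3)] ab(3) ordinal_trans[OF d_mem_ord[OF ab'(1)]]
          ordinal_trans[OF d_mem_ord[OF ab'(3)]] unfolding F_def by blast
    qed
    fix \<xi> assume \<xi>: "E \<xi> \<delta>"
    note \<xi>W = d_mem_in[OF \<xi>]
    obtain S where S: "S \<in> W" "\<And>p. E p S \<longleftrightarrow> (\<exists>x. E x \<xi> \<and> (\<exists>y. E y \<xi> \<and> is_opair E p x y))"
      using ex_prod[OF \<xi>W \<xi>W] by blast
    have "sm S"
    proof (rule sm_Union[OF sm_mem[OF \<xi>] \<xi>W S(1)])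
      show "def2 10 (\<lambda>p a. \<exists>b. E b \<xi> \<and> is_opair E p a b)"
        by (rule def2I) (intro dj_rules trm_shift | simp add: \<xi>W)+
      show "\<exists>x. E x \<xi> \<and> (\<exists>b. E b \<xi> \<and> is_opair E u x b)" if "E u S" for u
        using that S(2) by blast
      fix a assume a: "E a \<xi>"
      have aW: "a \<in> W" using a W_trans \<xi>W by blast
      obtain A where A: "A \<in> W" "\<And>x. E x A \<longleftrightarrow> x = a" using ex_singleton[OF aW] by blast
      obtain s where s: "s \<in> W" "\<And>p. E p s \<longleftrightarrow> (\<exists>x. E x A \<and> (\<exists>y. E y \<xi> \<and> is_opair E p x y))"
        using ex_prod[OF A(1) \<xi>W] by blast
      have "sm s"
      proof (rule sm_image[OF sm_mem[OF \<xi>] \<xi>W s(1)])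
        show "def2 20 (\<lambda>b p. is_opair E p a b)"
          by (rule def2I) (intro dj_rules trm_shift | simp add: aW)+
        show "\<exists>b. E b \<xi> \<and> is_opair E u a b" if "E u s" for u
          using that by (simp add: s(2) A(2))
      qed (use is_opair_fun in blast)
      moreover have "E p s" if "\<exists>b. E b \<xi> \<and> is_opair E p a b" for p
        using that s(2) A(2) by blast
      ultimately show "\<exists>s\<in>W. sm s \<and> (\<forall>u. E u S \<longrightarrow> (\<exists>b. E b \<xi> \<and> is_opair E u a b) \<longrightarrow> E u s)"
        using s(1) by blast
    qed
    then show "\<exists>s\<in>W. sm s \<and> (\<forall>u. E u Y \<longrightarrow> F u \<xi> \<longrightarrow> E u s)"
      using S unfolding F_def by blast
  qed
qed

end

section \<open>Transitive closure and rank\<close>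

context mst
begin

text \<open>Minimality is tested against sets of \<open>W\<close> only, as uniqueness within
  \<open>W\<close> is all that replacement needs.\<close>

definition is_tc :: "'a \<Rightarrow> 'a \<Rightarrow> bool" where
  "is_tc x t \<longleftrightarrow> (\<forall>u. E u x \<longrightarrow> E u t) \<and> (\<forall>u. E u t \<longrightarrow> (\<forall>v. E v u \<longrightarrow> E v t)) \<and>
     (\<forall>t'\<in>W. (\<forall>u. E u x \<longrightarrow> E u t') \<and> (\<forall>u. E u t' \<longrightarrow> (\<forall>v. E v u \<longrightarrow> E v t')) \<longrightarrow> (\<forall>u. E u t \<longrightarrow> E u t'))"

lemma is_tcD:
  assumes "is_tc x t"
  shows "E u x \<Longrightarrow> E u t" "E u t \<Longrightarrow> E v u \<Longrightarrow> E v t"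
    "t' \<in> W \<Longrightarrow> \<forall>u. E u x \<longrightarrow> E u t' \<Longrightarrow> \<forall>u. E u t' \<longrightarrow> (\<forall>v. E v u \<longrightarrow> E v t') \<Longrightarrow> E u t \<Longrightarrow> E u t'"
proof -
  have "\<forall>u. E u x \<longrightarrow> E u t" "\<forall>u. E u t \<longrightarrow> (\<forall>v. E v u \<longrightarrow> E v t)"
    using assms by (simp_all add: is_tc_def)
  then show "E u x \<Longrightarrow> E u t" "E u t \<Longrightarrow> E v u \<Longrightarrow> E v t"
    by simp_all
  assume t': "t' \<in> W" and A: "\<forall>u. E u x \<longrightarrow> E u t'" "\<forall>u. E u t' \<longrightarrow> (\<forall>v. E v u \<longrightarrow> E v t')" and "E u t"
  have "(\<forall>u. E u x \<longrightarrow> E u t') \<and> (\<forall>u. E u t' \<longrightarrow> (\<forall>v. E v u \<longrightarrow> E v t')) \<longrightarrow> (\<forall>u. E u t \<longrightarrow> E u t')"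
    using assms unfolding is_tc_def by (elim conjE) (rule bspec[OF _ t'])
  from mp[OF this conjI[OF A]] show "E u t'" using \<open>E u t\<close> by blast
qed

text \<open>Membership induction takes the place of iteration along the natural numbers: the
  closures of the members of \<open>x\<close> are collected by replacement and united with
  \<open>x\<close>.\<close>

lemma ex_tc: "x \<in> W \<Longrightarrow> \<exists>t\<in>W. is_tc x t"
proof (induction x rule: E_induct)
  case (mem x)
  have IH: "\<exists>t\<in>W. is_tc u t" if "E u x" for u
    using mem.IH[OF that] W_trans[OF mem.prems that] by blast
  have tc_fun: "t = t'" if t: "t \<in> W" "t' \<in> W" "is_tc u t" "is_tc u t'" for u t t'
  proof (rule E_ext)
    fix z
    show "E z t \<longleftrightarrow> E z t'"
    proof
      show "E z t \<Longrightarrow> E z t'"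
        by (erule is_tcD(3)[OF t(3,2), rotated 2]) (use is_tcD(1,2)[OF t(4)] in blast)+
      show "E z t' \<Longrightarrow> E z t"
        by (erule is_tcD(3)[OF t(4,1), rotated 2]) (use is_tcD(1,2)[OF t(3)] in blast)+
    qed
  qed
  have "\<exists>b\<in>W. \<forall>t. E t b \<longleftrightarrow> t \<in> W \<and> (\<exists>u. E u x \<and> is_tc u t)"
  proof (rule repl[OF _ mem.prems])
    show "df 60 (\<lambda>e. is_tc (e 0) (e 1))" unfolding is_tc_def by (intro dj_rules | simp)+
  qed (rule tc_fun)
  then obtain b where b: "b \<in> W" "\<And>t. E t b \<longleftrightarrow> t \<in> W \<and> (\<exists>u. E u x \<and> is_tc u t)" by blast
  obtain c where c: "c \<in> W" "\<And>z. E z c \<longleftrightarrow> (\<exists>t. E t b \<and> E z t)" using ex_union[OF b(1)] by blast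
  obtain t where t: "t \<in> W" "\<And>z. E z t \<longleftrightarrow> E z x \<or> E z c" using ex_un[OF mem.prems c(1)] by blast
  have c_iff: "E z c \<longleftrightarrow> (\<exists>u t. E u x \<and> t \<in> W \<and> is_tc u t \<and> E z t)" for z
    unfolding c(2) b(2) by blast
  have "is_tc x t"
    unfolding is_tc_def
  proof (intro conjI allI impI ballI)
    show "E u t" if "E u x" for u using that t(2) by blast
    show "E v t" if "E u t" "E v u" for u v
    proof (cases "E u x")
      case True
      obtain s where "s \<in> W" "is_tc u s" using IH[OF True] by blast
      then have "E v c" using c_iff[of v] True is_tcD(1) \<open>E v u\<close> by blast
      then show ?thesis using t(2) by blast
    next
      case False
      then obtain w s where "E w x" "s \<in> W" "is_tc w s" "E u s" using \<open>E u t\<close> t(2) c_iff[of u] by blast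
      then have "E v c" using c_iff[of v] is_tcD(2) \<open>E v u\<close> by blast
      then show ?thesis using t(2) by blast
    qed
    fix t' v assume t': "t' \<in> W" "(\<forall>u. E u x \<longrightarrow> E u t') \<and> (\<forall>u. E u t' \<longrightarrow> (\<forall>v. E v u \<longrightarrow> E v t'))" "E v t"
    show "E v t'"
    proof (cases "E v x")
      case False
      then obtain u s where s: "E u x" "s \<in> W" "is_tc u s" "E v s" using t'(3) t(2) c_iff[of v] by blast
      show ?thesis by (rule is_tcD(3)[OF s(3) t'(1) _ _ s(4)]) (use t'(2) s(1) in blast)+
    qed (use t'(2) in blast)
  qed
  then show ?case using t(1) by blast
qed

lemma wf_E_on: "wfp (\<lambda>x y. E x D \<and> E y D \<and> E x y)"
  using E_wf unfolding wfp_def by (rule wf_subset) auto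

lemma ex_rank:
  assumes "x \<in> W"
  shows "\<exists>t \<alpha> g. (\<forall>u. E u x \<longrightarrow> E u t) \<and> (\<forall>u v. E u t \<longrightarrow> E v u \<longrightarrow> E v t) \<and> \<alpha> \<in> W \<and> is_ordinal E \<alpha> \<and>
    (\<forall>u. E u t \<longrightarrow> E (g u) \<alpha>) \<and> (\<forall>u v. E u t \<longrightarrow> E v u \<longrightarrow> E (g v) (g u))"
proof -
  obtain t where t: "t \<in> W" "is_tc x t" using ex_tc[OF assms] by blast
  have r: "def2 20 E" by (rule def2I) (intro dj_rules)
  have H: "def2 20 (\<lambda>v q. E v q \<or> v = q)" by (rule def2I) (intro dj_rules)
  have "\<exists>h\<in>W. \<forall>v\<in>W. E v h \<longleftrightarrow> E v q \<or> v = q" if "q \<in> W" for q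
    using ex_insert[OF that that] by blast
  from recursion[OF t(1) wf_E_on r H this] obtain g G where G: "G \<in> W"
    "\<And>x y. maps_to E G x y \<longleftrightarrow> E x t \<and> y = g x"
    and g: "\<And>x. E x t \<Longrightarrow> g x \<in> W"
    and gmem: "\<And>x v. E x t \<Longrightarrow> v \<in> W \<Longrightarrow> E v (g x) \<longleftrightarrow> (\<exists>z. E z t \<and> E z x \<and> (E v (g z) \<or> v = g z))"
    by (smt (verit))
  have gmem': "E v (g x) \<longleftrightarrow> (\<exists>z. E z t \<and> E z x \<and> (E v (g z) \<or> v = g z))" if x: "E x t" for v x
    using gmem[OF x, of v] g W_trans x by metis
  have ord: "E u t \<Longrightarrow> is_ordinal E (g u)" for u
  proof (induction u rule: E_induct)
    case (mem u)
    show ?case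
    proof (rule ordinalI)
      show "is_ordinal E v" if "E v (g u)" for v
        using that mem ordinal_mem unfolding gmem'[OF mem.prems] by blast
      show "E w (g u)" if "E v (g u)" "E w v" for v w
        using that mem ordinal_trans unfolding gmem'[OF mem.prems] by blast
    qed
  qed
  obtain R where R: "R \<in> W" "\<And>y. E y R \<longleftrightarrow> (\<exists>x. maps_to E G x y)" using ex_ran[OF G(1)] by blast
  obtain S where S: "S \<in> W" "\<And>y. E y S \<longleftrightarrow> (\<exists>x. E x R \<and> E y x)" using ex_union[OF R(1)] by blast
  obtain \<alpha> where \<alpha>: "\<alpha> \<in> W" "\<And>y. E y \<alpha> \<longleftrightarrow> E y R \<or> E y S" using ex_un[OF R(1) S(1)] by blast
  have \<alpha>_iff: "E y \<alpha> \<longleftrightarrow> (\<exists>u. E u t \<and> (y = g u \<or> E y (g u)))" for y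
    unfolding \<alpha>(2) S(2) R(2) G(2) by blast
  have "is_ordinal E \<alpha>"
  proof (rule ordinalI)
    show "is_ordinal E y" if "E y \<alpha>" for y
      using that ord ordinal_mem unfolding \<alpha>_iff by blast
    show "E z \<alpha>" if "E y \<alpha>" "E z y" for y z
      using that ord ordinal_trans unfolding \<alpha>_iff by blast
  qed
  moreover have "E (g v) (g u)" if "E u t" "E v u" for u v
    using that gmem' is_tcD(2)[OF t(2) that] by blast
  ultimately show ?thesis
    using \<alpha>(1) \<alpha>_iff is_tcD(1,2)[OF t(2)] by (intro exI[of _ t] exI[of _ \<alpha>] exI[of _ g]) blast
qed

lemma cumulative_hierarchy:
  assumes \<alpha>: "\<alpha> \<in> W" "is_ordinal E \<alpha>"
  shows "\<exists>h. h \<alpha> \<in> W \<and> (\<forall>\<gamma> v. v \<in> W \<longrightarrow> E \<gamma> \<alpha> \<or> \<gamma> = \<alpha> \<longrightarrow>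
    (E v (h \<gamma>) \<longleftrightarrow> (\<exists>\<beta>. E \<beta> \<gamma> \<and> (\<forall>z. E z v \<longrightarrow> E z (h \<beta>)))))"
proof -
  obtain D where D: "D \<in> W" "\<And>z. E z D \<longleftrightarrow> E z \<alpha> \<or> z = \<alpha>" using ex_insert[OF \<alpha>(1,1)] by blast
  have r: "def2 20 E" by (rule def2I) (intro dj_rules)
  have H: "def2 20 (\<lambda>v q. \<forall>z. E z v \<longrightarrow> E z q)" by (rule def2I) (intro dj_rules trm_shift)
  have "\<exists>h\<in>W. \<forall>v\<in>W. E v h \<longleftrightarrow> (\<forall>z. E z v \<longrightarrow> E z q)" if "q \<in> W" for q
    using ex_power[OF that] by blast
  from recursion[OF D(1) wf_E_on r H this] obtain h
    where h: "\<And>x. E x D \<Longrightarrow> h x \<in> W"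
    and hmem: "\<And>x v. E x D \<Longrightarrow> v \<in> W \<Longrightarrow>
      E v (h x) \<longleftrightarrow> (\<exists>\<beta>. E \<beta> D \<and> E \<beta> x \<and> (\<forall>z. E z v \<longrightarrow> E z (h \<beta>)))"
    by (smt (verit))
  have "E \<beta> D" if "E \<gamma> \<alpha> \<or> \<gamma> = \<alpha>" "E \<beta> \<gamma>" for \<beta> \<gamma>
    using that D(2) ordinal_trans[OF \<alpha>(2)] by blast
  then have "E v (h \<gamma>) \<longleftrightarrow> (\<exists>\<beta>. E \<beta> \<gamma> \<and> (\<forall>z. E z v \<longrightarrow> E z (h \<beta>)))" if "v \<in> W" "E \<gamma> \<alpha> \<or> \<gamma> = \<alpha>" for \<gamma> v
    using hmem[of \<gamma> v] D(2)[of \<gamma>] that by blast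
  then show ?thesis using h[of \<alpha>] D(2) by blast
qed

end

text \<open>The rank \<alpha> of \<open>x\<close> is found in \<open>W'\<close> but lies in
  \<open>W\<close> because it is an ordinal, and level \<alpha> of the hierarchy built in
  \<open>W\<close> contains all members of \<open>x\<close> that belong to \<open>W\<close>. The
  trace of \<open>x\<close> on \<open>W\<close> is only bounded in this way; it need not be an
  element of \<open>W\<close>.\<close>

lemma bounded_trace:
  assumes "mst E W" "mst E W'" and sub: "W \<subseteq> W'"
    and ords: "\<And>\<alpha>. \<alpha> \<in> W' \<Longrightarrow> is_ordinal E \<alpha> \<Longrightarrow> \<alpha> \<in> W" and x: "x \<in> W'"
  shows "\<exists>z\<in>W. \<forall>u. E u x \<longrightarrow> u \<in> W \<longrightarrow> E u z"
proof -
  interpret W: mst E W by fact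
  interpret W': mst E W' by fact
  obtain t \<alpha> g where t: "\<And>u. E u x \<Longrightarrow> E u t" "\<And>u v. E u t \<Longrightarrow> E v u \<Longrightarrow> E v t"
    and \<alpha>: "\<alpha> \<in> W'" "is_ordinal E \<alpha>"
    and g: "\<And>u. E u t \<Longrightarrow> E (g u) \<alpha>" "\<And>u v. E u t \<Longrightarrow> E v u \<Longrightarrow> E (g v) (g u)"
    using W'.ex_rank[OF x] by blast
  obtain h where h: "h \<alpha> \<in> W" "\<And>\<gamma> v. v \<in> W \<Longrightarrow> E \<gamma> \<alpha> \<or> \<gamma> = \<alpha> \<Longrightarrow>
    (E v (h \<gamma>) \<longleftrightarrow> (\<exists>\<beta>. E \<beta> \<gamma> \<and> (\<forall>z. E z v \<longrightarrow> E z (h \<beta>))))"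
    using W.cumulative_hierarchy[OF ords[OF \<alpha>] \<alpha>(2)] by blast
  have *: "u \<in> W \<Longrightarrow> E u t \<Longrightarrow> E v u \<Longrightarrow> E v (h (g u))" for u v
  proof (induction u arbitrary: v rule: W.E_induct)
    case (mem u)
    have v: "v \<in> W" "E v t" using mem.prems W.W_trans t(2) by blast+
    then have "\<forall>z. E z v \<longrightarrow> E z (h (g v))" using mem.IH mem.prems(3) by blast
    then show ?case using h(2)[OF v(1)] g mem.prems by blast
  qed
  have "E u (h \<alpha>)" if "E u x" "u \<in> W" for u
    using h(2)[OF that(2), of \<alpha>] *[OF that(2) t(1)[OF that(1)]] g(1)[OF t(1)[OF that(1)]] by blast
  then show ?thesis using h(1) by blast
qed

section \<open>The embedding\<close>

lemma mst_of_zfc: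
  assumes "set_universe E" "transitive_zfc_model E W"
  shows "mst E W"
proof
  show "set_universe E" by fact
  have W: "transitive_class E W" "zfc_axioms_for E UNIV W"
    using assms(2) by (auto simp: transitive_zfc_model_def)
  moreover have "ax_separation E {\<phi>. is_Sigma 100 \<phi>} W"
    using W(2) unfolding zfc_axioms_for_def ax_separation_def by simp
  moreover have "ax_replacement E {\<phi>. is_Sigma 100 \<phi>} W"
    using W(2) unfolding zfc_axioms_for_def ax_replacement_def by simp
  ultimately show "model_of_set_theory E W"
    unfolding model_of_set_theory_def zfc_axioms_for_def by blast
qed

text \<open>For a least missing \<alpha>, the ordinals of \<open>W\<close> would be exactly the
  members of \<alpha>. The trace of \<alpha> on any \<open>a\<close> in \<open>W\<close> is then the
  set of ordinals in \<open>a\<close>, which separation provides, and approximation puts \<alpha>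
  into \<open>W\<close> after all.\<close>

lemma same_ordinals:
  assumes "mst E W" "mst E W'" and sub: "W \<subseteq> W'" and ap: "approximation_property E \<delta> W W'"
  shows "\<alpha> \<in> W' \<Longrightarrow> is_ordinal E \<alpha> \<Longrightarrow> \<alpha> \<in> W"
proof -
  interpret W: mst E W by fact
  interpret W': mst E W' by fact
  show "\<alpha> \<in> W' \<Longrightarrow> is_ordinal E \<alpha> \<Longrightarrow> \<alpha> \<in> W"
  proof (induction \<alpha> rule: W.E_induct)
    case (mem \<alpha>)
    show ?case
    proof (rule ccontr)
      assume no: "\<alpha> \<notin> W"
      have below: "\<beta> \<in> W" if "E \<beta> \<alpha>" for \<beta>
        using mem.IH[OF that] W'.W_trans[OF mem.prems(1) that] W.ordinal_mem[OF mem.prems(2) that] by blast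
      have mem_iff: "E \<gamma> \<alpha> \<longleftrightarrow> is_ordinal E \<gamma>" if "\<gamma> \<in> W" for \<gamma>
        using W.ordinal_total[OF mem.prems(2), of \<gamma>] W.ordinal_mem[OF mem.prems(2)] that no W.W_trans by blast
      have "is_set_in E W (ext E \<alpha> \<inter> ext E a)" if a: "a \<in> W" for a
      proof -
        have "\<exists>b\<in>W. \<forall>x. E x b \<longleftrightarrow> E x a \<and> is_ordinal E x"
          by (rule W.sep[OF _ a]) (intro W.dj_rules)
        then obtain b where "b \<in> W" "\<And>x. E x b \<longleftrightarrow> E x a \<and> is_ordinal E x" by blast
        moreover then have "ext E b = ext E \<alpha> \<inter> ext E a"
          using mem_iff W.W_trans[OF a] by (auto simp: ext_def)
        ultimately show ?thesis unfolding is_set_in_def by blast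
      qed
      moreover have "ext E \<alpha> \<subseteq> W" using below by (auto simp: ext_def)
      ultimately have "\<alpha> \<in> W" using ap mem.prems(1) unfolding approximation_property_def by blast
      then show False using no by blast
    qed
  qed
qed

lemma reg_of_regular:
  assumes "mst E W" "is_regular_cardinal_in E W \<delta>"
  shows "reg E W \<delta>"
proof -
  interpret mst E W by fact
  have r: "\<not> (\<exists>f\<in>W. is_function E f \<beta> (ext E \<delta>) \<and>
             (\<forall>\<alpha>. E \<alpha> \<delta> \<longrightarrow> (\<exists>x y. maps_to E f x y \<and> (E \<alpha> y \<or> \<alpha> = y))))" if "E \<beta> \<delta>" for \<beta>
    using assms(2) that unfolding is_regular_cardinal_in_def by blast
  show ?thesis
  proof
    show "\<delta> \<in> W" "is_ordinal E \<delta>" "infinite (ext E \<delta>)"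
      using assms(2) by (auto simp: is_regular_cardinal_in_def is_cardinality_in_def)
    fix \<beta> f assume "E \<beta> \<delta>" "f \<in> W" "is_function E f \<beta> (ext E \<delta>)"
    then show "\<exists>\<gamma>. E \<gamma> \<delta> \<and> (\<forall>x y. maps_to E f x y \<longrightarrow> \<not> E \<gamma> y \<and> \<gamma> \<noteq> y)"
      using r[of \<beta>] by blast
  qed
qed

lemma reg_down:
  assumes "reg E W' \<delta>" "mst E W" "W \<subseteq> W'" "\<delta> \<in> W"
  shows "reg E W \<delta>"
proof -
  interpret W': reg E W' \<delta> by fact
  interpret W: mst E W by fact
  show ?thesis
    by unfold_locales (use assms(3,4) W'.d_ord W'.d_inf W'.d_reg in blast)+
qed

locale lift = univ E
  for E :: "'a \<Rightarrow> 'a \<Rightarrow> bool" +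
  fixes V Vb M Mb N Nb :: "'a set" and j :: "'a \<Rightarrow> 'a" and \<delta> \<kappa> :: 'a
  assumes zfcV: "transitive_zfc_model E V" and zfcVb: "transitive_zfc_model E Vb"
    and V_sub: "V \<subseteq> Vb"
    and regular: "is_regular_cardinal_in E Vb \<delta>"
    and approx: "approximation_property E \<delta> V Vb" and cover: "cover_property E \<delta> V Vb"
    and Mb_sub: "Mb \<subseteq> Vb" and model_Mb: "model_of_set_theory E Mb"
    and M_def: "M = Mb \<inter> V" and model_M: "model_of_set_theory E M"
    and Nb_sub: "Nb \<subseteq> Vb" and Nb_transitive: "transitive_class E Nb"
    and elementary: "elementary_embedding E j Mb Nb" and cofinal: "cofinal_map E j Mb Nb"
    and crit: "is_critical_point E j Mb \<kappa>" and d_less: "E \<delta> \<kappa>"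
    and power_d: "\<forall>x\<in>Vb. ext E x \<subseteq> ext E \<delta> \<longrightarrow> x \<in> Mb"
    and Mb_closed: "\<forall>\<beta>. E \<beta> \<delta> \<longrightarrow> closed_under_sequences E Vb \<beta> Mb"
    and Nb_closed: "closed_under_sequences E Vb \<delta> Nb"
    and N_def: "N = (\<Union>x\<in>M. ext E (j x))"
begin

lemma mst_V: "mst E V" and mst_Vb: "mst E Vb"
  by (rule mst_of_zfc[OF univ zfcV], rule mst_of_zfc[OF univ zfcVb])

lemma ords_V: "\<alpha> \<in> Vb \<Longrightarrow> is_ordinal E \<alpha> \<Longrightarrow> \<alpha> \<in> V"
  by (rule same_ordinals[OF mst_V mst_Vb V_sub approx])

lemma reg_Vb: "reg E Vb \<delta>"
  by (rule reg_of_regular[OF mst_Vb regular])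

lemma d_facts: "\<delta> \<in> Vb" "is_ordinal E \<delta>"
  using reg_Vb by (auto simp: reg_def reg_axioms_def)

sublocale vb: reg E Vb \<delta> by (rule reg_Vb)

sublocale v: reg E V \<delta>
  by (rule reg_down[OF reg_Vb mst_V V_sub]) (rule ords_V[OF d_facts])

text \<open>As \<delta> is a subset of itself in \<open>Vb\<close>, the power set hypothesis puts it
  into \<open>Mb\<close>.\<close>

sublocale mb: reg E Mb \<delta>
  by (rule reg_down[OF reg_Vb _ Mb_sub]) (use univ model_Mb power_d d_facts in \<open>auto simp: mst_def mst_axioms_def univ_def\<close>)

sublocale m: reg E M \<delta>
  by (rule reg_down[OF reg_Vb])
    (use univ model_M M_def V_sub mb.d_in v.d_in in \<open>auto simp: mst_def mst_axioms_def univ_def\<close>)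

lemma M_iff: "x \<in> M \<longleftrightarrow> x \<in> Mb \<and> x \<in> V"
  by (simp add: M_def)

lemma ords_M: "\<alpha> \<in> Mb \<Longrightarrow> is_ordinal E \<alpha> \<Longrightarrow> \<alpha> \<in> M"
  using ords_V Mb_sub by (auto simp: M_iff)

lemma Nb_trans: "x \<in> Nb \<Longrightarrow> E y x \<Longrightarrow> y \<in> Nb"
  using Nb_transitive by (auto simp: transitive_class_def)

lemma N_iff: "y \<in> N \<longleftrightarrow> (\<exists>x\<in>M. E y (j x))"
  by (auto simp: N_def ext_def)

section \<open>Transfer of definable statements along the embedding\<close>

definition MN :: "bool \<Rightarrow> 'a set" where "MN b = (if b then Mb else Nb)"
definition cj :: "'a \<Rightarrow> bool \<Rightarrow> 'a" where "cj x b = (if b then x else j x)"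
definition CJ :: "(bool \<Rightarrow> 'a) set" where "CJ = cj ` Mb"

lemma cj_in: "x \<in> Mb \<Longrightarrow> cj x \<in> CJ"
  by (simp add: CJ_def)

lemma cj_simps [simp]: "cj x True = x" "cj x False = j x"
  by (simp_all add: cj_def)

lemma MN_simps [simp]: "MN True = Mb" "MN False = Nb"
  by (simp_all add: MN_def)

lemma j_in: "x \<in> Mb \<Longrightarrow> j x \<in> Nb"
  using elementary by (auto simp: elementary_embedding_def)

sublocale el: dj_family E MN CJ
proof
  show "transitive_class E (MN b)" for b
    using Nb_transitive model_Mb by (auto simp: MN_def model_of_set_theory_def)
  show "c b \<in> MN b" if "c \<in> CJ" for c b
    using that j_in by (auto simp: MN_def CJ_def cj_def)
  show "CJ \<noteq> {}" using mb.d_in by (auto simp: CJ_def)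
qed

text \<open>Elementarity without writing formulas: one uniform definition over source
  (\<open>True\<close>) and target (\<open>False\<close>), with every parameter \<open>x\<close>
  paired with \<open>j x\<close>, yields the same truth value on both sides. The level
  \<open>n\<close> is arbitrary because \<open>elementary\<close> covers all formulas.\<close>

lemma elem:
  assumes "dj E MN CJ n (\<lambda>b e. Q b)"
  shows "Q True \<longleftrightarrow> Q False"
proof -
  obtain \<phi> p where "lev n \<phi>" and p: "range p \<subseteq> CJ"
    "\<And>b e s. range e \<subseteq> MN b \<Longrightarrow> range s \<subseteq> MN b \<Longrightarrow> sat E (MN b) (mrg e (\<lambda>k. p k b) s) \<phi> \<longleftrightarrow> Q b"
    by (erule djE[OF assms])
  define e where "e = mrg (\<lambda>_. \<delta>) (\<lambda>k. p k True) (\<lambda>_. \<delta>)"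
  have pj: "p k False = j (p k True)" "p k True \<in> Mb" for k
  proof -
    have "p k \<in> CJ" using p(1) by blast
    then show "p k False = j (p k True)" "p k True \<in> Mb" by (auto simp: CJ_def)
  qed
  have "range e \<subseteq> Mb" using pj mb.d_in by (auto simp: e_def mrg_def)
  then have "sat E Mb e \<phi> \<longleftrightarrow> sat E Nb (\<lambda>n. j (e n)) \<phi>"
    using elementary by (simp add: elementary_embedding_def)
  moreover have "(\<lambda>n. j (e n)) = mrg (\<lambda>_. j \<delta>) (\<lambda>k. p k False) (\<lambda>_. j \<delta>)"
    by (auto simp: e_def mrg_def pj)
  moreover have "sat E Mb e \<phi> \<longleftrightarrow> Q True"
    using p(2)[of "\<lambda>_. \<delta>" True "\<lambda>_. \<delta>"] mb.d_in by (auto simp: e_def)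
  moreover have "sat E Nb (mrg (\<lambda>_. j \<delta>) (\<lambda>k. p k False) (\<lambda>_. j \<delta>)) \<phi> \<longleftrightarrow> Q False"
    using p(2)[of "\<lambda>_. j \<delta>" False "\<lambda>_. j \<delta>"] j_in[OF mb.d_in] by auto
  ultimately show ?thesis by simp
qed

lemma j_mem: "x \<in> Mb \<Longrightarrow> y \<in> Mb \<Longrightarrow> E (j x) (j y) \<longleftrightarrow> E x y"
  using elem[of 60 "\<lambda>b. E (cj x b) (cj y b)"] by (simp add: el.dj_mem trm_const cj_in)

lemma j_maps: "f \<in> Mb \<Longrightarrow> x \<in> Mb \<Longrightarrow> y \<in> Mb \<Longrightarrow> maps_to E (j f) (j x) (j y) \<longleftrightarrow> maps_to E f x y"
  using elem[of 60 "\<lambda>b. maps_to E (cj f b) (cj x b) (cj y b)"] by (simp add: el.dj_maps trm_const cj_in)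

lemma j_ordinal: "x \<in> Mb \<Longrightarrow> is_ordinal E (j x) \<longleftrightarrow> is_ordinal E x"
  using elem[of 60 "\<lambda>b. is_ordinal E (cj x b)"] by (simp add: el.dj_ordinal trm_const cj_in)

lemma j_bijection:
  "k \<in> Mb \<Longrightarrow> x \<in> Mb \<Longrightarrow> y \<in> Mb \<Longrightarrow> is_bijection E (j k) (j x) (j y) \<longleftrightarrow> is_bijection E k x y"
  using elem[of 60 "\<lambda>b. is_bijection E (cj k b) (cj x b) (cj y b)"] by (simp add: el.dj_bijection trm_const cj_in)

lemma j_sub:
  assumes "x \<in> Mb" "y \<in> Mb" "\<And>z. E z x \<Longrightarrow> E z y" "E z (j x)"
  shows "E z (j y)"
proof -
  have "dj E MN CJ 60 (\<lambda>b e. \<forall>z. E z (cj x b) \<longrightarrow> E z (cj y b))"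
    by (intro el.dj_rules | simp add: assms cj_in)+
  from elem[OF this] show ?thesis using assms by simp
qed

lemma Nb_opair: "x \<in> Nb \<Longrightarrow> y \<in> Nb \<Longrightarrow> \<exists>p\<in>Nb. is_opair E p x y"
proof -
  have "dj E MN CJ 60 (\<lambda>b e. \<forall>x\<in>MN b. \<forall>y\<in>MN b. \<exists>p\<in>MN b. is_opair E p x y)"
    by (intro el.dj_rules | simp)+
  from elem[OF this] show "x \<in> Nb \<Longrightarrow> y \<in> Nb \<Longrightarrow> ?thesis" using mb.ex_opair by simp
qed

lemma Nb_opair_in: "x \<in> Nb \<Longrightarrow> y \<in> Nb \<Longrightarrow> is_opair E p x y \<Longrightarrow> p \<in> Nb"
  using Nb_opair is_opair_fun by blast

lemma Nb_empty: "\<exists>z\<in>Nb. \<forall>x. \<not> E x z"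
proof -
  have "dj E MN CJ 60 (\<lambda>b e. \<exists>z\<in>MN b. \<forall>x\<in>MN b. \<not> E x z)"
    by (intro el.dj_rules | simp)+
  from elem[OF this] have "\<exists>z\<in>Nb. \<forall>x\<in>Nb. \<not> E x z" using mb.ex_empty by auto
  then show ?thesis using Nb_trans by blast
qed

lemma Nb_ran:
  assumes f: "f \<in> Nb"
  shows "\<exists>r\<in>Nb. \<forall>y. E y r \<longleftrightarrow> (\<exists>x. maps_to E f x y)"
proof -
  have D: "dj E MN CJ 60 (\<lambda>b e. \<forall>f\<in>MN b. \<exists>r\<in>MN b. \<forall>y\<in>MN b. E y r \<longleftrightarrow> (\<exists>x\<in>MN b. maps_to E f x y))"
    by (intro el.dj_rules | simp)+
  have "\<forall>f\<in>Mb. \<exists>r\<in>Mb. \<forall>y\<in>Mb. E y r \<longleftrightarrow> (\<exists>x\<in>Mb. maps_to E f x y)"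
  proof
    fix f assume f: "f \<in> Mb"
    then obtain r where "r \<in> Mb" "\<And>y. E y r \<longleftrightarrow> (\<exists>x. maps_to E f x y)" using mb.ex_ran by blast
    then show "\<exists>r\<in>Mb. \<forall>y\<in>Mb. E y r \<longleftrightarrow> (\<exists>x\<in>Mb. maps_to E f x y)"
      using mb.maps_to_in[OF _ f] by blast
  qed
  from elem[OF D, unfolded MN_simps, THEN iffD1, OF this]
  obtain r where r: "r \<in> Nb" "\<And>y. y \<in> Nb \<Longrightarrow> E y r \<longleftrightarrow> (\<exists>x\<in>Nb. maps_to E f x y)"
    using f by blast
  have in_Nb: "x \<in> Nb \<and> y \<in> Nb" if "maps_to E f x y" for x y
  proof -
    obtain p where "E p f" "is_opair E p x y" using \<open>maps_to E f x y\<close> unfolding maps_to_def by blast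
    then obtain u v where "p \<in> Nb" "E u p" "E v p" "E x v" "E y v"
      using Nb_trans[OF f] unfolding is_opair_iff is_upair_iff by blast
    then show ?thesis using Nb_trans by blast
  qed
  have "E y r \<longleftrightarrow> (\<exists>x. maps_to E f x y)" for y
    using r in_Nb Nb_trans[OF r(1)] by blast
  then show ?thesis using r(1) by blast
qed

text \<open>Closure of \<open>Nb\<close> concerns functions defined on all of \<delta>. The
  injection of \<open>U\<close> into \<delta> is therefore inverted, with \<open>u0\<close> as
  default off its range, and \<open>U\<close> is recovered as the range of the resulting function;
  only the empty set has no such default.\<close>

lemma Nb_small_in:
  assumes U: "U \<in> Vb" "\<And>u. E u U \<Longrightarrow> u \<in> Nb" and i: "i \<in> Vb" "inj_into i U \<delta>"
  shows "U \<in> Nb"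
proof (cases "\<exists>u. E u U")
  case False
  then show ?thesis using Nb_empty E_ext[of U] by metis
next
  case True
  then obtain u0 where u0: "E u0 U" by blast
  note iD = inj_intoD[OF i(2)]
  define Q where "Q \<xi> u \<longleftrightarrow> maps_to E i u \<xi> \<or> \<not> (\<exists>u'. E u' U \<and> maps_to E i u' \<xi>) \<and> u = u0" for \<xi> u
  have "vb.def2 40 Q"
    unfolding Q_def
    by (rule vb.def2I) (intro vb.dj_rules vb.trm_shift | simp add: U i vb.W_trans[OF U(1) u0])+
  from vb.ex_rel[OF this vb.d_in U(1)] obtain f where f: "f \<in> Vb"
    "\<And>p. E p f \<Longrightarrow> \<exists>x y. E x \<delta> \<and> E y U \<and> is_opair E p x y"
    "\<And>x y. maps_to E f x y \<longleftrightarrow> E x \<delta> \<and> E y U \<and> Q x y" by blast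
  have "is_function E f \<delta> Nb"
  proof (rule is_functionI)
    show "\<exists>x y. E x \<delta> \<and> y \<in> Nb \<and> is_opair E p x y" if "E p f" for p
      using f(2)[OF that] U(2) by blast
    show "\<exists>y. maps_to E f x y" if "E x \<delta>" for x
      unfolding f(3) Q_def using that u0 by blast
    show "y = y'" if "maps_to E f x y" "maps_to E f x y'" for x y y'
      using that iD(1,3) unfolding f(3) Q_def by blast
  qed
  then have "f \<in> Nb" using Nb_closed f(1) unfolding closed_under_sequences_def by blast
  then obtain r where r: "r \<in> Nb" "\<And>y. E y r \<longleftrightarrow> (\<exists>x. maps_to E f x y)" using Nb_ran by blast
  have "r = U"
  proof (rule E_ext)
    fix z show "E z r \<longleftrightarrow> E z U"
      unfolding r(2) f(3) Q_def using iD(4)[of z] by blast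
  qed
  then show ?thesis using r(1) by simp
qed

section \<open>Sets fixed by the embedding\<close>

lemma j_less: "E \<xi> \<delta> \<Longrightarrow> j \<xi> = \<xi>" and j_delta: "j \<delta> = \<delta>"
  using crit d_less ordinal_trans[of \<kappa> \<delta>] unfolding is_critical_point_def by blast+

lemma j_fix_subset:
  assumes "x \<in> Mb" "y \<in> Mb" "\<And>u. E u x \<Longrightarrow> E u y" "\<And>u. E u y \<Longrightarrow> j u = u" "j y = y"
  shows "j x = x"
proof (rule E_ext)
  fix u
  show "E u (j x) \<longleftrightarrow> E u x"
  proof
    assume u: "E u (j x)"
    then have "E u y" using j_sub[OF assms(1-3)] assms(5) by simp
    then show "E u x" using u assms(4) j_mem[OF _ assms(1), of u] mb.W_trans[OF assms(2)] by metis
  next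
    assume u: "E u x"
    then show "E u (j x)" using j_mem[OF _ assms(1), of u] assms(3,4) mb.W_trans[OF assms(1)] by metis
  qed
qed

lemma sub_delta_in: "A \<in> Vb \<Longrightarrow> (\<And>x. E x A \<Longrightarrow> E x \<delta>) \<Longrightarrow> A \<in> Mb"
  using power_d by (auto simp: ext_def)

lemma sub_delta_fix: "A \<in> Vb \<Longrightarrow> (\<And>x. E x A \<Longrightarrow> E x \<delta>) \<Longrightarrow> j A = A"
  using j_fix_subset[of A \<delta>] sub_delta_in mb.d_in j_less j_delta by blast

text \<open>Through \<open>q\<close> the set \<open>S\<close> becomes a subset of \<delta>, which
  belongs to \<open>Mb\<close> by hypothesis, and it is decoded inside \<open>Mb\<close>. The power
  set hypothesis thus extends to every set that injects into \<delta> in \<open>Mb\<close>.\<close>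

lemma transfer_subset:
  assumes Z: "Z \<in> Mb" and q: "q \<in> Mb" "inj_into q Z \<delta>" and S: "S \<in> Vb" "\<And>x. E x S \<Longrightarrow> E x Z"
  shows "S \<in> Mb"
proof -
  note qD = inj_intoD[OF q(2)]
  have qVb: "q \<in> Vb" using q Mb_sub by blast
  have "\<exists>A\<in>Vb. \<forall>\<zeta>. E \<zeta> A \<longleftrightarrow> E \<zeta> \<delta> \<and> (\<exists>x. E x S \<and> maps_to E q x \<zeta>)"
    by (rule vb.sep[OF _ vb.d_in]) (intro vb.dj_rules | simp add: S qVb)+
  then obtain A where A: "A \<in> Vb" "\<And>\<zeta>. E \<zeta> A \<longleftrightarrow> E \<zeta> \<delta> \<and> (\<exists>x. E x S \<and> maps_to E q x \<zeta>)" by blast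
  have AM: "A \<in> Mb" by (rule sub_delta_in[OF A(1)]) (simp add: A(2))
  have "\<exists>B\<in>Mb. \<forall>x. E x B \<longleftrightarrow> E x Z \<and> (\<exists>\<zeta>. E \<zeta> A \<and> maps_to E q x \<zeta>)"
    by (rule mb.sep[OF _ Z]) (intro mb.dj_rules | simp add: AM q)+
  then obtain B where B: "B \<in> Mb" "\<And>x. E x B \<longleftrightarrow> E x Z \<and> (\<exists>\<zeta>. E \<zeta> A \<and> maps_to E q x \<zeta>)" by blast
  have "B = S"
  proof (rule E_ext)
    fix x show "E x B \<longleftrightarrow> E x S"
    proof
      assume "E x B"
      then obtain \<zeta> x' where "maps_to E q x \<zeta>" "E x' S" "maps_to E q x' \<zeta>" unfolding B(2) A(2) by blast
      then show "E x S" using qD(3)[of x \<zeta> x'] by simp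
    next
      assume x: "E x S"
      then obtain \<zeta> where "maps_to E q x \<zeta>" "E \<zeta> \<delta>" using qD(4)[OF S(2)[OF x]] by blast
      then show "E x B" unfolding B(2) A(2) using x S(2) by blast
    qed
  qed
  then show ?thesis using B(1) by simp
qed

text \<open>Membership on \<beta>, copied to \<delta> along \<open>i\<close>, is a relation that
  lies in \<open>Mb\<close> by \<open>d_pairing\<close> and \<open>transfer_subset\<close>. Its
  Mostowski collapse in \<open>Mb\<close> returns \<beta> with an enumeration \<open>G\<close> along
  a set \<open>D\<close> of indices below \<delta>. Since \<open>j\<close> fixes \<open>D\<close>
  and each index, every member of \<open>j \<beta>\<close> is \<open>j x\<close> for some
  \<open>x\<close> in \<beta>, so \<open>j\<close> cannot move anything up to \<beta>.\<close>

lemma short_ordinal: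
  assumes \<beta>: "\<beta> \<in> Vb" "is_ordinal E \<beta>" and i: "i \<in> Vb" "inj_into i \<beta> \<delta>"
  shows "\<beta> \<in> Mb" "\<And>x. E x \<beta> \<Longrightarrow> j x = x" "j \<beta> = \<beta>"
    "\<And>A. A \<in> Vb \<Longrightarrow> (\<And>x. E x A \<Longrightarrow> E x \<beta>) \<Longrightarrow> A \<in> Mb \<and> j A = A"
proof -
  note iD = inj_intoD[OF i(2)]
  obtain Y where Y: "Y \<in> Mb" "\<And>p. E p Y \<longleftrightarrow> (\<exists>a. E a \<delta> \<and> (\<exists>b. E b \<delta> \<and> is_opair E p a b))"
    using mb.ex_prod[OF mb.d_in mb.d_in] by blast
  obtain q where q: "q \<in> Mb" "inj_into q Y \<delta>" using mb.d_pairing[OF Y] by blast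
  define r where "r z x \<longleftrightarrow> (\<exists>a. E a \<beta> \<and> (\<exists>b. E b \<beta> \<and> (E a b \<and> maps_to E i a z \<and> maps_to E i b x)))" for z x
  have "vb.def2 40 r"
    unfolding r_def by (rule vb.def2I) (intro vb.dj_rules vb.trm_shift | simp add: \<beta> i)+
  from vb.ex_rel[OF this vb.d_in vb.d_in] obtain S where S: "S \<in> Vb"
    "\<And>p. E p S \<Longrightarrow> \<exists>x y. E x \<delta> \<and> E y \<delta> \<and> is_opair E p x y"
    "\<And>x y. maps_to E S x y \<longleftrightarrow> E x \<delta> \<and> E y \<delta> \<and> r x y" by blast
  have SM: "S \<in> Mb"
    by (rule transfer_subset[OF Y(1) q S(1)]) (use S(2) Y(2) in blast)
  have "\<exists>D\<in>Vb. \<forall>\<zeta>. E \<zeta> D \<longleftrightarrow> E \<zeta> \<delta> \<and> (\<exists>x. E x \<beta> \<and> maps_to E i x \<zeta>)"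
    by (rule vb.sep[OF _ vb.d_in]) (intro vb.dj_rules | simp add: \<beta> i)+
  then obtain D where D: "D \<in> Vb" "\<And>\<zeta>. E \<zeta> D \<longleftrightarrow> E \<zeta> \<delta> \<and> (\<exists>x. E x \<beta> \<and> maps_to E i x \<zeta>)" by blast
  have DM: "D \<in> Mb" and jD: "j D = D"
    using sub_delta_in[OF D(1)] sub_delta_fix[OF D(1)] D(2) by blast+
  define inv where "inv \<zeta> = (THE x. maps_to E i x \<zeta>)" for \<zeta>
  have inv: "inv \<zeta> = x" if "maps_to E i x \<zeta>" for x \<zeta>
    unfolding inv_def using that iD(3) by blast
  have wf: "wfp (\<lambda>x y. E x D \<and> E y D \<and> maps_to E S x y)"
  proof -
    have "wf (inv_image {(x, y). E x y} inv)" using E_wf by (intro wf_inv_image) (simp add: wfp_def)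
    then show ?thesis
      unfolding wfp_def by (rule wf_subset) (auto simp: S(3) r_def inv)
  qed
  have r2: "mb.def2 20 (maps_to E S)"
    by (rule mb.def2I) (intro mb.dj_rules | simp add: SM)+
  have H2: "mb.def2 20 (=)" by (rule mb.def2I) (intro mb.dj_rules)
  have "\<exists>h\<in>Mb. \<forall>v\<in>Mb. E v h \<longleftrightarrow> v = q" if "q \<in> Mb" for q
    using mb.ex_singleton[OF that] by blast
  from mb.recursion[OF DM wf r2 H2 this] obtain g G where G: "G \<in> Mb"
    "\<And>x y. maps_to E G x y \<longleftrightarrow> E x D \<and> y = g x"
    and g: "\<And>x. E x D \<Longrightarrow> g x \<in> Mb"
    and gmem: "\<And>x v. E x D \<Longrightarrow> v \<in> Mb \<Longrightarrow> E v (g x) \<longleftrightarrow> (\<exists>z. E z D \<and> maps_to E S z x \<and> v = g z)"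
    by (smt (verit))
  have g_inv: "maps_to E i x \<zeta> \<Longrightarrow> g \<zeta> = x" for x \<zeta>
  proof (induction x arbitrary: \<zeta> rule: E_induct)
    case (mem x)
    have x: "E x \<beta>" "E \<zeta> \<delta>" using iD(1)[OF mem.prems] by blast+
    then have \<zeta>: "E \<zeta> D" using D(2) mem.prems by blast
    show ?case
    proof (rule E_ext)
      fix v
      show "E v (g \<zeta>) \<longleftrightarrow> E v x"
      proof
        assume v: "E v (g \<zeta>)"
        then obtain z where z: "E z D" "maps_to E S z \<zeta>" "v = g z"
          using gmem[OF \<zeta>] mb.W_trans[OF g[OF \<zeta>] v] by blast
        then obtain a b where ab: "E a b" "maps_to E i a z" "maps_to E i b \<zeta>" unfolding S(3) r_def by blast
        then have "b = x" using iD(3) mem.prems by blast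
        then show "E v x" using mem.IH[of a z] ab z(3) by simp
      next
        assume v: "E v x"
        then have v\<beta>: "E v \<beta>" using ordinal_trans[OF \<beta>(2)] x by blast
        then obtain z where z: "maps_to E i v z" "E z \<delta>" using iD(4) by blast
        then have "E z D" using D(2) v\<beta> by blast
        moreover have "maps_to E S z \<zeta>" unfolding S(3) r_def using z x v v\<beta> mem.prems by blast
        moreover have "g z = v" using mem.IH[OF v z(1)] .
        ultimately show "E v (g \<zeta>)" using gmem[OF \<zeta>, of v] g by blast
      qed
    qed
  qed
  have Gmap: "maps_to E G \<zeta> x \<longleftrightarrow> maps_to E i x \<zeta>" for \<zeta> x
  proof
    assume "maps_to E G \<zeta> x"
    then have "E \<zeta> D" "x = g \<zeta>" using G(2) by blast+
    then show "maps_to E i x \<zeta>" using D(2) g_inv by blast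
  next
    assume "maps_to E i x \<zeta>"
    then show "maps_to E G \<zeta> x" using G(2) D(2) g_inv iD(1) by blast
  qed
  obtain R where R: "R \<in> Mb" "\<And>y. E y R \<longleftrightarrow> (\<exists>x. maps_to E G x y)" using mb.ex_ran[OF G(1)] by blast
  have "R = \<beta>"
  proof (rule E_ext)
    show "E x R \<longleftrightarrow> E x \<beta>" for x
      unfolding R(2) Gmap using iD(1,4) by blast
  qed
  then show bM: "\<beta> \<in> Mb" using R(1) by simp
  \<comment> \<open>Three bounded statements about \<open>G\<close>, \<open>D\<close> and \<beta>
    are transferred in turn: values are closed downwards, every member of \<beta> is a value, and
    \<open>G\<close> is single-valued. With \<open>j D = D\<close> they determine
    \<open>j \<beta>\<close> from the values \<open>j x\<close>.\<close>
  have T: "dj E MN CJ 60 (\<lambda>b e. \<forall>\<zeta>. E \<zeta> (cj D b) \<longrightarrow> (\<forall>y. E y (cj \<beta> b) \<longrightarrow> maps_to E (cj G b) \<zeta> y \<longrightarrow>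
      (\<forall>v. E v y \<longrightarrow> E v (cj \<beta> b) \<and> (\<exists>\<eta>. E \<eta> (cj D b) \<and> maps_to E (cj G b) \<eta> v))))"
    by (intro el.dj_rules | simp add: cj_in DM G bM)+
  have "\<forall>\<zeta>. E \<zeta> D \<longrightarrow> (\<forall>y. E y \<beta> \<longrightarrow> maps_to E G \<zeta> y \<longrightarrow>
      (\<forall>v. E v y \<longrightarrow> E v \<beta> \<and> (\<exists>\<eta>. E \<eta> D \<and> maps_to E G \<eta> v)))"
  proof (intro allI impI)
    fix \<zeta> y v assume "E \<zeta> D" "E y \<beta>" "maps_to E G \<zeta> y" "E v y"
    then have "E v \<beta>" using ordinal_trans[OF \<beta>(2)] by blast
    moreover then obtain z where "maps_to E i v z" "E z \<delta>" using iD(4) by blast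
    ultimately show "E v \<beta> \<and> (\<exists>\<eta>. E \<eta> D \<and> maps_to E G \<eta> v)"
      using D(2) Gmap by blast
  qed
  from elem[OF T, unfolded cj_simps, THEN iffD1, OF this]
  have down: "E v (j \<beta>) \<and> (\<exists>\<eta>. E \<eta> D \<and> maps_to E (j G) \<eta> v)"
    if "E \<zeta> D" "E y (j \<beta>)" "maps_to E (j G) \<zeta> y" "E v y" for \<zeta> y v
    using that unfolding jD by blast
  have T: "dj E MN CJ 60 (\<lambda>b e. \<forall>v. E v (cj \<beta> b) \<longrightarrow> (\<exists>\<eta>. E \<eta> (cj D b) \<and> maps_to E (cj G b) \<eta> v))"
    by (intro el.dj_rules | simp add: cj_in DM G bM)+
  have "\<forall>v. E v \<beta> \<longrightarrow> (\<exists>\<eta>. E \<eta> D \<and> maps_to E G \<eta> v)"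
    using iD(4) D(2) Gmap by blast
  from elem[OF T, unfolded cj_simps, THEN iffD1, OF this]
  have onto: "\<exists>\<eta>. E \<eta> D \<and> maps_to E (j G) \<eta> v" if "E v (j \<beta>)" for v
    using that unfolding jD by blast
  have T: "dj E MN CJ 60 (\<lambda>b e. \<forall>\<zeta>. E \<zeta> (cj D b) \<longrightarrow> (\<forall>y. E y (cj \<beta> b) \<longrightarrow> (\<forall>y'. E y' (cj \<beta> b) \<longrightarrow>
      maps_to E (cj G b) \<zeta> y \<longrightarrow> maps_to E (cj G b) \<zeta> y' \<longrightarrow> y = y')))"
    by (intro el.dj_rules | simp add: cj_in DM G bM)+
  have "\<forall>\<zeta>. E \<zeta> D \<longrightarrow> (\<forall>y. E y \<beta> \<longrightarrow> (\<forall>y'. E y' \<beta> \<longrightarrow>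
      maps_to E G \<zeta> y \<longrightarrow> maps_to E G \<zeta> y' \<longrightarrow> y = y'))"
    by (simp add: G(2))
  from elem[OF T, unfolded cj_simps, THEN iffD1, OF this]
  have func: "y = y'"
    if "E \<zeta> D" "E y (j \<beta>)" "E y' (j \<beta>)" "maps_to E (j G) \<zeta> y" "maps_to E (j G) \<zeta> y'" for \<zeta> y y'
    using that unfolding jD by blast
  have jG: "maps_to E (j G) \<zeta> (j x)" if "maps_to E i x \<zeta>" for \<zeta> x
  proof -
    have x: "E x \<beta>" "E \<zeta> \<delta>" using iD(1) that by blast+
    then have "x \<in> Mb" "\<zeta> \<in> Mb" using mb.W_trans[OF bM] mb.d_mem_in by blast+
    then show ?thesis using j_maps[OF G(1), of \<zeta> x] Gmap that j_less[OF x(2)] by simp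
  qed
  have jb: "E (j x) (j \<beta>)" if "E x \<beta>" for x
    using j_mem[OF _ bM] mb.W_trans[OF bM] that by blast
  have val: "\<exists>x. E x \<beta> \<and> v = j x" if v: "E v (j \<beta>)" for v
  proof -
    obtain \<eta> where \<eta>: "E \<eta> D" "maps_to E (j G) \<eta> v" using onto[OF v] by blast
    then obtain x where x: "E x \<beta>" "maps_to E i x \<eta>" using D(2) by blast
    then show ?thesis using func[OF \<eta>(1) v jb[OF x(1)] \<eta>(2) jG[OF x(2)]] by blast
  qed
  show fix_mem: "E x \<beta> \<Longrightarrow> j x = x" for x
  proof (induction x rule: E_induct)
    case (mem x)
    show ?case
    proof (rule E_ext)
      fix v
      have xM: "x \<in> Mb" using mem.prems mb.W_trans[OF bM] by blast
      show "E v (j x) \<longleftrightarrow> E v x"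
      proof
        assume v: "E v (j x)"
        obtain \<zeta> where \<zeta>: "maps_to E i x \<zeta>" "E \<zeta> \<delta>" using iD(4)[OF mem.prems] by blast
        then have "E \<zeta> D" using D(2) mem.prems by blast
        then have "E v (j \<beta>)" using down[OF _ jb[OF mem.prems] jG[OF \<zeta>(1)] v] by blast
        then obtain y where y: "E y \<beta>" "v = j y" using val by blast
        then have "E y x" using v j_mem[OF _ xM] mb.W_trans[OF bM] by blast
        then show "E v x" using mem.IH y by simp
      next
        assume v: "E v x"
        then have "E v \<beta>" using ordinal_trans[OF \<beta>(2)] mem.prems by blast
        then have "E (j v) (j x)" using v j_mem[OF _ xM] mb.W_trans[OF bM] by blast
        then show "E v (j x)" using mem.IH[OF v \<open>E v \<beta>\<close>] by simp
      qed
    qed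
  qed
  show jbeta: "j \<beta> = \<beta>"
  proof (rule E_ext)
    show "E v (j \<beta>) \<longleftrightarrow> E v \<beta>" for v
      using val[of v] fix_mem jb[of v] by auto
  qed
  fix A assume A: "A \<in> Vb" "\<And>x. E x A \<Longrightarrow> E x \<beta>"
  \<comment> \<open>The injection of \<beta> into \<delta> is known only in \<open>Vb\<close>. It is
    rebuilt in \<open>Mb\<close> by inverting \<open>G\<close>, as \<open>transfer_subset\<close>
    needs it there.\<close>
  have "mb.def2 40 (\<lambda>x \<zeta>. maps_to E G \<zeta> x)"
    by (rule mb.def2I) (intro mb.dj_rules | simp add: G)+
  from mb.ex_rel[OF this bM mb.d_in] obtain i' where i': "i' \<in> Mb"
    "\<And>p. E p i' \<Longrightarrow> \<exists>x y. E x \<beta> \<and> E y \<delta> \<and> is_opair E p x y"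
    "\<And>x \<zeta>. maps_to E i' x \<zeta> \<longleftrightarrow> E x \<beta> \<and> E \<zeta> \<delta> \<and> maps_to E G \<zeta> x" by blast
  have i'_iff: "maps_to E i' x \<zeta> \<longleftrightarrow> maps_to E i x \<zeta>" for x \<zeta>
    unfolding i'(3) Gmap using iD(1) by blast
  have "is_function E i' \<beta> (ext E \<delta>)"
  proof (rule is_functionI)
    show "\<exists>x y. E x \<beta> \<and> y \<in> ext E \<delta> \<and> is_opair E p x y" if "E p i'" for p
      using i'(2)[OF that] by (simp add: ext_def)
  qed (use iD(2,4) in \<open>unfold i'_iff, blast\<close>)+
  then have "inj_into i' \<beta> \<delta>" unfolding inj_into_def i'_iff using iD(3) by blast
  then have AM: "A \<in> Mb" using transfer_subset[OF bM i'(1) _ A] by blast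
  then show "A \<in> Mb \<and> j A = A" using j_fix_subset[OF AM bM A(2) fix_mem jbeta] by blast
qed

end

section \<open>Enumerating sets of pairs of ordinals\<close>

context univ
begin

definition lexo :: "'a \<Rightarrow> 'a \<Rightarrow> 'a \<Rightarrow> bool" where
  "lexo \<theta> p q \<longleftrightarrow> (\<exists>a. E a \<theta> \<and> (\<exists>b. E b \<theta> \<and> (\<exists>c. E c \<theta> \<and> (\<exists>d. E d \<theta> \<and>
     (is_opair E p a b \<and> is_opair E q c d \<and> (E a c \<or> a = c \<and> E b d))))))"

text \<open>The Mostowski collapse of \<open>B\<close> under \<open>lexo\<close>, that is, the
  inverse of its increasing enumeration. It is described with bounded quantifiers only, so that all
  models recognise the same \<rho> and the description can be carried along \<open>j\<close>. The
  ordinal \<beta> is only required to contain the values.\<close>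

definition is_collapse :: "'a \<Rightarrow> 'a \<Rightarrow> 'a \<Rightarrow> 'a \<Rightarrow> bool" where
  "is_collapse \<theta> B \<rho> \<beta> \<longleftrightarrow>
     (\<forall>p. E p \<rho> \<longrightarrow> (\<exists>b. E b B \<and> (\<exists>y. E y \<beta> \<and> is_opair E p b y))) \<and>
     (\<forall>b. E b B \<longrightarrow> (\<exists>y. E y \<beta> \<and> maps_to E \<rho> b y)) \<and>
     (\<forall>b. E b B \<longrightarrow> (\<forall>y. E y \<beta> \<longrightarrow> maps_to E \<rho> b y \<longrightarrow>
        (\<forall>v. E v y \<longrightarrow> (\<exists>b'. E b' B \<and> (lexo \<theta> b' b \<and> maps_to E \<rho> b' v))) \<and>
        (\<forall>b'. E b' B \<longrightarrow> lexo \<theta> b' b \<longrightarrow> (\<forall>v. E v \<beta> \<longrightarrow> maps_to E \<rho> b' v \<longrightarrow> E v y))))"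

definition is_image :: "'a \<Rightarrow> 'a \<Rightarrow> 'a \<Rightarrow> 'a \<Rightarrow> bool" where
  "is_image \<rho> \<beta> A A0 \<longleftrightarrow> (\<forall>y. E y A0 \<longrightarrow> E y \<beta> \<and> (\<exists>b. E b A \<and> maps_to E \<rho> b y)) \<and>
     (\<forall>b. E b A \<longrightarrow> (\<forall>y. E y \<beta> \<longrightarrow> maps_to E \<rho> b y \<longrightarrow> E y A0))"

lemma is_imageD:
  assumes "is_image \<rho> \<beta> A A0"
  shows "E y A0 \<longleftrightarrow> E y \<beta> \<and> (\<exists>b. E b A \<and> maps_to E \<rho> b y)"
  using assms unfolding is_image_def by blast

lemma lexo_iff: "is_opair E p a b \<Longrightarrow> is_opair E q c d \<Longrightarrow> E a \<theta> \<Longrightarrow> E b \<theta> \<Longrightarrow> E c \<theta> \<Longrightarrow> E d \<theta> \<Longrightarrow>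
    lexo \<theta> p q \<longleftrightarrow> E a c \<or> a = c \<and> E b d"
  unfolding lexo_def using is_opair_inj by blast

lemma wf_lexo: "wfp (\<lambda>p q. E p B \<and> E q B \<and> lexo \<theta> p q)"
proof -
  define f where "f p = (THE a. \<exists>b. is_opair E p a b)" for p
  define s where "s p = (THE b. \<exists>a. is_opair E p a b)" for p
  have fs: "f p = a \<and> s p = b" if "is_opair E p a b" for p a b
    using that is_opair_inj unfolding f_def s_def by blast
  have "wf {(x, y). E x y}" using E_wf by (simp add: wfp_def)
  then have "wf (inv_image ({(x, y). E x y} <*lex*> {(x, y). E x y}) (\<lambda>u. (f u, s u)))"
    by (intro wf_inv_image wf_lex_prod)
  then show ?thesis
    unfolding wfp_def
  proof (rule wf_subset, intro subsetI)
    fix z assume "z \<in> {(p, q). E p B \<and> E q B \<and> lexo \<theta> p q}"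
    then obtain p q a b c d where z: "z = (p, q)" "is_opair E p a b" "is_opair E q c d"
      "E a c \<or> a = c \<and> E b d" unfolding lexo_def by blast
    then show "z \<in> inv_image ({(x, y). E x y} <*lex*> {(x, y). E x y}) (\<lambda>u. (f u, s u))"
      using fs[OF z(2)] fs[OF z(3)] by auto
  qed
qed

lemma lexo_trans:
  assumes \<theta>: "is_ordinal E \<theta>" and "lexo \<theta> p q" "lexo \<theta> q r"
  shows "lexo \<theta> p r"
proof -
  obtain a b c d where 1: "E a \<theta>" "E b \<theta>" "E c \<theta>" "E d \<theta>" "is_opair E p a b" "is_opair E q c d"
    "E a c \<or> a = c \<and> E b d" using assms(2) unfolding lexo_def by blast
  obtain c' d' e f where 2: "E e \<theta>" "E f \<theta>" "is_opair E q c' d'" "is_opair E r e f"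
    "E c' e \<or> c' = e \<and> E d' f" using assms(3) unfolding lexo_def by blast
  have "c' = c" "d' = d" using 1 2 is_opair_inj by blast+
  then have "E a e \<or> a = e \<and> E b f"
    using 1 2 ordinal_trans[OF ordinal_mem[OF \<theta> 2(1)]] ordinal_trans[OF ordinal_mem[OF \<theta> 2(2)]] by blast
  then show ?thesis using lexo_iff 1 2 by blast
qed

lemma lexo_total:
  assumes \<theta>: "is_ordinal E \<theta>"
    and "\<exists>a. E a \<theta> \<and> (\<exists>b. E b \<theta> \<and> is_opair E p a b)" "\<exists>a. E a \<theta> \<and> (\<exists>b. E b \<theta> \<and> is_opair E q a b)"
  shows "lexo \<theta> p q \<or> p = q \<or> lexo \<theta> q p"
proof -
  obtain a b c d where 1: "E a \<theta>" "E b \<theta>" "E c \<theta>" "E d \<theta>" "is_opair E p a b" "is_opair E q c d"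
    using assms(2,3) by blast
  have "E a c \<or> a = c \<or> E c a" "E b d \<or> b = d \<or> E d b" using ordinal_linear[OF \<theta>] 1 by blast+
  then show ?thesis
    using lexo_iff[OF 1(5,6,1-4)] lexo_iff[OF 1(6,5,3,4,1,2)] is_opair_fun 1(5,6) by blast
qed

end

context dj_family
begin

lemma dj_lexo:
  assumes "trm C t1" "trm C t2" "trm C t3"
  shows "dj E Wf C n (\<lambda>i e. lexo (t1 i e) (t2 i e) (t3 i e))"
  unfolding lexo_def using assms by (intro dj_rules trm_shift)

lemma dj_collapse:
  assumes "trm C t1" "trm C t2" "trm C t3" "trm C t4"
  shows "dj E Wf C n (\<lambda>i e. is_collapse (t1 i e) (t2 i e) (t3 i e) (t4 i e))"
  unfolding is_collapse_def using assms by (intro dj_rules dj_lexo trm_shift)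

lemma dj_image:
  assumes "trm C t1" "trm C t2" "trm C t3" "trm C t4"
  shows "dj E Wf C n (\<lambda>i e. is_image (t1 i e) (t2 i e) (t3 i e) (t4 i e))"
  unfolding is_image_def using assms by (intro dj_rules trm_shift)

end

context mst
begin

lemma lexo_recursion:
  assumes \<theta>: "\<theta> \<in> W" and B: "B \<in> W"
  obtains g G where "G \<in> W" "is_rel G" "\<And>x y. maps_to E G x y \<longleftrightarrow> E x B \<and> y = g x"
    "\<And>x. E x B \<Longrightarrow> g x \<in> W"
    "\<And>x v. E x B \<Longrightarrow> E v (g x) \<longleftrightarrow> (\<exists>z. E z B \<and> lexo \<theta> z x \<and> v = g z)"
proof -
  have r: "def2 20 (lexo \<theta>)" by (rule def2I) (intro dj_lexo dj_rules | simp add: \<theta>)+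
  have H: "def2 20 (=)" by (rule def2I) (intro dj_rules)
  have S: "\<exists>h\<in>W. \<forall>v\<in>W. E v h \<longleftrightarrow> v = q" if "q \<in> W" for q
    using ex_singleton[OF that] by blast
  obtain g G where 1: "G \<in> W" "is_rel G" "\<And>x y. maps_to E G x y \<longleftrightarrow> E x B \<and> y = g x"
    and g: "\<And>x. E x B \<Longrightarrow> g x \<in> W"
    and gm: "\<And>x v. E x B \<Longrightarrow> v \<in> W \<Longrightarrow> E v (g x) \<longleftrightarrow> (\<exists>z. E z B \<and> lexo \<theta> z x \<and> v = g z)"
    using recursion[OF B wf_lexo r H S] by (smt (verit))
  have "E v (g x) \<longleftrightarrow> (\<exists>z. E z B \<and> lexo \<theta> z x \<and> v = g z)" if x: "E x B" for v x
    using gm[OF x, of v] g W_trans x by metis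
  with that[OF 1] g show ?thesis by blast
qed

text \<open>By induction along \<open>lexo\<close> the bounded description leaves no choice for the
  values of \<rho>. Hence \<rho> lies in every model that contains \<theta> and \<open>B\<close>,
  which is \<open>collapse_in\<close>.\<close>

lemma collapse_unique:
  assumes col: "is_collapse \<theta> B \<rho> \<beta>"
    and g: "\<And>x v. E x B \<Longrightarrow> E v (g x) \<longleftrightarrow> (\<exists>z. E z B \<and> lexo \<theta> z x \<and> v = g z)"
  shows "maps_to E \<rho> b y \<longleftrightarrow> E b B \<and> y = g b"
proof -
  have dom: "E b B \<and> E y \<beta>" if m1: "maps_to E \<rho> b y" for b y
  proof -
    obtain p where p: "E p \<rho>" "is_opair E p b y" using m1 unfolding maps_to_def by blast
    then obtain b' y' where "E b' B" "E y' \<beta>" "is_opair E p b' y'" using col unfolding is_collapse_def by blast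
    then show ?thesis using p is_opair_inj by blast
  qed
  have ex: "\<exists>y. maps_to E \<rho> b y" if "E b B" for b
    using col that unfolding is_collapse_def by blast
  have below: "\<exists>b'. E b' B \<and> lexo \<theta> b' b \<and> maps_to E \<rho> b' v" if "maps_to E \<rho> b y" "E v y" for b y v
    using col dom[OF that(1)] that unfolding is_collapse_def by blast
  have above: "E v y" if "maps_to E \<rho> b y" "lexo \<theta> b' b" "maps_to E \<rho> b' v" for b y v b'
    using col dom[OF that(1)] dom[OF that(3)] that unfolding is_collapse_def by blast
  have val: "maps_to E \<rho> b y \<Longrightarrow> y = g b" for b y
  proof (induction b arbitrary: y rule: wfp_induct_rule[OF wf_lexo, of B \<theta>])
    case (1 b)
    have b: "E b B" using dom[OF 1(2)] by blast
    show ?case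
    proof (rule E_ext)
      fix v
      show "E v y \<longleftrightarrow> E v (g b)"
      proof
        assume "E v y"
        then obtain b' where b': "E b' B" "lexo \<theta> b' b" "maps_to E \<rho> b' v" using below[OF 1(2)] by blast
        then have "v = g b'" using 1(1)[of b' v] b by blast
        then show "E v (g b)" using g[OF b] b' by blast
      next
        assume "E v (g b)"
        then obtain b' where b': "E b' B" "lexo \<theta> b' b" "v = g b'" using g[OF b] by blast
        obtain v' where v': "maps_to E \<rho> b' v'" using ex[OF b'(1)] by blast
        then have "v' = g b'" using 1(1)[of b' v'] b b' by blast
        then show "E v y" using above[OF 1(2) b'(2) v'] b'(3) by simp
      qed
    qed
  qed
  show ?thesis using val ex dom by blast
qed

lemma collapse_in:
  assumes \<theta>: "\<theta> \<in> W" and B: "B \<in> W" and col: "is_collapse \<theta> B \<rho> \<beta>"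
  shows "\<rho> \<in> W"
proof -
  obtain g G where G: "G \<in> W" "is_rel G" "\<And>x y. maps_to E G x y \<longleftrightarrow> E x B \<and> y = g x"
    and "\<And>x. E x B \<Longrightarrow> g x \<in> W"
    and g: "\<And>x v. E x B \<Longrightarrow> E v (g x) \<longleftrightarrow> (\<exists>z. E z B \<and> lexo \<theta> z x \<and> v = g z)"
    by (rule lexo_recursion[OF \<theta> B]) (rule that)
  have "is_rel \<rho>" using col unfolding is_collapse_def is_rel_def by blast
  moreover have "maps_to E \<rho> b y \<longleftrightarrow> E b B \<and> y = g b" for b y
    by (rule collapse_unique[OF col]) (rule g)
  ultimately have "\<rho> = G" using G(2,3) by (intro is_rel_eqI) simp_all
  then show ?thesis using G(1) by simp
qed

lemma collapse_inj:
  assumes \<theta>: "\<theta> \<in> W" "is_ordinal E \<theta>" and B: "B \<in> W"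
    and B_sub: "\<And>p. E p B \<Longrightarrow> \<exists>a. E a \<theta> \<and> (\<exists>b. E b \<theta> \<and> is_opair E p a b)"
    and col: "is_collapse \<theta> B \<rho> \<beta>"
    and b: "maps_to E \<rho> b y" "maps_to E \<rho> b' y"
  shows "b = b'"
proof (rule ccontr)
  assume "b \<noteq> b'"
  obtain g G where G: "G \<in> W" "is_rel G" "\<And>x y. maps_to E G x y \<longleftrightarrow> E x B \<and> y = g x"
    and "\<And>x. E x B \<Longrightarrow> g x \<in> W"
    and g: "\<And>x v. E x B \<Longrightarrow> E v (g x) \<longleftrightarrow> (\<exists>z. E z B \<and> lexo \<theta> z x \<and> v = g z)"
    by (rule lexo_recursion[OF \<theta>(1) B]) (rule that)
  have \<rho>_iff: "maps_to E \<rho> b y \<longleftrightarrow> E b B \<and> y = g b" for b y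
    by (rule collapse_unique[OF col]) (rule g)
  have b: "E b B" "E b' B" "g b = g b'" using b unfolding \<rho>_iff by auto
  have "lexo \<theta> b b' \<or> lexo \<theta> b' b"
    using lexo_total[OF \<theta>(2) B_sub[OF b(1)] B_sub[OF b(2)]] \<open>b \<noteq> b'\<close> by blast
  then have "E (g b) (g b') \<or> E (g b') (g b)" using g b by blast
  then show False using b(3) E_irrefl by simp
qed

text \<open>As \<rho> belongs to \<open>W\<close> and is injective, a subset of \<open>B\<close> and
  its image can be computed from each other in \<open>W\<close>. In \<open>common_subset_iff\<close>
  this exchange is used once in \<open>V\<close> and once, by elementarity, on the side of
  \<open>N\<close>.\<close>

lemma collapse_image_iff:
  assumes \<theta>: "\<theta> \<in> W" "is_ordinal E \<theta>" and B: "B \<in> W" and \<beta>: "\<beta> \<in> W"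
    and B_sub: "\<And>p. E p B \<Longrightarrow> \<exists>a. E a \<theta> \<and> (\<exists>b. E b \<theta> \<and> is_opair E p a b)"
    and col: "is_collapse \<theta> B \<rho> \<beta>"
    and A: "\<And>x. E x A \<Longrightarrow> E x B" and im: "is_image \<rho> \<beta> A A0"
  shows "A \<in> W \<longleftrightarrow> A0 \<in> W"
proof -
  have \<rho>: "\<rho> \<in> W" by (rule collapse_in[OF \<theta>(1) B col])
  have inj: "b = b'" if "maps_to E \<rho> b y" "maps_to E \<rho> b' y" for b b' y
    by (rule collapse_inj[OF \<theta> B B_sub col that])
  show ?thesis
  proof
    assume AW: "A \<in> W"
    have "\<exists>Z\<in>W. \<forall>y. E y Z \<longleftrightarrow> E y \<beta> \<and> (\<exists>b. E b A \<and> maps_to E \<rho> b y)"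
      by (rule sep[OF _ \<beta>]) (intro dj_rules | simp add: AW \<rho>)+
    then obtain Z where Z: "Z \<in> W" "\<And>y. E y Z \<longleftrightarrow> E y \<beta> \<and> (\<exists>b. E b A \<and> maps_to E \<rho> b y)" by blast
    have "Z = A0" by (rule E_ext) (simp add: Z(2) is_imageD[OF im])
    then show "A0 \<in> W" using Z(1) by simp
  next
    assume AW: "A0 \<in> W"
    have "\<exists>Z\<in>W. \<forall>b. E b Z \<longleftrightarrow> E b B \<and> (\<exists>y. E y A0 \<and> maps_to E \<rho> b y)"
      by (rule sep[OF _ B]) (intro dj_rules | simp add: AW \<rho>)+
    then obtain Z where Z: "Z \<in> W" "\<And>b. E b Z \<longleftrightarrow> E b B \<and> (\<exists>y. E y A0 \<and> maps_to E \<rho> b y)" by blast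
    have "Z = A"
    proof (rule E_ext)
      fix b
      show "E b Z \<longleftrightarrow> E b A"
      proof
        assume "E b Z"
        then obtain y b' where "maps_to E \<rho> b y" "E b' A" "maps_to E \<rho> b' y"
          using Z(2) is_imageD[OF im] by blast
        then show "E b A" using inj[of b y b'] by simp
      next
        assume b: "E b A"
        then obtain y where "E y \<beta>" "maps_to E \<rho> b y" using col A unfolding is_collapse_def by blast
        then show "E b Z" using Z(2) is_imageD[OF im] A b by blast
      qed
    qed
    then show "A \<in> W" using Z(1) by simp
  qed
qed

lemma ex_collapse:
  assumes \<theta>: "\<theta> \<in> W" "is_ordinal E \<theta>" and B: "B \<in> W"
    and B_sub: "\<And>p. E p B \<Longrightarrow> \<exists>a. E a \<theta> \<and> (\<exists>b. E b \<theta> \<and> is_opair E p a b)"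
  shows "\<exists>\<rho>\<in>W. \<exists>\<beta>\<in>W. is_ordinal E \<beta> \<and> is_collapse \<theta> B \<rho> \<beta> \<and>
    (\<forall>y. E y \<beta> \<longrightarrow> (\<exists>b. E b B \<and> maps_to E \<rho> b y)) \<and>
    (\<forall>b y y'. maps_to E \<rho> b y \<longrightarrow> maps_to E \<rho> b y' \<longrightarrow> y = y')"
proof -
  obtain g G where G: "G \<in> W" "is_rel G" "\<And>x y. maps_to E G x y \<longleftrightarrow> E x B \<and> y = g x"
    and "\<And>x. E x B \<Longrightarrow> g x \<in> W"
    and g: "\<And>x v. E x B \<Longrightarrow> E v (g x) \<longleftrightarrow> (\<exists>z. E z B \<and> lexo \<theta> z x \<and> v = g z)"
    by (rule lexo_recursion[OF \<theta>(1) B]) (rule that)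
  obtain \<beta> where \<beta>: "\<beta> \<in> W" "\<And>y. E y \<beta> \<longleftrightarrow> (\<exists>x. maps_to E G x y)" using ex_ran[OF G(1)] by blast
  have ord: "E x B \<Longrightarrow> is_ordinal E (g x)" for x
  proof (induction x rule: wfp_induct_rule[OF wf_lexo, of B \<theta>])
    case (1 x)
    show ?case
    proof (rule ordinalI)
      show "is_ordinal E v" if v: "E v (g x)" for v
      proof -
        obtain z where z: "E z B" "lexo \<theta> z x" "v = g z" using v g[OF 1(2)] by blast
        then show ?thesis using 1(1)[of z] 1(2) by blast
      qed
      show "E w (g x)" if v: "E v (g x)" and w: "E w v" for v w
      proof -
        obtain z where z: "E z B" "lexo \<theta> z x" "v = g z" using v g[OF 1(2)] by blast
        then obtain z' where "E z' B" "lexo \<theta> z' z" "w = g z'" using w g[OF z(1)] by blast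
        then show ?thesis using g[OF 1(2)] lexo_trans[OF \<theta>(2) _ z(2)] by blast
      qed
    qed
  qed
  have "is_ordinal E \<beta>"
  proof (rule ordinalI)
    show "is_ordinal E y" if "E y \<beta>" for y
      using that ord unfolding \<beta>(2) G(3) by blast
    show "E z \<beta>" if "E y \<beta>" "E z y" for y z
      using that g unfolding \<beta>(2) G(3) by blast
  qed
  moreover have "is_collapse \<theta> B G \<beta>"
    unfolding is_collapse_def
  proof (intro conjI allI impI)
    fix p assume p: "E p G"
    then obtain x y where "is_opair E p x y" using G(2) unfolding is_rel_def by blast
    moreover then have "maps_to E G x y" using p by (rule maps_toI[rotated])
    ultimately show "\<exists>b. E b B \<and> (\<exists>y. E y \<beta> \<and> is_opair E p b y)" using \<beta>(2) G(3) by blast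
  next
    show "\<exists>y. E y \<beta> \<and> maps_to E G b y" if "E b B" for b
      using that unfolding \<beta>(2) G(3) by blast
  next
    show "\<exists>b'. E b' B \<and> lexo \<theta> b' b \<and> maps_to E G b' v" if "maps_to E G b y" "E v y" for b y v
      using that g unfolding G(3) by blast
  next
    show "E v y" if "maps_to E G b y" "E b' B" "lexo \<theta> b' b" "maps_to E G b' v" for b y b' v
      using that g unfolding G(3) by blast
  qed
  ultimately show ?thesis
    using \<beta> G by (intro bexI[OF _ G(1)] bexI[OF _ \<beta>(1)]) (simp add: G(3))
qed

end

section \<open>Subsets of an ordinal square in the two target models\<close>

context lift
begin

lemma sm_up: "v.sm a \<Longrightarrow> vb.sm a" "mb.sm a \<Longrightarrow> vb.sm a" "m.sm a \<Longrightarrow> v.sm a" "m.sm a \<Longrightarrow> mb.sm a"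
  using V_sub Mb_sub M_def unfolding v.sm_def vb.sm_def mb.sm_def m.sm_def by blast+

lemma Mb_seq:
  assumes "E \<xi> \<delta>" "k \<in> Vb" "is_bijection E k \<xi> a" "\<And>u. E u a \<Longrightarrow> u \<in> Mb"
  shows "k \<in> Mb" "a \<in> Mb"
proof -
  note kD = is_bijectionD[OF assms(3)]
  have "is_function E k \<xi> (ext E a)" using assms(3) by (simp add: is_bijection_def)
  then have "is_function E k \<xi> Mb"
    using assms(4) unfolding is_function_def ext_def by blast
  then show k: "k \<in> Mb" using Mb_closed assms(1,2) unfolding closed_under_sequences_def by blast
  obtain r where r: "r \<in> Mb" "\<And>y. E y r \<longleftrightarrow> (\<exists>x. maps_to E k x y)" using mb.ex_ran[OF k] by blast
  have "r = a" by (rule E_ext) (use r(2) kD(1,5) in blast)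
  then show "a \<in> Mb" using r(1) by simp
qed

lemma Mb_small_in:
  assumes "vb.sm a" "\<And>u. E u a \<Longrightarrow> u \<in> Mb"
  shows "a \<in> Mb"
  using assms Mb_seq unfolding vb.sm_def by blast

text \<open>An enumeration of \<open>a\<close> in \<open>V\<close> is a short sequence of elements
  of \<open>Mb\<close>, so closure puts it into \<open>Mb\<close> and hence into \<open>M\<close>:
  smallness in \<open>V\<close> is witnessed in \<open>M\<close> itself.\<close>

lemma M_small_in:
  assumes "a \<in> V" "v.sm a" "\<And>u. E u a \<Longrightarrow> u \<in> Mb"
  shows "a \<in> M \<and> m.sm a"
proof -
  obtain \<xi> k where k: "E \<xi> \<delta>" "k \<in> V" "is_bijection E k \<xi> a" using assms(2) unfolding v.sm_def by blast
  then have "k \<in> Mb" "a \<in> Mb" using Mb_seq[of \<xi> k a] V_sub assms(3) by blast+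
  then have "k \<in> M" "a \<in> M" using k(2) assms(1) by (simp_all add: M_iff)
  then show ?thesis using k(1,3) unfolding m.sm_def by blast
qed

lemma approxI:
  assumes "A \<in> Vb" "\<And>x. E x A \<Longrightarrow> x \<in> V"
    and "\<And>a. a \<in> V \<Longrightarrow> v.sm a \<Longrightarrow> \<exists>z\<in>V. \<forall>u. E u z \<longleftrightarrow> E u A \<and> E u a"
  shows "A \<in> V"
proof -
  have "is_set_in E V (ext E A \<inter> ext E a)" if "a \<in> V" "size_less_in E V a \<delta>" for a
    using assms(3)[of a] that v.sm_iff unfolding is_set_in_def ext_def by blast
  moreover have "ext E A \<subseteq> V" using assms(2) by (auto simp: ext_def)
  ultimately show ?thesis using approx assms(1) unfolding approximation_property_def by blast
qed

lemma coverD: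
  assumes "A \<in> Vb" "\<And>x. E x A \<Longrightarrow> x \<in> V" "vb.sm A"
  shows "\<exists>B\<in>V. v.sm B \<and> (\<forall>x. E x A \<longrightarrow> E x B)"
proof -
  have "ext E A \<subseteq> V" using assms(2) by (auto simp: ext_def)
  then obtain B where "B \<in> V" "ext E A \<subseteq> ext E B" "size_less_in E V B \<delta>"
    using cover assms(1,3) vb.sm_iff unfolding cover_property_def by blast
  then show ?thesis using v.sm_iff by (auto simp: ext_def)
qed

end

text \<open>Here \<open>X\<close> is the square of \<theta>, \<open>P\<close> its power set in the
  sense of \<open>M\<close>, and \<open>S\<close> the small members of \<open>P\<close>.
  \<open>N\<close> enters only through \<open>j P\<close> and \<open>j S\<close>, which makes sense
  even though \<open>M\<close> is not assumed to be definable in \<open>Mb\<close>: these are values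
  of \<open>j\<close> at single elements.\<close>

locale block = lift +
  fixes \<theta> X P S
  assumes \<theta>: "\<theta> \<in> M" "is_ordinal E \<theta>"
    and X: "X \<in> M" "\<And>p. E p X \<longleftrightarrow> (\<exists>a. E a \<theta> \<and> (\<exists>b. E b \<theta> \<and> is_opair E p a b))"
    and P: "P \<in> M" "\<And>a. E a P \<longleftrightarrow> a \<in> M \<and> (\<forall>x. E x a \<longrightarrow> E x X)"
    and S: "S \<in> M" "\<And>a. E a S \<longleftrightarrow> E a P \<and> m.sm a"
begin

lemma in_Mb: "\<theta> \<in> Mb" "X \<in> Mb" "P \<in> Mb" "S \<in> Mb" "\<delta> \<in> Mb"
  using \<theta> X P S mb.d_in by (auto simp: M_iff)

lemma in_Nb: "j \<theta> \<in> Nb" "j X \<in> Nb" "j P \<in> Nb" "j S \<in> Nb"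
  using in_Mb j_in by blast+

lemma jX_iff: "E p (j X) \<longleftrightarrow> (\<exists>a. E a (j \<theta>) \<and> (\<exists>b. E b (j \<theta>) \<and> is_opair E p a b))"
proof -
  have T: "dj E MN CJ 60 (\<lambda>i e. (\<forall>p. E p (cj X i) \<longrightarrow> (\<exists>a. E a (cj \<theta> i) \<and> (\<exists>b. E b (cj \<theta> i) \<and> is_opair E p a b))) \<and>
    (\<forall>a. E a (cj \<theta> i) \<longrightarrow> (\<forall>b. E b (cj \<theta> i) \<longrightarrow> (\<forall>p\<in>MN i. is_opair E p a b \<longrightarrow> E p (cj X i)))))"
    by (intro el.dj_rules | simp add: cj_in in_Mb)+
  have "(\<forall>p. E p X \<longrightarrow> (\<exists>a. E a \<theta> \<and> (\<exists>b. E b \<theta> \<and> is_opair E p a b))) \<and>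
    (\<forall>a. E a \<theta> \<longrightarrow> (\<forall>b. E b \<theta> \<longrightarrow> (\<forall>p\<in>Mb. is_opair E p a b \<longrightarrow> E p X)))"
    using X(2) by blast
  from elem[OF T, unfolded cj_simps MN_simps, THEN iffD1, OF this]
  show ?thesis using Nb_opair_in Nb_trans[OF in_Nb(1)] by blast
qed

lemma j_theta: "is_ordinal E (j \<theta>)" "j \<theta> \<in> V"
  using j_ordinal in_Mb \<theta>(2) ords_V in_Nb Nb_sub by blast+

lemma jX_in: "j X \<in> V"
proof -
  obtain Y where Y: "Y \<in> V" "\<And>p. E p Y \<longleftrightarrow> (\<exists>x. E x (j \<theta>) \<and> (\<exists>y. E y (j \<theta>) \<and> is_opair E p x y))"
    using v.ex_prod[OF j_theta(2,2)] by blast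
  have "Y = j X" by (rule E_ext) (simp add: Y(2) jX_iff)
  then show ?thesis using Y(1) by simp
qed

text \<open>A small \<open>a\<close> of \<open>V\<close> may be cut down to \<open>X\<close>, where
  it lies in \<open>M\<close> by \<open>M_small_in\<close>. Testing members of \<open>S\<close>
  therefore suffices, and in this form the approximation property mentions only parameters from
  \<open>M\<close>, so that \<open>j\<close> can carry it over.\<close>

lemma M_approx:
  assumes A: "A \<in> Mb" "\<And>z. E z A \<Longrightarrow> E z X"
    and H: "\<And>a. E a S \<Longrightarrow> \<exists>z. E z P \<and> (\<forall>u. E u z \<longleftrightarrow> E u A \<and> E u a)"
  shows "E A P"
proof -
  have XW: "x \<in> M" if "E x X" for x using m.W_trans[OF X(1) that] .
  have "A \<in> V"
  proof (rule approxI)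
    show "A \<in> Vb" using A Mb_sub by blast
    show "x \<in> V" if "E x A" for x using XW[OF A(2)[OF that]] by (simp add: M_iff)
    fix a assume a: "a \<in> V" "v.sm a"
    have XV: "X \<in> V" using X(1) by (simp add: M_iff)
    have "\<exists>b\<in>V. \<forall>x. E x b \<longleftrightarrow> E x a \<and> E x X"
      by (rule v.sep[OF _ a(1)]) (intro v.dj_rules | simp add: XV)+
    then obtain b where b: "b \<in> V" "\<And>x. E x b \<longleftrightarrow> E x a \<and> E x X" by blast
    have "v.sm b" by (rule v.sm_subset[OF a(2,1) b(1)]) (simp add: b(2))
    then have "b \<in> M \<and> m.sm b" using M_small_in b XW M_iff by blast
    then have "E b S" using S(2) P(2) b(2) by blast
    then obtain z where z: "E z P" "\<forall>u. E u z \<longleftrightarrow> E u A \<and> E u b" using H by blast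
    have "z \<in> V" using z(1) P(2) M_iff by blast
    then show "\<exists>z\<in>V. \<forall>u. E u z \<longleftrightarrow> E u A \<and> E u a" using z(2) b(2) A(2) by blast
  qed
  then show ?thesis using A P(2) M_iff by blast
qed

lemma M_cover:
  assumes c: "c \<in> Mb" "\<And>z. E z c \<Longrightarrow> E z X" "mb.sm c"
  shows "\<exists>b. E b S \<and> (\<forall>x. E x c \<longrightarrow> E x b)"
proof -
  have XW: "x \<in> M" if "E x X" for x using m.W_trans[OF X(1) that] .
  have XV: "X \<in> V" using X(1) by (simp add: M_iff)
  have "x \<in> V" if "E x c" for x using XW[OF c(2)[OF that]] by (simp add: M_iff)
  then obtain a where a: "a \<in> V" "v.sm a" "\<forall>x. E x c \<longrightarrow> E x a"
    using coverD[of c] c(1,3) sm_up(2) Mb_sub by blast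
  have "\<exists>b\<in>V. \<forall>x. E x b \<longleftrightarrow> E x a \<and> E x X"
    by (rule v.sep[OF _ a(1)]) (intro v.dj_rules | simp add: XV)+
  then obtain b where b: "b \<in> V" "\<And>x. E x b \<longleftrightarrow> E x a \<and> E x X" by blast
  have "v.sm b" by (rule v.sm_subset[OF a(2,1) b(1)]) (simp add: b(2))
  then have "b \<in> M \<and> m.sm b" using M_small_in b XW M_iff by blast
  then have "E b S" using S(2) P(2) b(2) by blast
  then show ?thesis using b(2) a(3) c(2) by blast
qed

lemma N_approx:
  assumes A: "A \<in> Nb" "\<And>z. E z A \<Longrightarrow> E z (j X)"
    and H: "\<And>a. E a (j S) \<Longrightarrow> \<exists>z. E z (j P) \<and> (\<forall>u. E u z \<longleftrightarrow> E u A \<and> E u a)"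
  shows "E A (j P)"
proof -
  \<comment> \<open>The equivalence in \<open>H\<close> is split into two implications with bounded
    quantifiers, so that \<open>u\<close> need not be restricted to either model.\<close>
  have T: "dj E MN CJ 60 (\<lambda>b e. \<forall>A\<in>MN b. (\<forall>z. E z A \<longrightarrow> E z (cj X b)) \<longrightarrow>
     (\<forall>a. E a (cj S b) \<longrightarrow> (\<exists>z. E z (cj P b) \<and> ((\<forall>u. E u z \<longrightarrow> E u A \<and> E u a) \<and> (\<forall>u. E u A \<longrightarrow> E u a \<longrightarrow> E u z)))) \<longrightarrow>
     E A (cj P b))"
    by (intro el.dj_rules | simp add: cj_in in_Mb)+
  have "\<forall>A\<in>Mb. (\<forall>z. E z A \<longrightarrow> E z X) \<longrightarrow>
     (\<forall>a. E a S \<longrightarrow> (\<exists>z. E z P \<and> ((\<forall>u. E u z \<longrightarrow> E u A \<and> E u a) \<and> (\<forall>u. E u A \<longrightarrow> E u a \<longrightarrow> E u z)))) \<longrightarrow>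
     E A P"
  proof (intro ballI impI)
    fix A assume A: "A \<in> Mb" "\<forall>z. E z A \<longrightarrow> E z X" and
      H: "\<forall>a. E a S \<longrightarrow> (\<exists>z. E z P \<and> ((\<forall>u. E u z \<longrightarrow> E u A \<and> E u a) \<and> (\<forall>u. E u A \<longrightarrow> E u a \<longrightarrow> E u z)))"
    show "E A P"
    proof (rule M_approx[OF A(1)])
      show "\<exists>z. E z P \<and> (\<forall>u. E u z \<longleftrightarrow> E u A \<and> E u a)" if a: "E a S" for a
      proof -
        obtain z where "E z P" "\<forall>u. E u z \<longrightarrow> E u A \<and> E u a" "\<forall>u. E u A \<longrightarrow> E u a \<longrightarrow> E u z"
          using H a by blast
        then show ?thesis by (intro exI[of _ z]) blast
      qed
    qed (use A(2) in blast)
  qed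
  from elem[OF T, unfolded cj_simps MN_simps, THEN iffD1, OF this]
  have R: "(\<forall>z. E z A \<longrightarrow> E z (j X)) \<longrightarrow>
     (\<forall>a. E a (j S) \<longrightarrow> (\<exists>z. E z (j P) \<and> ((\<forall>u. E u z \<longrightarrow> E u A \<and> E u a) \<and> (\<forall>u. E u A \<longrightarrow> E u a \<longrightarrow> E u z)))) \<longrightarrow>
     E A (j P)" using A(1) by (rule bspec)
  show ?thesis
  proof (rule R[rule_format])
    fix a assume "E a (j S)"
    then obtain z where "E z (j P)" "\<forall>u. E u z \<longleftrightarrow> E u A \<and> E u a" using H by blast
    then show "\<exists>z. E z (j P) \<and> ((\<forall>u. E u z \<longrightarrow> E u A \<and> E u a) \<and> (\<forall>u. E u A \<longrightarrow> E u a \<longrightarrow> E u z))"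
      by (intro exI[of _ z]) simp
  qed (rule A(2))
qed

text \<open>Transferred to the target, smallness is witnessed by bijections in \<open>Nb\<close>
  whose index lies below \<open>j \<delta> = \<delta>\<close>, and these are also in
  \<open>Vb\<close>.\<close>

lemma N_small: "E a (j S) \<Longrightarrow> E a (j P) \<and> vb.sm a"
proof -
  have T: "dj E MN CJ 60 (\<lambda>b e. \<forall>a. E a (cj S b) \<longrightarrow> E a (cj P b) \<and>
      (\<exists>\<xi>. E \<xi> (cj \<delta> b) \<and> (\<exists>f\<in>MN b. is_bijection E f \<xi> a)))"
    by (intro el.dj_rules | simp add: cj_in in_Mb)+
  have "\<forall>a. E a S \<longrightarrow> E a P \<and> (\<exists>\<xi>. E \<xi> \<delta> \<and> (\<exists>f\<in>Mb. is_bijection E f \<xi> a))"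
    using S(2) sm_up(4) unfolding mb.sm_def by blast
  from elem[OF T, unfolded cj_simps MN_simps j_delta, THEN iffD1, OF this]
  show "E a (j S) \<Longrightarrow> ?thesis" using Nb_sub unfolding vb.sm_def by blast
qed

lemma N_inter:
  assumes "E a (j P)"
  shows "E x a \<Longrightarrow> E x (j X)" "E b (j P) \<Longrightarrow> \<exists>c. E c (j P) \<and> (\<forall>u. E u c \<longleftrightarrow> E u a \<and> E u b)"
proof -
  have T: "dj E MN CJ 60 (\<lambda>i e. \<forall>a. E a (cj P i) \<longrightarrow> (\<forall>x. E x a \<longrightarrow> E x (cj X i)) \<and>
     (\<forall>b. E b (cj P i) \<longrightarrow> (\<exists>c. E c (cj P i) \<and> ((\<forall>u. E u c \<longrightarrow> E u a \<and> E u b) \<and> (\<forall>u. E u a \<longrightarrow> E u b \<longrightarrow> E u c)))))"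
    by (intro el.dj_rules | simp add: cj_in in_Mb)+
  have "\<forall>a. E a P \<longrightarrow> (\<forall>x. E x a \<longrightarrow> E x X) \<and>
     (\<forall>b. E b P \<longrightarrow> (\<exists>c. E c P \<and> ((\<forall>u. E u c \<longrightarrow> E u a \<and> E u b) \<and> (\<forall>u. E u a \<longrightarrow> E u b \<longrightarrow> E u c))))"
  proof (intro allI impI conjI)
    show "E x X" if "E a P" "E x a" for a x using that P(2) by blast
    fix a b assume ab: "E a P" "E b P"
    then have W: "a \<in> M" "b \<in> M" using P(2) by blast+
    have "\<exists>c\<in>M. \<forall>x. E x c \<longleftrightarrow> E x a \<and> E x b"
      by (rule m.sep[OF _ W(1)]) (intro m.dj_rules | simp add: W)+
    then obtain c where c: "c \<in> M" "\<And>x. E x c \<longleftrightarrow> E x a \<and> E x b" by blast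
    then have "E c P" using P(2) ab by blast
    then show "\<exists>c. E c P \<and> ((\<forall>u. E u c \<longrightarrow> E u a \<and> E u b) \<and> (\<forall>u. E u a \<longrightarrow> E u b \<longrightarrow> E u c))"
      using c(2) by blast
  qed
  from elem[OF T, unfolded cj_simps MN_simps, THEN iffD1, OF this]
  have R: "(\<forall>x. E x a \<longrightarrow> E x (j X)) \<and>
     (\<forall>b. E b (j P) \<longrightarrow> (\<exists>c. E c (j P) \<and> ((\<forall>u. E u c \<longrightarrow> E u a \<and> E u b) \<and> (\<forall>u. E u a \<longrightarrow> E u b \<longrightarrow> E u c))))"
    using assms by blast
  show "E x a \<Longrightarrow> E x (j X)" using R by blast
  assume "E b (j P)"
  then obtain c where "E c (j P)" "\<forall>u. E u c \<longrightarrow> E u a \<and> E u b" "\<forall>u. E u a \<longrightarrow> E u b \<longrightarrow> E u c"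
    using R by blast
  then show "\<exists>c. E c (j P) \<and> (\<forall>u. E u c \<longleftrightarrow> E u a \<and> E u b)" by (intro exI[of _ c]) blast
qed

lemma bij_in_Nb:
  assumes c: "c \<in> Vb" "\<And>u. E u c \<Longrightarrow> u \<in> Nb" and k: "E \<xi> \<delta>" "k \<in> Vb" "is_bijection E k \<xi> c"
  shows "c \<in> Nb" "k \<in> Nb"
proof -
  note kD = is_bijectionD[OF k(3)]
  have \<xi>\<delta>: "E \<eta> \<delta>" if "E \<eta> \<xi>" for \<eta> using ordinal_trans[OF vb.d_ord k(1) that] .
  have \<delta>Nb: "\<eta> \<in> Nb" if "E \<eta> \<delta>" for \<eta>
    using j_in[OF mb.d_mem_in[OF that]] j_less[OF that] by simp
  have k_pair: "\<exists>\<eta> u. E \<eta> \<xi> \<and> E u c \<and> is_opair E p \<eta> u" if "E p k" for p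
    using k(3) that unfolding is_bijection_def is_function_def ext_def by blast
  show "c \<in> Nb"
  proof -
    have "vb.def2 40 (\<lambda>u \<eta>. maps_to E k \<eta> u)"
      by (rule vb.def2I) (intro vb.dj_rules | simp add: k)+
    from vb.ex_rel[OF this c(1) vb.d_in] obtain i where i: "i \<in> Vb"
      "\<And>p. E p i \<Longrightarrow> \<exists>x y. E x c \<and> E y \<delta> \<and> is_opair E p x y"
      "\<And>u \<eta>. maps_to E i u \<eta> \<longleftrightarrow> E u c \<and> E \<eta> \<delta> \<and> maps_to E k \<eta> u" by blast
    have "is_function E i c (ext E \<delta>)"
    proof (rule is_functionI)
      show "\<exists>x y. E x c \<and> y \<in> ext E \<delta> \<and> is_opair E p x y" if "E p i" for p
        using i(2)[OF that] by (simp add: ext_def)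
      show "\<exists>y. maps_to E i x y" if "E x c" for x
        using kD(5)[OF that] kD(1) \<xi>\<delta> that unfolding i(3) by blast
      show "y = y'" if "maps_to E i x y" "maps_to E i x y'" for x y y'
        using that kD(3) unfolding i(3) by blast
    qed
    then have "inj_into i c \<delta>" unfolding inj_into_def i(3) using kD(2) by blast
    then show ?thesis using Nb_small_in[OF c i(1)] by blast
  qed
  show "k \<in> Nb"
  proof -
    have "vb.def2 40 (\<lambda>p \<eta>. \<exists>u. E u c \<and> is_opair E p \<eta> u)"
      by (rule vb.def2I) (intro vb.dj_rules vb.trm_shift | simp add: c)+
    from vb.ex_rel[OF this k(2) vb.d_in] obtain i where i: "i \<in> Vb"
      "\<And>p. E p i \<Longrightarrow> \<exists>x y. E x k \<and> E y \<delta> \<and> is_opair E p x y"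
      "\<And>p \<eta>. maps_to E i p \<eta> \<longleftrightarrow> E p k \<and> E \<eta> \<delta> \<and> (\<exists>u. E u c \<and> is_opair E p \<eta> u)" by blast
    have "is_function E i k (ext E \<delta>)"
    proof (rule is_functionI)
      show "\<exists>x y. E x k \<and> y \<in> ext E \<delta> \<and> is_opair E p x y" if "E p i" for p
        using i(2)[OF that] by (simp add: ext_def)
      show "\<exists>y. maps_to E i x y" if "E x k" for x
        using k_pair[OF that] \<xi>\<delta> that unfolding i(3) by blast
      show "y = y'" if "maps_to E i x y" "maps_to E i x y'" for x y y'
        using that is_opair_inj unfolding i(3) by blast
    qed
    moreover have "p = p'" if pp: "maps_to E i p \<eta>" "maps_to E i p' \<eta>" for p p' \<eta>
    proof -
      obtain u u' where u: "E p k" "is_opair E p \<eta> u" "E p' k" "is_opair E p' \<eta> u'"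
        using pp unfolding i(3) by blast
      then have "u = u'" using kD(2) maps_toI by blast
      then show ?thesis using u is_opair_fun by blast
    qed
    ultimately have "inj_into i k \<delta>" unfolding inj_into_def by blast
    moreover have "p \<in> Nb" if "E p k" for p
      using k_pair[OF that] c(2) \<delta>Nb \<xi>\<delta> Nb_opair_in by blast
    ultimately show ?thesis using Nb_small_in[OF k(2) _ i(1)] by blast
  qed
qed

lemma jX_Nb: "E x (j X) \<Longrightarrow> x \<in> Nb"
  using Nb_trans in_Nb by blast

text \<open>What transfers from \<open>M_cover\<close> concerns small sets of \<open>Nb\<close>. A
  small set of \<open>Vb\<close> with members in \<open>Nb\<close> qualifies, because closure puts
  both the set and its enumeration into \<open>Nb\<close>.\<close>

lemma N_cover:
  assumes c: "c \<in> Vb" "\<And>x. E x c \<Longrightarrow> E x (j X)" "vb.sm c"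
  shows "\<exists>b. E b (j S) \<and> (\<forall>x. E x c \<longrightarrow> E x b)"
proof -
  obtain \<xi> k where k: "E \<xi> \<delta>" "k \<in> Vb" "is_bijection E k \<xi> c" using c(3) unfolding vb.sm_def by blast
  have Nb: "c \<in> Nb" "k \<in> Nb" using bij_in_Nb[OF c(1) _ k] jX_Nb c(2) by blast+
  have T: "dj E MN CJ 60 (\<lambda>b e. \<forall>c\<in>MN b. (\<forall>z. E z c \<longrightarrow> E z (cj X b)) \<longrightarrow>
     (\<exists>\<xi>. E \<xi> (cj \<delta> b) \<and> (\<exists>f\<in>MN b. is_bijection E f \<xi> c)) \<longrightarrow>
     (\<exists>a. E a (cj S b) \<and> (\<forall>x. E x c \<longrightarrow> E x a)))"
    by (intro el.dj_rules | simp add: cj_in in_Mb)+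
  have "\<forall>c\<in>Mb. (\<forall>z. E z c \<longrightarrow> E z X) \<longrightarrow> (\<exists>\<xi>. E \<xi> \<delta> \<and> (\<exists>f\<in>Mb. is_bijection E f \<xi> c)) \<longrightarrow>
     (\<exists>a. E a S \<and> (\<forall>x. E x c \<longrightarrow> E x a))"
    using M_cover unfolding mb.sm_def by blast
  from elem[OF T, unfolded cj_simps MN_simps j_delta, THEN iffD1, OF this]
  show ?thesis using Nb k(1,3) c(2) by blast
qed

section \<open>Covers that belong to both sides\<close>

definition covers :: "'a \<Rightarrow> 'a \<Rightarrow> 'a \<Rightarrow> 'a \<Rightarrow> bool" where
  "covers c Pv q b \<longleftrightarrow> (\<exists>a. E a Pv \<and> ((\<forall>x. E x q \<longrightarrow> E x a) \<and> (\<forall>x. E x c \<longrightarrow> E x a) \<and> (\<forall>x. E x a \<longrightarrow> E x b)))"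

text \<open>Taking the first suitable \<open>b\<close> in a fixed enumeration \<open>h\<close> of
  \<open>j S\<close> makes the step definable and single-valued, as the recursion requires. In
  \<open>covers\<close>, the set \<open>c\<close> enters every round because the recursion starts
  from the empty set.\<close>

definition first_cover :: "'a \<Rightarrow> 'a \<Rightarrow> 'a \<Rightarrow> 'a \<Rightarrow> 'a \<Rightarrow> 'a \<Rightarrow> bool" where
  "first_cover c Pv l h q b \<longleftrightarrow> (\<exists>\<zeta>. E \<zeta> l \<and> (maps_to E h \<zeta> b \<and> covers c Pv q b \<and>
     (\<forall>\<zeta>'. E \<zeta>' \<zeta> \<longrightarrow> (\<forall>b'. E b' (j S) \<longrightarrow> maps_to E h \<zeta>' b' \<longrightarrow> \<not> covers c Pv q b'))))"

lemma alternate_cover: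
  assumes c: "c \<in> Vb" "\<And>x. E x c \<Longrightarrow> E x (j X)" "vb.sm c"
    and Pv: "Pv \<in> V" "\<And>a. E a Pv \<longleftrightarrow> a \<in> V \<and> (\<forall>x. E x a \<longrightarrow> E x (j X)) \<and> v.sm a"
    and q: "q \<in> Vb" "\<And>x. E x q \<Longrightarrow> E x (j X)" "vb.sm q"
  shows "\<exists>b. E b (j S) \<and> covers c Pv q b"
proof -
  obtain d where d: "d \<in> Vb" "\<And>x. E x d \<longleftrightarrow> E x q \<or> E x c" using vb.ex_un[OF q(1) c(1)] by blast
  have d_sm: "vb.sm d" by (rule vb.sm_un[OF q(3,1) c(3,1) d(1)]) (simp add: d(2))
  have jXV: "x \<in> V" if "E x (j X)" for x using v.W_trans[OF jX_in that] .
  obtain a where a: "a \<in> V" "v.sm a" "\<forall>x. E x d \<longrightarrow> E x a"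
    using coverD[OF d(1) _ d_sm] d(2) jXV c(2) q(2) by blast
  have "\<exists>b\<in>V. \<forall>x. E x b \<longleftrightarrow> E x a \<and> E x (j X)"
    by (rule v.sep[OF _ a(1)]) (intro v.dj_rules | simp add: jX_in)+
  then obtain a' where a': "a' \<in> V" "\<And>x. E x a' \<longleftrightarrow> E x a \<and> E x (j X)" by blast
  have "v.sm a'" by (rule v.sm_subset[OF a(2,1) a'(1)]) (simp add: a'(2))
  then have "E a' Pv" "vb.sm a'" "a' \<in> Vb" using Pv(2) a' sm_up(1) V_sub by blast+
  then obtain b where "E b (j S)" "\<forall>x. E x a' \<longrightarrow> E x b" using N_cover a'(2) by blast
  moreover then have "covers c Pv q b"
    unfolding covers_def using \<open>E a' Pv\<close> a'(2) a(3) d(2) c(2) q(2) by blast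
  ultimately show ?thesis by blast
qed

text \<open>
  Small sets are covered in turn by elements of \<open>V\<close> and of \<open>N\<close>.  After \<open>\<delta>\<close> steps the union lies in
  both models by approximation, since by regularity every small piece of it is already captured at
  an earlier stage.
\<close>

theorem common_cover:
  assumes c: "c \<in> Vb" "\<And>x. E x c \<Longrightarrow> E x (j X)" "vb.sm c"
  shows "\<exists>B\<in>V. E B (j P) \<and> (\<forall>x. E x c \<longrightarrow> E x B) \<and> (\<exists>i\<in>Vb. inj_into i B \<delta>)"
proof -
  have jXVb: "j X \<in> Vb" "j S \<in> Vb" using in_Nb Nb_sub by blast+
  obtain Q where Q: "Q \<in> V" "\<And>a. E a Q \<longleftrightarrow> a \<in> V \<and> (\<forall>x. E x a \<longrightarrow> E x (j X))"
    using v.ex_power[OF jX_in] by blast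
  have "\<exists>b\<in>V. \<forall>a. E a b \<longleftrightarrow> E a Q \<and> v.sm a"
    unfolding v.sm_def by (rule v.sep[OF _ Q(1)]) (intro v.dj_rules | simp add: v.d_in)+
  then obtain Pv where Pv: "Pv \<in> V" "\<And>a. E a Pv \<longleftrightarrow> a \<in> V \<and> (\<forall>x. E x a \<longrightarrow> E x (j X)) \<and> v.sm a"
    using Q(2) by auto
  have PvVb: "Pv \<in> Vb" using Pv(1) V_sub by blast
  obtain l h where h: "l \<in> Vb" "h \<in> Vb" "is_ordinal E l" "is_bijection E h l (j S)"
    using vb.well_ordering[OF jXVb(2)] by blast
  note hD = is_bijectionD[OF h(4)]
  let ?C = "first_cover c Pv l h"
  have C_S: "E b (j S)" "covers c Pv q b" if "?C q b" for q b
    using that hD(1) unfolding first_cover_def by blast+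
  have C_fun: "b = b'" if b: "?C q b" "?C q b'" for q b b'
  proof -
    obtain \<zeta> where z: "E \<zeta> l" "maps_to E h \<zeta> b" "covers c Pv q b"
      "\<And>\<eta> d. E \<eta> \<zeta> \<Longrightarrow> E d (j S) \<Longrightarrow> maps_to E h \<eta> d \<Longrightarrow> \<not> covers c Pv q d"
      using b(1) unfolding first_cover_def by blast
    obtain \<zeta>' where z': "E \<zeta>' l" "maps_to E h \<zeta>' b'" "covers c Pv q b'"
      "\<And>\<eta> d. E \<eta> \<zeta>' \<Longrightarrow> E d (j S) \<Longrightarrow> maps_to E h \<eta> d \<Longrightarrow> \<not> covers c Pv q d"
      using b(2) unfolding first_cover_def by blast
    have "\<zeta> = \<zeta>'" using ordinal_linear[OF h(3) z(1) z'(1)] z z' hD(1) by blast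
    then show ?thesis using z(2) z'(2) hD(2) by blast
  qed
  have C_ex: "\<exists>b. ?C q b" if q: "q \<in> Vb" "\<And>x. E x q \<Longrightarrow> E x (j X)" "vb.sm q" for q
  proof -
    obtain b where b: "E b (j S)" "covers c Pv q b"
      using alternate_cover[OF c Pv q] by blast
    obtain \<zeta> where "maps_to E h \<zeta> b" using hD(5)[OF b(1)] by blast
    then have "\<exists>b. maps_to E h \<zeta> b \<and> covers c Pv q b" using b(2) by blast
    then obtain m where m: "\<exists>b. maps_to E h m b \<and> covers c Pv q b"
      "\<And>y. E y m \<Longrightarrow> \<not> (\<exists>b. maps_to E h y b \<and> covers c Pv q b)"
      using E_minimal[of "\<lambda>\<zeta>. \<exists>b. maps_to E h \<zeta> b \<and> covers c Pv q b"] by blast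
    then show ?thesis unfolding first_cover_def using hD(1) by blast
  qed
  \<comment> \<open>The recursion forms unions, so with this operation \<open>F \<xi>\<close> is the
    union of the covers chosen at all stages before \<xi>.\<close>
  define H where "H u q \<longleftrightarrow> (\<exists>b. E b (j S) \<and> (?C q b \<and> E u b))" for u q
  have r2: "vb.def2 20 E" by (rule vb.def2I) (intro vb.dj_rules)
  have cVb: "c \<in> Vb" by (rule c(1))
  have H2: "vb.def2 20 H"
    unfolding H_def first_cover_def covers_def
    by (rule vb.def2I) (intro vb.dj_rules vb.trm_shift | simp add: jXVb h PvVb cVb)+
  have Hset: "\<exists>s\<in>Vb. \<forall>u\<in>Vb. E u s \<longleftrightarrow> H u q" if "q \<in> Vb" for q
  proof (cases "\<exists>b. ?C q b")
    case True
    then obtain b where b: "?C q b" by blast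
    have "H u q \<longleftrightarrow> E u b" for u unfolding H_def using b C_fun C_S(1) by blast
    moreover have "b \<in> Vb" using C_S(1)[OF b] vb.W_trans jXVb by blast
    ultimately show ?thesis by blast
  next
    case False
    then have "\<not> H u q" for u unfolding H_def by blast
    then show ?thesis using vb.ex_empty by blast
  qed
  obtain F G where G: "G \<in> Vb" "is_rel G" "\<And>x y. maps_to E G x y \<longleftrightarrow> E x \<delta> \<and> y = F x"
    and F: "\<And>x. E x \<delta> \<Longrightarrow> F x \<in> Vb"
    and Fm: "\<And>x u. E x \<delta> \<Longrightarrow> u \<in> Vb \<Longrightarrow> E u (F x) \<longleftrightarrow> (\<exists>z. E z \<delta> \<and> E z x \<and> H u (F z))"
    using vb.recursion[OF vb.d_in vb.wf_E_on r2 H2 Hset] by (smt (verit))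
  have FmW: "E u (F x) \<longleftrightarrow> (\<exists>z. E z x \<and> H u (F z))" if x: "E x \<delta>" for u x
  proof -
    have "u \<in> Vb" if "H u q" for q
      using that C_S(1) vb.W_trans jXVb unfolding H_def by blast
    then show ?thesis using Fm[OF x, of u] F[OF x] vb.W_trans ordinal_trans[OF vb.d_ord x] by blast
  qed
  define Fr where "Fr u \<xi> \<longleftrightarrow> (\<exists>q\<in>Vb. maps_to E G \<xi> q \<and> E u q)" for u \<xi>
  have Fr_iff: "Fr u \<xi> \<longleftrightarrow> E u (F \<xi>)" if "E \<xi> \<delta>" for u \<xi>
    unfolding Fr_def G(3) using F that by blast
  have Fr2: "vb.def2 10 Fr"
    unfolding Fr_def by (rule vb.def2I) (intro vb.dj_rules vb.trm_shift | simp add: G)+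
  \<comment> \<open>A cover is only guaranteed for a small subset of \<open>j X\<close>, so this has
    to be shown along the recursion; regularity keeps the union of the earlier covers small.\<close>
  have step: "vb.sm (F \<xi>) \<and> (\<forall>u. E u (F \<xi>) \<longrightarrow> E u (j X))" if "E \<xi> \<delta>" for \<xi>
    using that
  proof (induction \<xi> rule: E_induct)
    case (mem \<xi>)
    note \<xi> = \<open>E \<xi> \<delta>\<close>
    have \<eta>\<delta>: "E \<eta> \<delta>" if "E \<eta> \<xi>" for \<eta> using ordinal_trans[OF vb.d_ord \<xi> that] .
    have C\<eta>: "\<exists>b. ?C (F \<eta>) b \<and> (\<forall>u. H u (F \<eta>) \<longleftrightarrow> E u b)" if \<eta>: "E \<eta> \<xi>" for \<eta>
    proof -
      obtain b where b: "?C (F \<eta>) b" using C_ex F \<eta>\<delta>[OF \<eta>] mem.IH[OF \<eta>] by blast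
      have "H u (F \<eta>) \<longleftrightarrow> E u b" for u unfolding H_def using b C_fun C_S(1) by blast
      then show ?thesis using b by blast
    qed
    have sub: "E u (j X)" if u: "E u (F \<xi>)" for u
    proof -
      obtain \<eta> where "E \<eta> \<xi>" "H u (F \<eta>)" using u FmW[OF \<xi>] by blast
      then obtain b where "?C (F \<eta>) b" "E u b" using C\<eta> by blast
      then show ?thesis using C_S(1) N_small N_inter(1) by blast
    qed
    have "vb.sm (F \<xi>)"
    proof (rule vb.sm_Union[OF vb.sm_mem[OF \<xi>] vb.d_mem_in[OF \<xi>] F[OF \<xi>]])
      let ?R = "\<lambda>u \<eta>. \<exists>q\<in>Vb. maps_to E G \<eta> q \<and> (\<exists>b. E b (j S) \<and> (?C q b \<and> E u b))"
      have R: "?R u \<eta> \<longleftrightarrow> H u (F \<eta>)" if "E \<eta> \<xi>" for u \<eta>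
        unfolding G(3) H_def using F \<eta>\<delta>[OF that] by blast
      show "vb.def2 10 ?R"
        unfolding first_cover_def covers_def
        by (rule vb.def2I) (intro vb.dj_rules vb.trm_shift | simp add: jXVb h PvVb cVb G)+
      show "\<exists>x. E x \<xi> \<and> ?R u x" if "E u (F \<xi>)" for u
        using that FmW[OF \<xi>] R by blast
      fix \<eta> assume \<eta>: "E \<eta> \<xi>"
      obtain b where b: "?C (F \<eta>) b" "\<And>u. H u (F \<eta>) \<longleftrightarrow> E u b" using C\<eta>[OF \<eta>] by blast
      have "b \<in> Vb" "vb.sm b" using C_S(1)[OF b(1)] N_small vb.W_trans jXVb by blast+
      then show "\<exists>s\<in>Vb. vb.sm s \<and> (\<forall>u. E u (F \<xi>) \<longrightarrow> ?R u \<eta> \<longrightarrow> E u s)"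
        using R[OF \<eta>] b(2) by blast
    qed
    then show ?case using sub by blast
  qed
  have "\<exists>b. ?C (F \<xi>) b" if "E \<xi> \<delta>" for \<xi>
    using C_ex F[OF that] step[OF that] by blast
  then obtain Cf where Cf: "\<And>\<xi>. E \<xi> \<delta> \<Longrightarrow> ?C (F \<xi>) (Cf \<xi>)" by metis
  have Fmem: "E u (F \<xi>) \<longleftrightarrow> (\<exists>\<eta>. E \<eta> \<xi> \<and> E u (Cf \<eta>))" if \<xi>: "E \<xi> \<delta>" for \<xi> u
  proof -
    have "H u (F \<eta>) \<longleftrightarrow> E u (Cf \<eta>)" if "E \<eta> \<xi>" for \<eta>
    proof -
      have "?C (F \<eta>) (Cf \<eta>)" using Cf ordinal_trans[OF vb.d_ord \<xi> that] .
      then show ?thesis unfolding H_def using C_fun C_S(1) by blast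
    qed
    then show ?thesis using FmW[OF \<xi>] by blast
  qed
  have mono: "E u (F \<xi>')" if "E u (F \<xi>)" "E \<xi> \<xi>'" "E \<xi>' \<delta>" for u \<xi> \<xi>'
  proof -
    have "E \<xi> \<delta>" using ordinal_trans[OF vb.d_ord that(3,2)] .
    then show ?thesis
      using that Fmem ordinal_trans[OF vb.d_mem_ord[OF that(3)] that(2)] by blast
  qed
  have Cf_cover: "E (Cf \<xi>) (j S)"
    "\<exists>a. E a Pv \<and> (\<forall>x. E x (F \<xi>) \<longrightarrow> E x a) \<and> (\<forall>x. E x c \<longrightarrow> E x a) \<and> (\<forall>x. E x a \<longrightarrow> E x (Cf \<xi>))"
    if "E \<xi> \<delta>" for \<xi>
    using C_S[OF Cf[OF that]] unfolding covers_def by blast+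
  have "\<exists>B\<in>Vb. \<forall>u. E u B \<longleftrightarrow> E u (j X) \<and> (\<exists>\<xi>. E \<xi> \<delta> \<and> Fr u \<xi>)"
    by (rule vb.sep[OF _ jXVb(1)]) (intro vb.dj_rules vb.def2D[OF Fr2] | simp add: vb.d_in)+
  then obtain B where B: "B \<in> Vb" "\<And>u. E u B \<longleftrightarrow> E u (j X) \<and> (\<exists>\<xi>. E \<xi> \<delta> \<and> Fr u \<xi>)" by blast
  have B_iff: "E u B \<longleftrightarrow> (\<exists>\<xi>. E \<xi> \<delta> \<and> E u (F \<xi>))" for u
    unfolding B(2) using Fr_iff step by blast
  have Cf_B: "E u B" if \<xi>: "E \<xi> \<delta>" and u: "E u (Cf \<xi>)" for u \<xi>
  proof -
    obtain \<xi>' where "E \<xi>' \<delta>" "E \<xi> \<xi>'" using vb.d_limit[OF \<xi>] by blast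
    then show ?thesis using B_iff Fmem u by blast
  qed
  have "\<exists>i\<in>Vb. inj_into i B \<delta>"
  proof (rule vb.chain_injects[OF B(1) Fr2])
    show "Fr u \<xi>'" if "Fr u \<xi>" "E \<xi> \<xi>'" "E \<xi>' \<delta>" for u \<xi> \<xi>'
      using that mono Fr_iff ordinal_trans[OF vb.d_ord that(3,2)] by blast
    show "\<exists>\<xi>. E \<xi> \<delta> \<and> Fr u \<xi>" if "E u B" for u
      using that B(2) by blast
    show "\<exists>s\<in>Vb. vb.sm s \<and> (\<forall>u. E u B \<longrightarrow> Fr u \<xi> \<longrightarrow> E u s)" if "E \<xi> \<delta>" for \<xi>
      using step[OF that] F[OF that] Fr_iff[OF that] by blast
  qed
  then obtain i where i: "i \<in> Vb" "inj_into i B \<delta>" by blast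
  have absorb: "\<exists>\<gamma>. E \<gamma> \<delta> \<and> (\<forall>u. E u a \<longrightarrow> E u B \<longrightarrow> E u (F \<gamma>))" if a: "a \<in> Vb" "vb.sm a" for a
  proof -
    define R where "R u \<xi> \<longleftrightarrow> Fr u \<xi> \<and> (\<forall>\<eta>. E \<eta> \<xi> \<longrightarrow> \<not> Fr u \<eta>)" for u \<xi>
    have "vb.def2 30 R"
      unfolding R_def by (rule vb.def2I) (intro vb.dj_rules vb.def2D[OF Fr2] vb.trm_shift | simp)+
    moreover have "\<alpha> = \<alpha>'" if "E \<alpha> \<delta>" "E \<alpha>' \<delta>" "R x \<alpha>" "R x \<alpha>'" for x \<alpha> \<alpha>'
      using ordinal_linear[OF vb.d_ord that(1,2)] that unfolding R_def by blast
    ultimately obtain \<gamma> where g: "E \<gamma> \<delta>" "\<And>u \<xi>. E u a \<Longrightarrow> E \<xi> \<delta> \<Longrightarrow> R u \<xi> \<Longrightarrow> E \<xi> \<gamma>"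
      using vb.bounded[of R, OF _ a(2,1)] by blast
    have "E u (F \<gamma>)" if u: "E u a" "E u B" for u
    proof -
      obtain \<xi> where "E \<xi> \<delta> \<and> Fr u \<xi>" using u(2) B(2) by blast
      then obtain m where m: "E m \<delta> \<and> Fr u m" "\<And>y. E y m \<Longrightarrow> \<not> (E y \<delta> \<and> Fr u y)"
        using E_minimal[of "\<lambda>\<xi>. E \<xi> \<delta> \<and> Fr u \<xi>"] by blast
      then have "R u m" unfolding R_def using ordinal_trans[OF vb.d_ord] by blast
      then show ?thesis using g u(1) m(1) mono[of u m \<gamma>] Fr_iff by blast
    qed
    then show ?thesis using g(1) by blast
  qed
  have "B \<in> V"
  proof (rule approxI[OF B(1)])
    show "x \<in> V" if "E x B" for x using v.W_trans[OF jX_in] that B(2) by blast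
    fix a assume a: "a \<in> V" "v.sm a"
    have "a \<in> Vb" "vb.sm a" using a V_sub sm_up(1) by blast+
    then obtain \<gamma> where g: "E \<gamma> \<delta>" "\<And>u. E u a \<Longrightarrow> E u B \<Longrightarrow> E u (F \<gamma>)" using absorb by blast
    \<comment> \<open>From \<open>F \<gamma> \<subseteq> d \<subseteq> Cf \<gamma> \<subseteq>
      B\<close> with \<open>d\<close> in \<open>V\<close> it follows that \<open>d\<close> and
      \<open>B\<close> agree on \<open>a\<close>. On the side of \<open>N\<close> the set
      \<open>Cf \<gamma>\<close> plays the part of \<open>d\<close>.\<close>
    obtain d where d: "E d Pv" "\<And>x. E x (F \<gamma>) \<Longrightarrow> E x d" "\<And>x. E x d \<Longrightarrow> E x (Cf \<gamma>)"
      using Cf_cover(2)[OF g(1)] by blast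
    have dV: "d \<in> V" using d(1) Pv(2) by blast
    have "\<exists>z\<in>V. \<forall>u. E u z \<longleftrightarrow> E u d \<and> E u a"
      by (rule v.sep[OF _ dV]) (intro v.dj_rules | simp add: a)+
    then obtain z where z: "z \<in> V" "\<And>u. E u z \<longleftrightarrow> E u d \<and> E u a" by blast
    have "E u z \<longleftrightarrow> E u B \<and> E u a" for u
      using z(2)[of u] d(2,3)[of u] g(2)[of u] Cf_B[OF g(1), of u] by blast
    then show "\<exists>z\<in>V. \<forall>u. E u z \<longleftrightarrow> E u B \<and> E u a" using z(1) by blast
  qed
  moreover have "E B (j P)"
  proof (rule N_approx)
    show "B \<in> Nb" using Nb_small_in[OF B(1) _ i] B(2) jX_Nb by blast
    show "E z (j X)" if "E z B" for z using that B(2) by blast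
    fix a assume a: "E a (j S)"
    have "a \<in> Vb" "vb.sm a" "E a (j P)" using a N_small vb.W_trans[OF jXVb(2)] by blast+
    then obtain \<gamma> where g: "E \<gamma> \<delta>" "\<And>u. E u a \<Longrightarrow> E u B \<Longrightarrow> E u (F \<gamma>)" using absorb by blast
    have "E (Cf \<gamma>) (j P)" using Cf_cover(1)[OF g(1)] N_small by blast
    then obtain z where z: "E z (j P)" "\<And>u. E u z \<longleftrightarrow> E u (Cf \<gamma>) \<and> E u a"
      using N_inter(2) \<open>E a (j P)\<close> by blast
    have "E u z \<longleftrightarrow> E u B \<and> E u a" for u
      using z(2)[of u] Cf_cover(2)[OF g(1)] g(2)[of u] Cf_B[OF g(1), of u] by blast
    then show "\<exists>z. E z (j P) \<and> (\<forall>u. E u z \<longleftrightarrow> E u B \<and> E u a)" using z(1) by blast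
  qed
  moreover have "\<forall>x. E x c \<longrightarrow> E x B"
  proof -
    have "ext E \<delta> \<noteq> {}" using vb.d_inf by auto
    then obtain \<xi> where \<xi>: "E \<xi> \<delta>" by (auto simp: ext_def)
    show ?thesis using Cf_cover(2)[OF \<xi>] Cf_B[OF \<xi>] by blast
  qed
  ultimately show ?thesis using i by blast
qed

end

context lift
begin

lemma Nb_inter:
  assumes "A \<in> Nb" "B \<in> Nb"
  shows "\<exists>C\<in>Nb. \<forall>u. E u C \<longleftrightarrow> E u A \<and> E u B"
proof -
  have T: "dj E MN CJ 60 (\<lambda>b e. \<forall>A\<in>MN b. \<forall>B\<in>MN b. \<exists>C\<in>MN b. \<forall>u\<in>MN b. E u C \<longleftrightarrow> E u A \<and> E u B)"
    by (intro el.dj_rules | simp)+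
  have "\<forall>A\<in>Mb. \<forall>B\<in>Mb. \<exists>C\<in>Mb. \<forall>u\<in>Mb. E u C \<longleftrightarrow> E u A \<and> E u B"
  proof (intro ballI)
    fix A B assume AB: "A \<in> Mb" "B \<in> Mb"
    have "\<exists>C\<in>Mb. \<forall>u. E u C \<longleftrightarrow> E u A \<and> E u B"
      by (rule mb.sep[OF _ AB(1)]) (intro mb.dj_rules | simp add: AB)+
    then show "\<exists>C\<in>Mb. \<forall>u\<in>Mb. E u C \<longleftrightarrow> E u A \<and> E u B" by blast
  qed
  from bspec[OF bspec[OF elem[OF T, unfolded MN_simps, THEN iffD1, OF this] assms(1)] assms(2)]
  obtain C where C: "C \<in> Nb" "\<forall>u\<in>Nb. E u C \<longleftrightarrow> E u A \<and> E u B" by (elim bexE)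
  have "E u C \<longleftrightarrow> E u A \<and> E u B" for u
    using bspec[OF C(2), of u] Nb_trans[OF C(1), of u] Nb_trans[OF assms(1), of u] by blast
  then show ?thesis using C(1) by blast
qed

end

section \<open>Comparing subsets of a common cover\<close>

context block
begin

text \<open>In the source, \<open>collapse_image_iff\<close> for \<open>V\<close> is rephrased
  through membership in \<open>P\<close> and \<open>Pb\<close>, which are parameters that
  \<open>j\<close> can move. The equation \<open>j \<beta> = \<beta>\<close> lets the transferred
  statement speak of the same \<beta>.\<close>

lemma N_collapse_iff:
  assumes \<beta>: "\<beta> \<in> M" "j \<beta> = \<beta>" and Pb: "Pb \<in> M" "\<And>a. E a Pb \<longleftrightarrow> a \<in> M \<and> (\<forall>x. E x a \<longrightarrow> E x \<beta>)"
    and B: "E B (j P)" and \<rho>: "\<rho> \<in> Nb" "is_collapse (j \<theta>) B \<rho> \<beta>"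
    and A: "A \<in> Nb" "\<And>x. E x A \<Longrightarrow> E x B" and A0: "A0 \<in> Nb" "is_image \<rho> \<beta> A A0"
  shows "E A (j P) \<longleftrightarrow> E A0 (j Pb)"
proof -
  have Mb: "\<beta> \<in> Mb" "Pb \<in> Mb" using \<beta> Pb by (auto simp: M_iff)
  have T: "dj E MN CJ 60 (\<lambda>b e. \<forall>B. E B (cj P b) \<longrightarrow> (\<forall>\<rho>\<in>MN b. is_collapse (cj \<theta> b) B \<rho> (cj \<beta> b) \<longrightarrow>
    (\<forall>A\<in>MN b. (\<forall>x. E x A \<longrightarrow> E x B) \<longrightarrow> (\<forall>A0\<in>MN b. is_image \<rho> (cj \<beta> b) A A0 \<longrightarrow>
      (E A (cj P b) \<longleftrightarrow> E A0 (cj Pb b))))))"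
    by (intro el.dj_rules el.dj_collapse el.dj_image | simp add: cj_in in_Mb Mb)+
  have "\<forall>B. E B P \<longrightarrow> (\<forall>\<rho>\<in>Mb. is_collapse \<theta> B \<rho> \<beta> \<longrightarrow>
    (\<forall>A\<in>Mb. (\<forall>x. E x A \<longrightarrow> E x B) \<longrightarrow> (\<forall>A0\<in>Mb. is_image \<rho> \<beta> A A0 \<longrightarrow> (E A P \<longleftrightarrow> E A0 Pb))))"
  proof (intro allI ballI impI)
    fix B \<rho> A A0
    assume H: "E B P" "\<rho> \<in> Mb" "is_collapse \<theta> B \<rho> \<beta>" "A \<in> Mb" "\<forall>x. E x A \<longrightarrow> E x B"
      "A0 \<in> Mb" "is_image \<rho> \<beta> A A0"
    have V: "B \<in> V" "\<theta> \<in> V" "\<beta> \<in> V" using H(1) P(2) \<theta>(1) \<beta>(1) M_iff by blast+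
    have BX: "E x X" if "E x B" for x using H(1) P(2) that by blast
    have "A \<in> V \<longleftrightarrow> A0 \<in> V"
      by (rule v.collapse_image_iff[OF V(2) \<theta>(2) V(1,3) _ H(3) _ H(7)]) (use BX X(2) H(5) in blast)+
    moreover have "E A P \<longleftrightarrow> A \<in> V" using P(2) H(4,5) BX M_iff by blast
    moreover have "E A0 Pb \<longleftrightarrow> A0 \<in> V" using Pb(2) H(6) is_imageD[OF H(7)] M_iff by blast
    ultimately show "E A P \<longleftrightarrow> E A0 Pb" by blast
  qed
  from elem[OF T, unfolded cj_simps MN_simps \<beta>(2), THEN iffD1, OF this]
  show ?thesis using B \<rho> A A0 by blast
qed

text \<open>The image \<open>A0\<close> of \<open>A\<close> is a subset of an ordinal that injects
  into \<delta>, because \<open>B\<close> does. By \<open>short_ordinal\<close> it lies in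
  \<open>Mb\<close> and equals \<open>j A0\<close>, so membership of \<open>A0\<close> in
  \<open>Pb\<close> and in \<open>j Pb\<close> coincide; the two collapse equivalences connect these
  with \<open>A\<close>.\<close>

lemma common_subset_iff:
  assumes B: "B \<in> V" "E B (j P)" and i: "i \<in> Vb" "inj_into i B \<delta>"
    and A: "A \<in> Nb" "\<And>x. E x A \<Longrightarrow> E x B"
  shows "A \<in> V \<longleftrightarrow> E A (j P)"
proof -
  note iD = inj_intoD[OF i(2)]
  have BX: "E x (j X)" if "E x B" for x using N_inter(1)[OF B(2) that] .
  have B_sub: "\<exists>a. E a (j \<theta>) \<and> (\<exists>b. E b (j \<theta>) \<and> is_opair E p a b)" if "E p B" for p
    using BX[OF that] jX_iff by blast
  obtain \<rho> \<beta> where \<rho>: "\<rho> \<in> V" and \<beta>: "\<beta> \<in> V" "is_ordinal E \<beta>" and col: "is_collapse (j \<theta>) B \<rho> \<beta>"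
    and onto: "\<And>y. E y \<beta> \<Longrightarrow> \<exists>b. E b B \<and> maps_to E \<rho> b y"
    and func: "\<And>b y y'. maps_to E \<rho> b y \<Longrightarrow> maps_to E \<rho> b y' \<Longrightarrow> y = y'"
    using v.ex_collapse[OF j_theta(2,1) B(1) B_sub] by blast
  have inj: "b = b'" if "maps_to E \<rho> b y" "maps_to E \<rho> b' y" for b b' y
    by (rule v.collapse_inj[OF j_theta(2,1) B(1) B_sub col that])
  have Vb: "B \<in> Vb" "\<rho> \<in> Vb" "\<beta> \<in> Vb" "A \<in> Vb" using B \<rho> \<beta> A V_sub Nb_sub by blast+
  have "vb.def2 40 (\<lambda>y \<zeta>. \<exists>b. E b B \<and> (maps_to E \<rho> b y \<and> maps_to E i b \<zeta>))"
    by (rule vb.def2I) (intro vb.dj_rules vb.trm_shift | simp add: Vb i)+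
  from vb.ex_rel[OF this Vb(3) vb.d_in] obtain i' where i': "i' \<in> Vb"
    "\<And>p. E p i' \<Longrightarrow> \<exists>x y. E x \<beta> \<and> E y \<delta> \<and> is_opair E p x y"
    "\<And>y \<zeta>. maps_to E i' y \<zeta> \<longleftrightarrow> E y \<beta> \<and> E \<zeta> \<delta> \<and> (\<exists>b. E b B \<and> (maps_to E \<rho> b y \<and> maps_to E i b \<zeta>))"
    by blast
  have "is_function E i' \<beta> (ext E \<delta>)"
  proof (rule is_functionI)
    show "\<exists>x y. E x \<beta> \<and> y \<in> ext E \<delta> \<and> is_opair E p x y" if "E p i'" for p
      using i'(2)[OF that] by (simp add: ext_def)
    show "\<exists>\<zeta>. maps_to E i' y \<zeta>" if y: "E y \<beta>" for y
    proof -
      obtain b where b: "E b B" "maps_to E \<rho> b y" using onto[OF y] by blast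
      then show ?thesis using iD(4)[OF b(1)] y unfolding i'(3) by blast
    qed
    show "\<zeta> = \<zeta>'" if \<zeta>: "maps_to E i' y \<zeta>" "maps_to E i' y \<zeta>'" for y \<zeta> \<zeta>'
    proof -
      obtain b b' where b: "maps_to E \<rho> b y" "maps_to E i b \<zeta>" "maps_to E \<rho> b' y" "maps_to E i b' \<zeta>'"
        using \<zeta> unfolding i'(3) by blast
      then have "b = b'" using inj by blast
      then show ?thesis using b iD(2) by blast
    qed
  qed
  moreover have "y = y'" if \<zeta>: "maps_to E i' y \<zeta>" "maps_to E i' y' \<zeta>" for y y' \<zeta>
  proof -
    obtain b b' where b: "maps_to E \<rho> b y" "maps_to E i b \<zeta>" "maps_to E \<rho> b' y'" "maps_to E i b' \<zeta>"
      using \<zeta> unfolding i'(3) by blast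
    then have "b = b'" using iD(3) by blast
    then show ?thesis using b func by blast
  qed
  ultimately have "inj_into i' \<beta> \<delta>" unfolding inj_into_def by blast
  note short = short_ordinal[OF Vb(3) \<beta>(2) i'(1) this]
  have \<beta>M: "\<beta> \<in> M" using ords_M short(1) \<beta>(2) by blast
  obtain Pb where Pb: "Pb \<in> M" "\<And>a. E a Pb \<longleftrightarrow> a \<in> M \<and> (\<forall>x. E x a \<longrightarrow> E x \<beta>)"
    using m.ex_power[OF \<beta>M] by blast
  have \<rho>_pair: "\<exists>b. E b B \<and> (\<exists>y. E y \<beta> \<and> is_opair E p b y)" if "E p \<rho>" for p
    using col that unfolding is_collapse_def by blast
  \<comment> \<open>The collapse was computed in \<open>V\<close>. It reaches \<open>Nb\<close> by
    closure under \<delta>-sequences: \<rho> injects into \<delta> along with \<open>B\<close>, and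
    its pairs lie in \<open>Nb\<close> because \<open>j\<close> fixes every member of
    \<beta>.\<close>
  have "\<rho> \<in> Nb"
  proof -
    have "vb.def2 40 (\<lambda>p \<zeta>. \<exists>b. E b B \<and> (\<exists>y. E y \<beta> \<and> (is_opair E p b y \<and> maps_to E i b \<zeta>)))"
      by (rule vb.def2I) (intro vb.dj_rules vb.trm_shift | simp add: Vb i)+
    from vb.ex_rel[OF this Vb(2) vb.d_in] obtain k where k: "k \<in> Vb"
      "\<And>p. E p k \<Longrightarrow> \<exists>x y. E x \<rho> \<and> E y \<delta> \<and> is_opair E p x y"
      "\<And>p \<zeta>. maps_to E k p \<zeta> \<longleftrightarrow> E p \<rho> \<and> E \<zeta> \<delta> \<and>
        (\<exists>b. E b B \<and> (\<exists>y. E y \<beta> \<and> (is_opair E p b y \<and> maps_to E i b \<zeta>)))"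
      by blast
    have "is_function E k \<rho> (ext E \<delta>)"
    proof (rule is_functionI)
      show "\<exists>x y. E x \<rho> \<and> y \<in> ext E \<delta> \<and> is_opair E p x y" if "E p k" for p
        using k(2)[OF that] by (simp add: ext_def)
      show "\<exists>\<zeta>. maps_to E k p \<zeta>" if p: "E p \<rho>" for p
      proof -
        obtain b y where b: "E b B" "E y \<beta>" "is_opair E p b y" using \<rho>_pair[OF p] by blast
        then show ?thesis using iD(4)[OF b(1)] p unfolding k(3) by blast
      qed
      show "\<zeta> = \<zeta>'" if \<zeta>: "maps_to E k p \<zeta>" "maps_to E k p \<zeta>'" for p \<zeta> \<zeta>'
      proof -
        obtain b y b' y' where b: "is_opair E p b y" "maps_to E i b \<zeta>" "is_opair E p b' y'" "maps_to E i b' \<zeta>'"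
          using \<zeta> unfolding k(3) by blast
        then have "b = b'" using is_opair_inj by blast
        then show ?thesis using b iD(2) by blast
      qed
    qed
    moreover have "p = p'" if \<zeta>: "maps_to E k p \<zeta>" "maps_to E k p' \<zeta>" for p p' \<zeta>
    proof -
      obtain b y b' y' where b: "E p \<rho>" "is_opair E p b y" "maps_to E i b \<zeta>"
        "E p' \<rho>" "is_opair E p' b' y'" "maps_to E i b' \<zeta>"
        using \<zeta> unfolding k(3) by blast
      then have "b = b'" using iD(3) by blast
      moreover have "maps_to E \<rho> b y" "maps_to E \<rho> b' y'" using b maps_toI by blast+
      ultimately have "y = y'" using func by blast
      then show ?thesis using b \<open>b = b'\<close> is_opair_fun by blast
    qed
    ultimately have "inj_into k \<rho> \<delta>" unfolding inj_into_def by blast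
    moreover have "p \<in> Nb" if p: "E p \<rho>" for p
    proof -
      obtain b y where b: "E b B" "E y \<beta>" "is_opair E p b y" using \<rho>_pair[OF p] by blast
      have "y \<in> Nb" using j_in[of y] short(2)[OF b(2)] mb.W_trans[OF short(1) b(2)] by simp
      then show ?thesis using Nb_opair_in[OF _ _ b(3)] jX_Nb BX b(1) by blast
    qed
    ultimately show ?thesis using Nb_small_in[OF Vb(2) _ k(1)] by blast
  qed
  have "\<exists>A0\<in>Vb. \<forall>y. E y A0 \<longleftrightarrow> E y \<beta> \<and> (\<exists>b. E b A \<and> maps_to E \<rho> b y)"
    by (rule vb.sep[OF _ Vb(3)]) (intro vb.dj_rules | simp add: Vb)+
  then obtain A0 where A0: "A0 \<in> Vb" "\<And>y. E y A0 \<longleftrightarrow> E y \<beta> \<and> (\<exists>b. E b A \<and> maps_to E \<rho> b y)" by blast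
  have im: "is_image \<rho> \<beta> A A0" unfolding is_image_def using A0(2) by blast
  have A0M: "A0 \<in> Mb" "j A0 = A0" using short(4)[OF A0(1)] A0(2) by blast+
  then have A0N: "A0 \<in> Nb" using j_in by metis
  have "A \<in> V \<longleftrightarrow> A0 \<in> V"
    by (rule v.collapse_image_iff[OF j_theta(2,1) B(1) \<beta>(1) B_sub col A(2) im])
  also have "\<dots> \<longleftrightarrow> E A0 Pb" using Pb(2) A0M(1) A0(2) M_iff by blast
  also have "\<dots> \<longleftrightarrow> E A0 (j Pb)" using j_mem[OF A0M(1), of Pb] A0M(2) Pb(1) by (simp add: M_iff)
  also have "\<dots> \<longleftrightarrow> E A (j P)"
    using N_collapse_iff[OF \<beta>M short(3) Pb B(2) \<open>\<rho> \<in> Nb\<close> col A A0N im] by blast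
  finally show ?thesis .
qed

text \<open>Both directions are alike. A small \<open>a\<close> on the side to be reached has a
  superset \<open>B\<close> lying on both sides; the part of \<open>A\<close> in \<open>B\<close>
  changes sides by \<open>common_subset_iff\<close>, hence so does the part in \<open>a\<close>, and
  approximation on that side assembles \<open>A\<close>.\<close>

theorem square_subset_iff:
  assumes A: "A \<in> Nb" "\<And>x. E x A \<Longrightarrow> E x (j X)"
  shows "A \<in> V \<longleftrightarrow> E A (j P)"
proof
  assume AV: "A \<in> V"
  show "E A (j P)"
  proof (rule N_approx[OF A])
    fix a assume a: "E a (j S)"
    have aP: "E a (j P)" "vb.sm a" using N_small[OF a] by blast+
    have aVb: "a \<in> Vb" using a Nb_trans in_Nb Nb_sub by blast
    obtain B i where B: "B \<in> V" "E B (j P)" "\<And>x. E x a \<Longrightarrow> E x B" "i \<in> Vb" "inj_into i B \<delta>"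
      using common_cover[OF aVb N_inter(1)[OF aP(1)] aP(2)] by blast
    have BN: "B \<in> Nb" using Nb_trans[OF in_Nb(3) B(2)] .
    obtain C where C: "C \<in> Nb" "\<And>u. E u C \<longleftrightarrow> E u A \<and> E u B" using Nb_inter[OF A(1) BN] by blast
    have "\<exists>D\<in>V. \<forall>u. E u D \<longleftrightarrow> E u A \<and> E u B"
      by (rule v.sep[OF _ AV]) (intro v.dj_rules | simp add: B)+
    then obtain D where D: "D \<in> V" "\<And>u. E u D \<longleftrightarrow> E u A \<and> E u B" by blast
    have "C = D" by (rule E_ext) (simp add: C(2) D(2))
    then have "E C (j P)" using common_subset_iff[OF B(1,2,4,5) C(1)] C(2) D(1) by blast
    then obtain z where z: "E z (j P)" "\<forall>u. E u z \<longleftrightarrow> E u C \<and> E u a" using N_inter(2) aP(1) by blast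
    then show "\<exists>z. E z (j P) \<and> (\<forall>u. E u z \<longleftrightarrow> E u A \<and> E u a)" using C(2) B(3) by blast
  qed
next
  assume AP: "E A (j P)"
  have XV: "x \<in> V" if "E x (j X)" for x using v.W_trans[OF jX_in that] .
  show "A \<in> V"
  proof (rule approxI)
    show "A \<in> Vb" using A(1) Nb_sub by blast
    show "x \<in> V" if "E x A" for x using XV A(2)[OF that] .
    fix a assume a: "a \<in> V" "v.sm a"
    have "\<exists>b\<in>V. \<forall>x. E x b \<longleftrightarrow> E x a \<and> E x (j X)"
      by (rule v.sep[OF _ a(1)]) (intro v.dj_rules | simp add: jX_in)+
    then obtain b where b: "b \<in> V" "\<And>x. E x b \<longleftrightarrow> E x a \<and> E x (j X)" by blast
    have "v.sm b" by (rule v.sm_subset[OF a(2,1) b(1)]) (simp add: b(2))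
    then have bsm: "vb.sm b" "b \<in> Vb" using sm_up(1) b(1) V_sub by blast+
    obtain B i where B: "B \<in> V" "E B (j P)" "\<And>x. E x b \<Longrightarrow> E x B" "i \<in> Vb" "inj_into i B \<delta>"
      using common_cover[OF bsm(2) _ bsm(1)] b(2) by blast
    obtain C where C: "E C (j P)" "\<And>u. E u C \<longleftrightarrow> E u A \<and> E u B" using N_inter(2)[OF AP B(2)] by blast
    have "C \<in> Nb" using Nb_trans[OF in_Nb(3) C(1)] .
    then have CV: "C \<in> V" using common_subset_iff[OF B(1,2,4,5)] C by blast
    have "\<exists>z\<in>V. \<forall>u. E u z \<longleftrightarrow> E u C \<and> E u a"
      by (rule v.sep[OF _ CV]) (intro v.dj_rules | simp add: a)+
    then obtain z where z: "z \<in> V" "\<And>u. E u z \<longleftrightarrow> E u C \<and> E u a" by blast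
    have "E u z \<longleftrightarrow> E u A \<and> E u a" for u
      using z(2)[of u] C(2)[of u] B(3)[of u] b(2)[of u] A(2)[of u] by blast
    then show "\<exists>z\<in>V. \<forall>u. E u z \<longleftrightarrow> E u A \<and> E u a" using z(1) by blast
  qed
qed

end

section \<open>The restricted embedding\<close>

context lift
begin

lemma ex_block:
  assumes "\<theta> \<in> M" "is_ordinal E \<theta>"
  shows "\<exists>X P S. block E V Vb M Mb N Nb j \<delta> \<kappa> \<theta> X P S"
proof -
  obtain X where X: "X \<in> M" "\<And>p. E p X \<longleftrightarrow> (\<exists>a. E a \<theta> \<and> (\<exists>b. E b \<theta> \<and> is_opair E p a b))"
    using m.ex_prod[OF assms(1,1)] by blast
  obtain P where P: "P \<in> M" "\<And>a. E a P \<longleftrightarrow> a \<in> M \<and> (\<forall>x. E x a \<longrightarrow> E x X)"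
    using m.ex_power[OF X(1)] by blast
  have "\<exists>S\<in>M. \<forall>a. E a S \<longleftrightarrow> E a P \<and> m.sm a"
    unfolding m.sm_def by (rule m.sep[OF _ P(1)]) (intro m.dj_rules | simp add: m.d_in)+
  then obtain S where S: "S \<in> M" "\<And>a. E a S \<longleftrightarrow> E a P \<and> m.sm a" by blast
  have "block E V Vb M Mb N Nb j \<delta> \<kappa> \<theta> X P S"
    by unfold_locales (fact assms X P S)+
  then show ?thesis by blast
qed

text \<open>Membership on a transitive set containing \<open>x\<close> is copied to a relation
  \<open>R\<close> on an ordinal. By \<open>square_subset_iff\<close> the relation
  \<open>j R\<close> lies in \<open>V\<close>, and its Mostowski collapse, computed in
  \<open>V\<close>, has the values of \<open>j k\<close>, among which is \<open>j x\<close>.\<close>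

lemma j_in_V:
  assumes x: "x \<in> M"
  shows "j x \<in> V"
proof -
  \<comment> \<open>The closure given by \<open>is_tc\<close> contains the members of its argument
    but not the argument, so the singleton is used to have \<open>x\<close> itself in
    \<open>t\<close>.\<close>
  obtain x1 where x1: "x1 \<in> M" "\<And>z. E z x1 \<longleftrightarrow> z = x" using m.ex_singleton[OF x] by blast
  obtain t where t: "t \<in> M" "m.is_tc x1 t" using m.ex_tc[OF x1(1)] by blast
  have xt: "E x t" using m.is_tcD(1)[OF t(2)] x1(2) by blast
  obtain \<theta> k where k: "\<theta> \<in> M" "k \<in> M" "is_ordinal E \<theta>" "is_bijection E k \<theta> t"
    using m.well_ordering[OF t(1)] by blast
  note kD = is_bijectionD[OF k(4)]
  have "m.def2 40 (\<lambda>\<xi> \<eta>. \<exists>u. E u t \<and> (\<exists>v. E v t \<and> (E u v \<and> maps_to E k \<xi> u \<and> maps_to E k \<eta> v)))"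
    by (rule m.def2I) (intro m.dj_rules m.trm_shift | simp add: k t)+
  from m.ex_rel[OF this k(1,1)] obtain R where R: "R \<in> M"
    "\<And>p. E p R \<Longrightarrow> \<exists>x y. E x \<theta> \<and> E y \<theta> \<and> is_opair E p x y"
    "\<And>\<xi> \<eta>. maps_to E R \<xi> \<eta> \<longleftrightarrow> E \<xi> \<theta> \<and> E \<eta> \<theta> \<and>
       (\<exists>u. E u t \<and> (\<exists>v. E v t \<and> (E u v \<and> maps_to E k \<xi> u \<and> maps_to E k \<eta> v)))" by blast
  obtain X P S where "block E V Vb M Mb N Nb j \<delta> \<kappa> \<theta> X P S" using ex_block[OF k(1,3)] by blast
  then interpret b: block E V Vb M Mb N Nb j \<delta> \<kappa> \<theta> X P S .
  have Mb: "x \<in> Mb" "t \<in> Mb" "k \<in> Mb" "\<theta> \<in> Mb" "R \<in> Mb" "P \<in> Mb"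
    using x t k R b.P by (auto simp: M_iff)
  have "E R P" using b.P(2) b.X(2) R(1,2) by blast
  then have jRP: "E (j R) (j P)" using j_mem Mb by blast
  then have jRV: "j R \<in> V" using b.square_subset_iff[OF j_in[OF Mb(5)]] b.N_inter(1) by blast
  have jk: "is_bijection E (j k) (j \<theta>) (j t)" using j_bijection Mb k(4) by blast
  note jkD = is_bijectionD[OF jk]
  have T1: "dj E MN CJ 60 (\<lambda>b e. \<forall>u. E u (cj t b) \<longrightarrow> (\<forall>v. E v u \<longrightarrow> E v (cj t b)))"
    by (intro el.dj_rules | simp add: cj_in Mb)+
  have "\<forall>u. E u t \<longrightarrow> (\<forall>v. E v u \<longrightarrow> E v t)" using m.is_tcD(2)[OF t(2)] by blast
  from elem[OF T1, unfolded cj_simps, THEN iffD1, OF this]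
  have jt: "E v (j t)" if "E u (j t)" "E v u" for u v using that by blast
  have T2: "dj E MN CJ 60 (\<lambda>b e. \<forall>\<xi>. E \<xi> (cj \<theta> b) \<longrightarrow> (\<forall>\<eta>. E \<eta> (cj \<theta> b) \<longrightarrow> (maps_to E (cj R b) \<xi> \<eta> \<longleftrightarrow>
    (\<exists>u. E u (cj t b) \<and> (\<exists>v. E v (cj t b) \<and> (E u v \<and> maps_to E (cj k b) \<xi> u \<and> maps_to E (cj k b) \<eta> v))))))"
    by (intro el.dj_rules | simp add: cj_in Mb)+
  have "\<forall>\<xi>. E \<xi> \<theta> \<longrightarrow> (\<forall>\<eta>. E \<eta> \<theta> \<longrightarrow> (maps_to E R \<xi> \<eta> \<longleftrightarrow>
    (\<exists>u. E u t \<and> (\<exists>v. E v t \<and> (E u v \<and> maps_to E k \<xi> u \<and> maps_to E k \<eta> v)))))"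
    by (simp add: R(3))
  from elem[OF T2, unfolded cj_simps, THEN iffD1, OF this]
  have jR: "maps_to E (j R) \<xi> \<eta> \<longleftrightarrow>
    (\<exists>u. E u (j t) \<and> (\<exists>v. E v (j t) \<and> (E u v \<and> maps_to E (j k) \<xi> u \<and> maps_to E (j k) \<eta> v)))"
    if "E \<xi> (j \<theta>)" "E \<eta> (j \<theta>)" for \<xi> \<eta> using that by simp
  define inv where "inv \<xi> = (THE u. maps_to E (j k) \<xi> u)" for \<xi>
  have inv: "inv \<xi> = u" if "maps_to E (j k) \<xi> u" for \<xi> u
    unfolding inv_def using that jkD(2) by blast
  have wf: "wfp (\<lambda>\<xi> \<eta>. E \<xi> (j \<theta>) \<and> E \<eta> (j \<theta>) \<and> maps_to E (j R) \<xi> \<eta>)"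
  proof -
    have "wf (inv_image {(x, y). E x y} inv)" using E_wf by (intro wf_inv_image) (simp add: wfp_def)
    then show ?thesis
      unfolding wfp_def by (rule wf_subset) (auto simp: jR inv)
  qed
  have r2: "v.def2 20 (maps_to E (j R))"
    by (rule v.def2I) (intro v.dj_rules | simp add: jRV)+
  have H2: "v.def2 20 (=)" by (rule v.def2I) (intro v.dj_rules)
  have Hs: "\<exists>h\<in>V. \<forall>v\<in>V. E v h \<longleftrightarrow> v = q" if "q \<in> V" for q
    using v.ex_singleton[OF that] by blast
  obtain g G where "G \<in> V" and g: "\<And>x. E x (j \<theta>) \<Longrightarrow> g x \<in> V"
    and gm: "\<And>x v. E x (j \<theta>) \<Longrightarrow> v \<in> V \<Longrightarrow> E v (g x) \<longleftrightarrow> (\<exists>z. E z (j \<theta>) \<and> maps_to E (j R) z x \<and> v = g z)"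
    using v.recursion[OF b.j_theta(2) wf r2 H2 Hs] by (smt (verit))
  have val: "maps_to E (j k) \<xi> u \<Longrightarrow> g \<xi> = u" for \<xi> u
  proof (induction u arbitrary: \<xi> rule: E_induct)
    case (mem u)
    have u: "E \<xi> (j \<theta>)" "E u (j t)" using jkD(1)[OF mem.prems] by blast+
    show ?case
    proof (rule E_ext)
      fix v
      show "E v (g \<xi>) \<longleftrightarrow> E v u"
      proof
        assume v: "E v (g \<xi>)"
        then obtain \<eta> where \<eta>: "E \<eta> (j \<theta>)" "maps_to E (j R) \<eta> \<xi>" "v = g \<eta>"
          using gm[OF u(1)] v.W_trans[OF g[OF u(1)] v] by blast
        then obtain a c where ac: "E a c" "maps_to E (j k) \<eta> a" "maps_to E (j k) \<xi> c"
          using jR[OF \<eta>(1) u(1)] by blast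
        then have "c = u" using jkD(2) mem.prems by blast
        then show "E v u" using mem.IH[of a \<eta>] ac \<eta>(3) by simp
      next
        assume v: "E v u"
        then have vt: "E v (j t)" using jt u(2) by blast
        then obtain \<eta> where \<eta>: "maps_to E (j k) \<eta> v" using jkD(5) by blast
        then have \<eta>\<theta>: "E \<eta> (j \<theta>)" using jkD(1) by blast
        have "maps_to E (j R) \<eta> \<xi>" using jR[OF \<eta>\<theta> u(1)] vt u(2) v \<eta> mem.prems by blast
        moreover have "g \<eta> = v" by (rule mem.IH[OF v \<eta>])
        ultimately show "E v (g \<xi>)" using gm[OF u(1), of v] g[OF \<eta>\<theta>] \<eta>\<theta> by blast
      qed
    qed
  qed
  have "E (j x) (j t)" using j_mem Mb xt by blast
  then obtain \<xi> where \<xi>: "maps_to E (j k) \<xi> (j x)" using jkD(5) by blast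
  then show ?thesis using val[OF \<xi>] g jkD(1)[OF \<xi>] by metis
qed

lemma j_image_in: "x \<in> M \<Longrightarrow> j x \<in> N"
proof -
  assume x: "x \<in> M"
  obtain s where s: "s \<in> M" "\<And>z. E z s \<longleftrightarrow> z = x" using m.ex_singleton[OF x] by blast
  then have "E (j x) (j s)" using j_mem[of x s] x by (simp add: M_iff)
  then show ?thesis using s(1) N_iff by blast
qed

lemma N_sub: "N \<subseteq> V" "N \<subseteq> Nb"
proof -
  show "N \<subseteq> V" using v.W_trans j_in_V N_iff by blast
  have "j x \<in> Nb" if "x \<in> M" for x using that j_in M_iff by blast
  then show "N \<subseteq> Nb" using Nb_trans N_iff by blast
qed

lemma M_trace:
  assumes "x \<in> Mb"
  shows "\<exists>z\<in>M. \<forall>u. E u x \<longrightarrow> u \<in> M \<longrightarrow> E u z"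
  by (rule bounded_trace[OF m.mst_axioms mb.mst_axioms _ ords_M assms]) (auto simp: M_iff)

text \<open>By membership induction \<open>y\<close> is included in \<open>N\<close>; the point is
  to find one \<open>z\<close> in \<open>M\<close> with \<open>y\<close> included in
  \<open>j z\<close>. Cofinality yields only some \<open>x\<close> in \<open>Mb\<close>, and
  \<open>M_trace\<close> turns the part of its union inside \<open>M\<close> into such a
  \<open>z\<close>. A subset of \<open>j z\<close> is then moved to an ordinal along
  \<open>j k\<close>, where \<open>square_subset_iff\<close> decides it.\<close>

lemma N_eq: "y \<in> Nb \<Longrightarrow> y \<in> V \<Longrightarrow> y \<in> N"
proof (induction y rule: E_induct)
  case (mem y)
  have sub: "u \<in> N" if "E u y" for u
    using mem.IH[OF that] Nb_trans[OF mem.prems(1) that] v.W_trans[OF mem.prems(2) that] by blast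
  obtain x where x: "x \<in> Mb" "E y (j x)" using cofinal mem.prems(1) unfolding cofinal_map_def by blast
  obtain ux where ux: "ux \<in> Mb" "\<And>z. E z ux \<longleftrightarrow> (\<exists>y. E y x \<and> E z y)" using mb.ex_union[OF x(1)] by blast
  obtain z where z: "z \<in> M" "\<And>u. E u ux \<Longrightarrow> u \<in> M \<Longrightarrow> E u z" using M_trace[OF ux(1)] by blast
  have zMb: "z \<in> Mb" using z(1) M_iff by blast
  have y_ux: "E u (j ux)" if u: "E u y" for u
  proof -
    have T: "dj E MN CJ 60 (\<lambda>b e. \<forall>y. E y (cj x b) \<longrightarrow> (\<forall>u. E u y \<longrightarrow> E u (cj ux b)))"
      by (intro el.dj_rules | simp add: cj_in x ux)+
    have "\<forall>y. E y x \<longrightarrow> (\<forall>u. E u y \<longrightarrow> E u ux)" using ux(2) by blast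
    from elem[OF T, unfolded cj_simps, THEN iffD1, OF this] show ?thesis using x(2) u by blast
  qed
  \<comment> \<open>All members of \<open>n\<close> belong to \<open>M\<close>, so those that are in
    \<open>ux\<close> are in \<open>z\<close>; this inclusion is bounded and transfers.\<close>
  have yz: "E u (j z)" if u: "E u y" for u
  proof -
    obtain n where n: "n \<in> M" "E u (j n)" using sub[OF u] N_iff by blast
    have nMb: "n \<in> Mb" using n(1) M_iff by blast
    have T: "dj E MN CJ 60 (\<lambda>b e. \<forall>u. E u (cj n b) \<longrightarrow> E u (cj ux b) \<longrightarrow> E u (cj z b))"
      by (intro el.dj_rules | simp add: cj_in nMb ux zMb)+
    have "\<forall>u. E u n \<longrightarrow> E u ux \<longrightarrow> E u z" using z(2) m.W_trans[OF n(1)] by blast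
    from elem[OF T, unfolded cj_simps, THEN iffD1, OF this] show ?thesis using n(2) y_ux[OF u] by blast
  qed
  obtain l k where k: "l \<in> M" "k \<in> M" "is_ordinal E l" "is_bijection E k l z"
    using m.well_ordering[OF z(1)] by blast
  note kD = is_bijectionD[OF k(4)]
  obtain X P S where "block E V Vb M Mb N Nb j \<delta> \<kappa> l X P S" using ex_block[OF k(1,3)] by blast
  then interpret b: block E V Vb M Mb N Nb j \<delta> \<kappa> l X P S .
  obtain Pz where Pz: "Pz \<in> M" "\<And>a. E a Pz \<longleftrightarrow> a \<in> M \<and> (\<forall>x. E x a \<longrightarrow> E x z)"
    using m.ex_power[OF z(1)] by blast
  have Mb: "l \<in> Mb" "k \<in> Mb" "Pz \<in> Mb" "X \<in> Mb" "P \<in> Mb"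
    using k Pz b.in_Mb by (auto simp: M_iff)
  have jkV: "j k \<in> V" "j l \<in> V" using j_in_V k by blast+
  have jk: "is_bijection E (j k) (j l) (j z)" using j_bijection Mb zMb k(4) by blast
  note jkD = is_bijectionD[OF jk]
  \<comment> \<open>The subset of \<open>j l\<close> that corresponds to \<open>y\<close> is placed
    on the diagonal of \<open>j X\<close>, since \<open>square_subset_iff\<close> speaks of sets of
    pairs. All the data are in \<open>V\<close> and in \<open>Nb\<close>, and both compute the same
    code \<open>A\<close>.\<close>
  let ?D = "\<lambda>p y. \<exists>a. E a (j l) \<and> (is_opair E p a a \<and> (\<exists>u. E u y \<and> maps_to E (j k) a u))"
  have "\<exists>A\<in>V. \<forall>p. E p A \<longleftrightarrow> E p (j X) \<and> ?D p y"
    by (rule v.sep[OF _ b.jX_in]) (intro v.dj_rules | simp add: jkV mem.prems)+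
  then obtain A where A: "A \<in> V" "\<And>p. E p A \<longleftrightarrow> E p (j X) \<and> ?D p y" by blast
  have "A \<in> Nb"
  proof -
    have T: "dj E MN CJ 60 (\<lambda>b e. \<forall>y\<in>MN b. \<exists>A\<in>MN b. \<forall>p\<in>MN b. E p A \<longleftrightarrow> E p (cj X b) \<and>
      (\<exists>a. E a (cj l b) \<and> (is_opair E p a a \<and> (\<exists>u. E u y \<and> maps_to E (cj k b) a u))))"
      by (intro el.dj_rules | simp add: cj_in Mb)+
    have "\<forall>y\<in>Mb. \<exists>A\<in>Mb. \<forall>p\<in>Mb. E p A \<longleftrightarrow> E p X \<and>
      (\<exists>a. E a l \<and> (is_opair E p a a \<and> (\<exists>u. E u y \<and> maps_to E k a u)))"
    proof
      fix y assume y: "y \<in> Mb"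
      have "\<exists>A\<in>Mb. \<forall>p. E p A \<longleftrightarrow> E p X \<and>
        (\<exists>a. E a l \<and> (is_opair E p a a \<and> (\<exists>u. E u y \<and> maps_to E k a u)))"
        by (rule mb.sep[OF _ Mb(4)]) (intro mb.dj_rules | simp add: y Mb)+
      then show "\<exists>A\<in>Mb. \<forall>p\<in>Mb. E p A \<longleftrightarrow> E p X \<and>
        (\<exists>a. E a l \<and> (is_opair E p a a \<and> (\<exists>u. E u y \<and> maps_to E k a u)))" by blast
    qed
    from bspec[OF elem[OF T, unfolded cj_simps MN_simps, THEN iffD1, OF this] mem.prems(1)]
    obtain A' where A': "A' \<in> Nb" "\<forall>p\<in>Nb. E p A' \<longleftrightarrow> E p (j X) \<and> ?D p y" by (elim bexE)
    have "A' = A"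
    proof (rule E_ext)
      fix p show "E p A' \<longleftrightarrow> E p A"
        using bspec[OF A'(2), of p] Nb_trans[OF A'(1), of p] b.jX_Nb[of p] A(2)[of p] by blast
    qed
    then show ?thesis using A'(1) by simp
  qed
  then have AP: "E A (j P)" using b.square_subset_iff A by blast
  \<comment> \<open>In the source every member of \<open>P\<close>, read on the diagonal, decodes to
    a member of \<open>Pz\<close>. The transferred statement, applied to \<open>A\<close>, puts
    \<open>y\<close> into \<open>j Pz\<close> and hence into \<open>N\<close>.\<close>
  have T: "dj E MN CJ 60 (\<lambda>b e. \<forall>A. E A (cj P b) \<longrightarrow> (\<exists>y. E y (cj Pz b) \<and> ((\<forall>v. E v y \<longrightarrow> E v (cj z b)) \<and>
     (\<forall>v. E v (cj z b) \<longrightarrow> (E v y \<longleftrightarrow> (\<exists>a. E a (cj l b) \<and> (maps_to E (cj k b) a v \<and> (\<exists>p. E p A \<and> is_opair E p a a))))))))"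
    by (intro el.dj_rules | simp add: cj_in Mb zMb)+
  have "\<forall>A. E A P \<longrightarrow> (\<exists>y. E y Pz \<and> ((\<forall>v. E v y \<longrightarrow> E v z) \<and>
     (\<forall>v. E v z \<longrightarrow> (E v y \<longleftrightarrow> (\<exists>a. E a l \<and> (maps_to E k a v \<and> (\<exists>p. E p A \<and> is_opair E p a a)))))))"
  proof (intro allI impI)
    fix A assume "E A P"
    then have A: "A \<in> M" using b.P(2) by blast
    have "\<exists>y\<in>M. \<forall>v. E v y \<longleftrightarrow> E v z \<and> (\<exists>a. E a l \<and> (maps_to E k a v \<and> (\<exists>p. E p A \<and> is_opair E p a a)))"
      by (rule m.sep[OF _ z(1)]) (intro m.dj_rules | simp add: A k)+
    then obtain y where y: "y \<in> M"
      "\<And>v. E v y \<longleftrightarrow> E v z \<and> (\<exists>a. E a l \<and> (maps_to E k a v \<and> (\<exists>p. E p A \<and> is_opair E p a a)))" by blast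
    then have "E y Pz" using Pz(2) by blast
    then show "\<exists>y. E y Pz \<and> ((\<forall>v. E v y \<longrightarrow> E v z) \<and>
     (\<forall>v. E v z \<longrightarrow> (E v y \<longleftrightarrow> (\<exists>a. E a l \<and> (maps_to E k a v \<and> (\<exists>p. E p A \<and> is_opair E p a a))))))"
      by (intro exI[of _ y]) (simp add: y(2))
  qed
  from mp[OF spec[OF elem[OF T, unfolded cj_simps, THEN iffD1, OF this]] AP]
  obtain y' where y': "E y' (j Pz)" "\<forall>v. E v y' \<longrightarrow> E v (j z)"
    "\<forall>v. E v (j z) \<longrightarrow> (E v y' \<longleftrightarrow> (\<exists>a. E a (j l) \<and> (maps_to E (j k) a v \<and> (\<exists>p. E p A \<and> is_opair E p a a))))"
    by (elim exE conjE)
  have "y' = y"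
  proof (rule E_ext)
    fix v
    show "E v y' \<longleftrightarrow> E v y"
    proof
      assume v: "E v y'"
      then obtain a p where a: "E a (j l)" "maps_to E (j k) a v" "E p A" "is_opair E p a a" using y' by blast
      obtain a' u where a': "is_opair E p a' a'" "E u y" "maps_to E (j k) a' u" using A(2) a(3) by blast
      have "a' = a" using is_opair_inj[OF a'(1) a(4)] by simp
      then have "u = v" using jkD(2) a'(3) a(2) by blast
      then show "E v y" using a'(2) by simp
    next
      assume v: "E v y"
      have vz: "E v (j z)" using yz[OF v] .
      then obtain a where a: "maps_to E (j k) a v" using jkD(5) by blast
      then have al: "E a (j l)" using jkD(1) by blast
      have "a \<in> V" using v.W_trans[OF jkV(2) al] .
      then obtain p where p: "is_opair E p a a" using v.ex_opair by blast
      then have "E p (j X)" using b.jX_iff al by blast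
      then have "E p A" using A(2) al p v a by blast
      then show "E v y'" using y'(3) vz al a p by blast
    qed
  qed
  then show ?case using y'(1) Pz(1) N_iff by blast
qed

section \<open>Pieces of \<open>M\<close> and of the graph of \<open>j\<close>\<close>

text \<open>Closure under short sequences puts \<open>d\<close> into \<open>Mb\<close>, and
  \<open>M_trace\<close> bounds it by some \<open>z\<close> in \<open>M\<close>. Since all members
  of \<open>z\<close> are in \<open>M\<close>, the set \<open>d\<close> is the intersection of
  \<open>a\<close> and \<open>z\<close>, which \<open>V\<close> can form.\<close>

lemma M_small_trace:
  assumes a: "a \<in> V" "v.sm a" and d: "d \<in> Vb" "\<And>u. E u d \<longleftrightarrow> u \<in> M \<and> E u a"
  shows "d \<in> M \<and> m.sm d"
proof -
  have "a \<in> Vb" "vb.sm a" using a V_sub sm_up(1) by blast+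
  then have "vb.sm d" using vb.sm_subset d by blast
  then have "d \<in> Mb" using Mb_small_in d(2) M_iff by blast
  then obtain z where z: "z \<in> M" "\<And>u. E u d \<Longrightarrow> u \<in> M \<Longrightarrow> E u z" using M_trace by blast
  have zV: "z \<in> V" using z(1) M_iff by blast
  have "\<exists>c\<in>V. \<forall>u. E u c \<longleftrightarrow> E u a \<and> E u z"
    by (rule v.sep[OF _ a(1)]) (intro v.dj_rules | simp add: zV)+
  then obtain c where c: "c \<in> V" "\<And>u. E u c \<longleftrightarrow> E u a \<and> E u z" by blast
  have "c = d"
  proof (rule E_ext)
    fix u show "E u c \<longleftrightarrow> E u d"
      using c(2)[of u] d(2)[of u] z(2)[of u] m.W_trans[OF z(1), of u] by blast
  qed
  then have dV: "d \<in> V" using c(1) by simp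
  have "v.sm d" by (rule v.sm_subset[OF a(2,1) dV]) (simp add: d(2))
  then show ?thesis using M_small_in[OF dV] d(2) M_iff by blast
qed

text \<open>\<open>bounded_trace\<close> encloses \<open>M\<close> in a set of \<open>V\<close>, so
  separation makes it a set of \<open>Vb\<close>; its small pieces lie in \<open>V\<close> by
  \<open>M_small_trace\<close>, and approximation applies.\<close>

lemma M_set:
  assumes "is_set_in E Vb Mb"
  shows "is_set_in E V M"
proof -
  obtain mm where mm: "mm \<in> Vb" "\<And>u. E u mm \<longleftrightarrow> u \<in> Mb"
    using assms by (auto simp: is_set_in_def ext_def)
  obtain z where z: "z \<in> V" "\<And>u. E u mm \<Longrightarrow> u \<in> V \<Longrightarrow> E u z"
    using bounded_trace[OF v.mst_axioms vb.mst_axioms V_sub ords_V mm(1)] by blast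
  have zVb: "z \<in> Vb" using z(1) V_sub by blast
  have "\<exists>n\<in>Vb. \<forall>u. E u n \<longleftrightarrow> E u z \<and> E u mm"
    by (rule vb.sep[OF _ zVb]) (intro vb.dj_rules | simp add: mm)+
  then obtain n where n: "n \<in> Vb" "\<And>u. E u n \<longleftrightarrow> E u z \<and> E u mm" by blast
  have n_iff: "E u n \<longleftrightarrow> u \<in> M" for u
    using n(2)[of u] mm(2)[of u] z(2)[of u] v.W_trans[OF z(1), of u] M_iff by blast
  have "n \<in> V"
  proof (rule approxI[OF n(1)])
    show "x \<in> V" if "E x n" for x using that n_iff M_iff by blast
    fix a assume a: "a \<in> V" "v.sm a"
    have aVb: "a \<in> Vb" using a V_sub by blast
    have "\<exists>d\<in>Vb. \<forall>u. E u d \<longleftrightarrow> E u n \<and> E u a"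
      by (rule vb.sep[OF _ n(1)]) (intro vb.dj_rules | simp add: aVb)+
    then obtain d where d: "d \<in> Vb" "\<And>u. E u d \<longleftrightarrow> E u n \<and> E u a" by blast
    have "d \<in> M" using M_small_trace[OF a d(1)] d(2) n_iff by blast
    then show "\<exists>z\<in>V. \<forall>u. E u z \<longleftrightarrow> E u n \<and> E u a" using d(2) M_iff by blast
  qed
  then show ?thesis using n_iff by (auto simp: is_set_in_def ext_def)
qed

text \<open>
  A small piece of the graph is recovered from an enumeration \<open>k\<close> of its domain, since
  \<open>j k\<close> enumerates the values along the same ordinal below \<open>\<delta>\<close>.
\<close>

lemma graph_small_piece:
  assumes b: "b \<in> V" "v.sm b"
    and dom: "\<And>e. e \<in> V \<Longrightarrow> \<exists>d\<in>Vb. \<forall>u. E u d \<longleftrightarrow> u \<in> M \<and> E u e"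
  shows "\<exists>g\<in>V. \<forall>p. E p g \<longleftrightarrow> E p b \<and> p \<in> graph_on E j M"
proof -
  obtain e where e: "e \<in> V" "\<And>x. E x e \<longleftrightarrow> (\<exists>y. maps_to E b x y)" using v.ex_dom[OF b(1)] by blast
  have "v.sm e"
  proof (rule v.sm_image[OF b(2,1) e(1)])
    show "v.def2 20 (\<lambda>p x. \<exists>y\<in>V. is_opair E p x y)"
      by (rule v.def2I) (intro v.dj_rules v.trm_shift | simp)+
    show "\<exists>p. E p b \<and> (\<exists>y\<in>V. is_opair E p x y)" if "E x e" for x
      using that e(2) v.maps_to_in[OF _ b(1)] unfolding maps_to_def by blast
  qed (use is_opair_inj in blast)
  \<comment> \<open>The part of the domain inside \<open>M\<close> is at first known only as a set
    of \<open>Vb\<close>; being small, it lies in \<open>M\<close> and has an enumeration there to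
    which \<open>j\<close> applies.\<close>
  obtain d where d: "d \<in> Vb" "\<And>u. E u d \<longleftrightarrow> u \<in> M \<and> E u e" using dom[OF e(1)] by blast
  have dM: "d \<in> M" "m.sm d" using M_small_trace[OF e(1) \<open>v.sm e\<close> d] by blast+
  obtain \<xi> k where k: "E \<xi> \<delta>" "k \<in> M" "is_bijection E k \<xi> d" using dM(2) unfolding m.sm_def by blast
  note kD = is_bijectionD[OF k(3)]
  have V: "d \<in> V" "k \<in> V" "j k \<in> V" "\<xi> \<in> V" using dM k j_in_V v.d_mem_in M_iff by blast+
  have Mb: "k \<in> Mb" "d \<in> Mb" "\<xi> \<in> Mb" using k dM mb.d_mem_in M_iff by blast+
  have jk: "is_bijection E (j k) (j \<xi>) (j d)" using j_bijection Mb k(3) by blast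
  have jk_val: "maps_to E (j k) \<zeta> (j x)" if m: "maps_to E k \<zeta> x" for \<zeta> x
  proof -
    have \<zeta>: "E \<zeta> \<xi>" "E x d" using kD(1)[OF m] by blast+
    then have "E \<zeta> \<delta>" using ordinal_trans[OF vb.d_ord k(1)] by blast
    moreover have "x \<in> Mb" "\<zeta> \<in> Mb" using mb.W_trans Mb \<zeta> by blast+
    ultimately show ?thesis using j_maps[OF Mb(1), of \<zeta> x] j_less m by simp
  qed
  let ?Q = "\<lambda>p. \<exists>x. E x d \<and> (\<exists>\<zeta>. E \<zeta> \<xi> \<and> (maps_to E k \<zeta> x \<and> (\<exists>y\<in>V. maps_to E (j k) \<zeta> y \<and> is_opair E p x y)))"
  have "\<exists>g\<in>V. \<forall>p. E p g \<longleftrightarrow> E p b \<and> ?Q p"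
    by (rule v.sep[OF _ b(1)]) (intro v.dj_rules | simp add: V)+
  then obtain g where g: "g \<in> V" "\<And>p. E p g \<longleftrightarrow> E p b \<and> ?Q p" by blast
  have "E p g \<longleftrightarrow> E p b \<and> p \<in> graph_on E j M" for p
  proof
    assume "E p g"
    then obtain x \<zeta> y where p: "E p b" "E x d" "maps_to E k \<zeta> x" "maps_to E (j k) \<zeta> y" "is_opair E p x y"
      using g(2) by blast
    then have "y = j x" using is_bijectionD(2)[OF jk _ jk_val] by blast
    then show "E p b \<and> p \<in> graph_on E j M" using p d(2) unfolding graph_on_def by blast
  next
    assume p: "E p b \<and> p \<in> graph_on E j M"
    then obtain x where x: "x \<in> M" "is_opair E p x (j x)" unfolding graph_on_def by blast
    have "E x e" using e(2) maps_toI p x(2) by blast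
    then have xd: "E x d" using d(2) x(1) by blast
    then obtain \<zeta> where \<zeta>: "maps_to E k \<zeta> x" using kD(5) by blast
    have "E \<zeta> \<xi>" using kD(1)[OF \<zeta>] by blast
    then show "E p g" using g(2) p xd \<zeta> jk_val[OF \<zeta>] j_in_V[OF x(1)] x(2) by blast
  qed
  then show ?thesis using g(1) by blast
qed

lemma graph_in:
  assumes "p \<in> graph_on E j M"
  shows "p \<in> V"
  using assms j_in_V v.opair_in M_iff unfolding graph_on_def by blast

lemma graph_restrict_set:
  assumes "D \<subseteq> Mb" "g \<in> Vb" "ext E g = graph_on E j D"
    and D': "\<And>x. E x D' \<longleftrightarrow> (\<exists>y. maps_to E g x y)"
  shows "E x D' \<longleftrightarrow> x \<in> D"
proof
  assume "E x D'"
  then obtain y p where "E p g" "is_opair E p x y" using D' unfolding maps_to_def by blast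
  then show "x \<in> D" using assms(3) is_opair_inj unfolding graph_on_def ext_def by blast
next
  assume x: "x \<in> D"
  then have "x \<in> Vb" "j x \<in> Vb" using assms(1) Mb_sub j_in Nb_sub by blast+
  then obtain p where p: "is_opair E p x (j x)" using vb.ex_opair by blast
  then have "p \<in> graph_on E j D" using x unfolding graph_on_def by blast
  then have "E p g" using assms(3) by (auto simp: ext_def)
  then show "E x D'" using D' p maps_toI by blast
qed

lemma amenable:
  assumes am: "amenable_map E j Mb Vb"
  shows "amenable_map E j M V"
  unfolding amenable_map_def
proof
  fix a assume a: "a \<in> V"
  \<comment> \<open>On a set of \<open>V\<close> the traces of \<open>M\<close> and
    \<open>Mb\<close> coincide, so amenability to \<open>Vb\<close> already speaks about
    \<open>j\<close> restricted to \<open>M\<close>.\<close>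
  have M_eq: "M \<inter> ext E e = Mb \<inter> ext E e" if "e \<in> V" for e
    using v.W_trans[OF that] M_iff by (auto simp: ext_def)
  have "is_set_in E Vb (graph_on E j (M \<inter> ext E a))"
    using am a V_sub M_eq unfolding amenable_map_def by auto
  then obtain g where g: "g \<in> Vb" "ext E g = graph_on E j (M \<inter> ext E a)"
    unfolding is_set_in_def by blast
  have g_iff: "E p g \<longleftrightarrow> p \<in> graph_on E j (M \<inter> ext E a)" for p
    using g(2) by (auto simp: ext_def)
  have dom: "\<exists>d\<in>Vb. \<forall>u. E u d \<longleftrightarrow> u \<in> M \<and> E u e" if e: "e \<in> V" for e
  proof -
    have "is_set_in E Vb (graph_on E j (M \<inter> ext E e))"
      using am e V_sub M_eq unfolding amenable_map_def by auto
    then obtain h where h: "h \<in> Vb" "ext E h = graph_on E j (M \<inter> ext E e)"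
      unfolding is_set_in_def by blast
    obtain d where d: "d \<in> Vb" "\<And>x. E x d \<longleftrightarrow> (\<exists>y. maps_to E h x y)" using vb.ex_dom[OF h(1)] by blast
    have "M \<inter> ext E e \<subseteq> Mb" using M_iff by blast
    then have "E u d \<longleftrightarrow> u \<in> M \<inter> ext E e" for u
      using graph_restrict_set[OF _ h d(2)] by blast
    then show ?thesis using d(1) by (auto simp: ext_def)
  qed
  have "g \<in> V"
  proof (rule approxI[OF g(1)])
    show "p \<in> V" if "E p g" for p
      using that g_iff graph_in unfolding graph_on_def by blast
    fix b assume b: "b \<in> V" "v.sm b"
    obtain h where h: "h \<in> V" "\<And>p. E p h \<longleftrightarrow> E p b \<and> p \<in> graph_on E j M"
      using graph_small_piece[OF b dom] by blast
    have "\<exists>z\<in>V. \<forall>p. E p z \<longleftrightarrow> E p h \<and> (\<exists>x. E x a \<and> (\<exists>y\<in>V. is_opair E p x y))"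
      by (rule v.sep[OF _ h(1)]) (intro v.dj_rules | simp add: a)+
    then obtain z where z: "z \<in> V" "\<And>p. E p z \<longleftrightarrow> E p h \<and> (\<exists>x. E x a \<and> (\<exists>y\<in>V. is_opair E p x y))"
      by blast
    have "E p z \<longleftrightarrow> E p g \<and> E p b" for p
    proof
      assume "E p z"
      then obtain x y x' where p: "E p b" "x \<in> M" "is_opair E p x (j x)" "E x' a" "is_opair E p x' y"
        using z(2) h(2) unfolding graph_on_def by blast
      then have "x' = x" using is_opair_inj by blast
      then show "E p g \<and> E p b" using p g_iff unfolding graph_on_def ext_def by blast
    next
      assume p: "E p g \<and> E p b"
      then obtain x where x: "x \<in> M" "E x a" "is_opair E p x (j x)"
        using g_iff unfolding graph_on_def ext_def by blast
      then show "E p z" using z(2) h(2) p j_in_V unfolding graph_on_def by blast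
    qed
    then show "\<exists>z\<in>V. \<forall>u. E u z \<longleftrightarrow> E u g \<and> E u b" using z(1) by blast
  qed
  then show "is_set_in E V (graph_on E j (M \<inter> ext E a))" using g(2) unfolding is_set_in_def by blast
qed

text \<open>A set graph makes its domain \<open>Mb\<close> a set, so \<open>M\<close> is a set of
  \<open>V\<close> by \<open>M_set\<close>. It also makes \<open>j\<close> amenable to
  \<open>Vb\<close>, and amenability of the restriction to \<open>V\<close>, evaluated at the set
  \<open>M\<close>, is the claim.\<close>

lemma graph_set:
  assumes "is_set_in E Vb (graph_on E j Mb)"
  shows "is_set_in E V (graph_on E j M)"
proof -
  obtain g where g: "g \<in> Vb" "ext E g = graph_on E j Mb" using assms unfolding is_set_in_def by blast
  have g_iff: "E p g \<longleftrightarrow> p \<in> graph_on E j Mb" for p using g(2) by (auto simp: ext_def)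
  obtain d where d: "d \<in> Vb" "\<And>x. E x d \<longleftrightarrow> (\<exists>y. maps_to E g x y)" using vb.ex_dom[OF g(1)] by blast
  have "ext E d = Mb" using graph_restrict_set[OF subset_refl g d(2)] by (auto simp: ext_def)
  then have "is_set_in E V M" using M_set d(1) unfolding is_set_in_def by blast
  then obtain n where n: "n \<in> V" "ext E n = M" unfolding is_set_in_def by blast
  have "amenable_map E j Mb Vb"
    unfolding amenable_map_def
  proof
    fix a assume a: "a \<in> Vb"
    have "\<exists>z\<in>Vb. \<forall>p. E p z \<longleftrightarrow> E p g \<and> (\<exists>x. E x a \<and> (\<exists>y\<in>Vb. is_opair E p x y))"
      by (rule vb.sep[OF _ g(1)]) (intro vb.dj_rules | simp add: a)+
    then obtain z where z: "z \<in> Vb" "\<And>p. E p z \<longleftrightarrow> E p g \<and> (\<exists>x. E x a \<and> (\<exists>y\<in>Vb. is_opair E p x y))"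
      by blast
    have "E p z \<longleftrightarrow> p \<in> graph_on E j (Mb \<inter> ext E a)" for p
    proof
      assume "E p z"
      then obtain x y x' where p: "x \<in> Mb" "is_opair E p x (j x)" "E x' a" "is_opair E p x' y"
        using z(2) g_iff unfolding graph_on_def by blast
      then have "x' = x" using is_opair_inj by blast
      then show "p \<in> graph_on E j (Mb \<inter> ext E a)" using p unfolding graph_on_def ext_def by blast
    next
      assume "p \<in> graph_on E j (Mb \<inter> ext E a)"
      then obtain x where x: "x \<in> Mb" "E x a" "is_opair E p x (j x)" unfolding graph_on_def ext_def by blast
      then have "E p g" "j x \<in> Vb" using g_iff j_in Nb_sub unfolding graph_on_def by blast+
      then show "E p z" using z(2) x by blast
    qed
    then have "ext E z = graph_on E j (Mb \<inter> ext E a)" by (auto simp: ext_def)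
    then show "is_set_in E Vb (graph_on E j (Mb \<inter> ext E a))" using z(1) unfolding is_set_in_def by blast
  qed
  from amenable[OF this] have "is_set_in E V (graph_on E j (M \<inter> ext E n))"
    using n(1) unfolding amenable_map_def by blast
  then show ?thesis using n(2) by simp
qed

end

section \<open>Models equipped with classes\<close>

primrec cfm_of :: "fm \<Rightarrow> cfm" where
  "cfm_of (Mem m n) = CMem m n"
| "cfm_of (Eq m n) = CEq m n"
| "cfm_of (Neg \<phi>) = CNeg (cfm_of \<phi>)"
| "cfm_of (And \<phi> \<psi>) = CAnd (cfm_of \<phi>) (cfm_of \<psi>)"
| "cfm_of (Ex n \<phi>) = CEx n (cfm_of \<phi>)"

lemma csat_cfm_of: "csat E W K e (cfm_of \<phi>) \<longleftrightarrow> sat E W e \<phi>"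
  by (induction \<phi> arbitrary: e) simp_all

lemma (in mst) class_of:
  assumes C: "class_comprehension E W C" and G: "G \<in> C" and D: "D \<in> C"
    and Q: "df 60 (\<lambda>e. Q (e 0) (e 1))"
  shows "{p \<in> W. p \<in> G \<and> (\<exists>x\<in>W. x \<in> D \<and> Q p x)} \<in> C"
proof -
  obtain \<phi> p where "lev 60 \<phi>" and p: "range p \<subseteq> {c. c () \<in> W}"
    "\<And>i e s. range e \<subseteq> W \<Longrightarrow> range s \<subseteq> W \<Longrightarrow>
      sat E W (mrg e (\<lambda>k. p k i) s) \<phi> \<longleftrightarrow> Q (e 0) (e 1)"
    by (erule djE[OF Q])
  obtain w where w: "w \<in> W" using ex_empty by blast
  define e where "e = mrg (\<lambda>_. w) (\<lambda>k. p k ()) (\<lambda>_. w)"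
  define K where "K = (\<lambda>k::nat. if k = 0 then G else D)"
  \<comment> \<open>Variable 3 is argument 1 of the merged assignment, so the quantifier binds the
    second argument of \<open>Q\<close>; class variables 0 and 1 stand for \<open>G\<close> and
    \<open>D\<close>.\<close>
  define \<psi> where "\<psi> = CAnd (CIn 0 0) (CEx 3 (CAnd (CIn 3 1) (cfm_of \<phi>)))"
  have "range e \<subseteq> W" using p(1) w by (auto simp: e_def mrg_def)
  moreover have "range K \<subseteq> C" using G D by (auto simp: K_def)
  ultimately have "{x \<in> W. csat E W K (e(0 := x)) \<psi>} \<in> C"
    using C unfolding class_comprehension_def by blast
  moreover have "csat E W K (e(0 := x)) \<psi> \<longleftrightarrow> x \<in> G \<and> (\<exists>y\<in>W. y \<in> D \<and> Q x y)" if x: "x \<in> W" for x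
  proof -
    have "(e(0 := x))(3 := y) = mrg ((\<lambda>_. w)(0 := x, 1 := y)) (\<lambda>k. p k ()) (\<lambda>_. w)" for y
    proof
      fix n show "((e(0 := x))(3 := y)) n = mrg ((\<lambda>_. w)(0 := x, 1 := y)) (\<lambda>k. p k ()) (\<lambda>_. w) n"
      proof (cases n rule: mod3_cases)
        case (2 k)
        then have "n \<noteq> 0" "n \<noteq> 3" by presburger+
        then show ?thesis using 2 by (simp add: e_def)
      next
        case (3 k)
        then have "n \<noteq> 0" "n \<noteq> 3" by presburger+
        then show ?thesis using 3 by (simp add: e_def)
      qed (simp add: e_def)
    qed
    moreover have "sat E W (mrg ((\<lambda>_. w)(0 := x, 1 := y)) (\<lambda>k. p k ()) (\<lambda>_. w)) \<phi> \<longleftrightarrow> Q x y"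
      if "y \<in> W" for y
      using p(2)[of "(\<lambda>_. w)(0 := x, 1 := y)" "\<lambda>_. w" "()"] x w that by auto
    moreover have "mrg a b c 3 = a 1" for a b c :: "nat \<Rightarrow> 'a"
      using mrg_simps(1)[of a b c 1] by simp
    ultimately show ?thesis by (simp add: \<psi>_def K_def csat_cfm_of)
  qed
  ultimately show ?thesis by (simp cong: conj_cong)
qed

context lift
begin

lemma graph_class:
  assumes CVb: "model_with_classes E Vb CVb" and ap: "class_approximation_property E \<delta> V CV CVb"
    and G: "graph_on E j Mb \<in> CVb" and M: "M \<in> CVb"
  shows "graph_on E j M \<in> CV"
proof -
  have comp: "class_comprehension E Vb CVb" and repl: "class_replacement E Vb CVb"
    using CVb by (auto simp: model_with_classes_def)
  have MVb: "M \<subseteq> Vb" using Mb_sub M_iff by blast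
  have "vb.df 60 (\<lambda>e. \<exists>y\<in>Vb. is_opair E (e 0) (e 1) y)" by (intro vb.dj_rules | simp)+
  from vb.class_of[OF comp G M this]
  have "{p \<in> Vb. p \<in> graph_on E j Mb \<and> (\<exists>x\<in>Vb. x \<in> M \<and> (\<exists>y\<in>Vb. is_opair E p x y))} \<in> CVb" .
  moreover have "{p \<in> Vb. p \<in> graph_on E j Mb \<and> (\<exists>x\<in>Vb. x \<in> M \<and> (\<exists>y\<in>Vb. is_opair E p x y))} = graph_on E j M"
    (is "?L = ?R")
  proof (intro equalityI subsetI)
    fix p assume "p \<in> ?L"
    then obtain x y x' where p: "is_opair E p x (j x)" "x' \<in> M" "is_opair E p x' y" unfolding graph_on_def by blast
    then have "x' = x" using is_opair_inj by blast
    then show "p \<in> ?R" using p unfolding graph_on_def by blast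
  next
    fix p assume p: "p \<in> ?R"
    then obtain x where x: "x \<in> M" "is_opair E p x (j x)" unfolding graph_on_def by blast
    then have "x \<in> Mb" "x \<in> Vb" "j x \<in> Vb" using M_iff MVb j_in_V V_sub by blast+
    then show "p \<in> ?L" using graph_in[OF p] V_sub x unfolding graph_on_def by blast
  qed
  ultimately have GM: "graph_on E j M \<in> CVb" by simp
  have Vb_class: "Vb \<in> CVb"
    using comp[unfolded class_comprehension_def, rule_format, of "\<lambda>_. M" "\<lambda>_. \<delta>" "CEq 0 0"] M vb.d_in
    by auto
  \<comment> \<open>The identity on \<open>M\<close> as a class of pairs: class replacement along it
    makes the trace of \<open>M\<close> on any set a set of \<open>Vb\<close>, as
    \<open>graph_small_piece\<close> requires.\<close>
  have "vb.df 60 (\<lambda>e. is_opair E (e 0) (e 1) (e 1))" by (intro vb.dj_rules)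
  from vb.class_of[OF comp Vb_class M this]
  have I: "{p \<in> Vb. p \<in> Vb \<and> (\<exists>x\<in>Vb. x \<in> M \<and> is_opair E p x x)} \<in> CVb" (is "?I \<in> _") .
  have I_iff: "(\<exists>p\<in>?I. is_opair E p x y) \<longleftrightarrow> x \<in> M \<and> y = x" for x y
  proof
    assume "\<exists>p\<in>?I. is_opair E p x y"
    then show "x \<in> M \<and> y = x" using is_opair_inj by blast
  next
    assume xy: "x \<in> M \<and> y = x"
    then obtain p where "p \<in> Vb" "is_opair E p x x" using vb.ex_opair MVb by blast
    then show "\<exists>p\<in>?I. is_opair E p x y" using xy MVb by blast
  qed
  have dom: "\<exists>d\<in>Vb. \<forall>u. E u d \<longleftrightarrow> u \<in> M \<and> E u e" if e: "e \<in> V" for e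
  proof -
    have eVb: "e \<in> Vb" using e V_sub by blast
    have "(\<forall>x y y'. E x e \<and> (\<exists>p\<in>?I. is_opair E p x y) \<and> (\<exists>p\<in>?I. is_opair E p x y') \<longrightarrow> y = y') \<longrightarrow>
        is_set_in E Vb {y. \<exists>x. E x e \<and> (\<exists>p\<in>?I. is_opair E p x y)}"
      using bspec[OF bspec[OF repl[unfolded class_replacement_def] I] eVb] .
    then have "is_set_in E Vb {y. \<exists>x. E x e \<and> (x \<in> M \<and> y = x)}"
      unfolding I_iff by simp
    then obtain d where "d \<in> Vb" "ext E d = {y. \<exists>x. E x e \<and> (x \<in> M \<and> y = x)}"
      unfolding is_set_in_def by blast
    then show ?thesis by (intro bexI[of _ d]) (auto simp: ext_def)
  qed
  have "is_set_in E V (graph_on E j M \<inter> ext E b)" if b: "b \<in> V" "size_less_in E V b \<delta>" for b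
  proof -
    have "v.sm b" using b(2) v.sm_iff by simp
    from graph_small_piece[OF b(1) this dom]
    obtain g where "g \<in> V" "\<And>p. E p g \<longleftrightarrow> E p b \<and> p \<in> graph_on E j M" by blast
    then show ?thesis unfolding is_set_in_def by (intro bexI[of _ g]) (auto simp: ext_def)
  qed
  moreover have "graph_on E j M \<subseteq> V" using graph_in by blast
  ultimately show ?thesis using ap GM unfolding class_approximation_property_def by blast
qed

end

theorem mainTheorem1:
  fixes E :: "'a \<Rightarrow> 'a \<Rightarrow> bool"
    and V Vbar M Mbar N Nbar :: "'a set"
    and j :: "'a \<Rightarrow> 'a"
    and \<delta> \<kappa> :: 'a
  assumes "set_universe E"
    and "transitive_zfc_model E V" and "transitive_zfc_model E Vbar" and "V \<subseteq> Vbar"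
    and "is_regular_cardinal_in E Vbar \<delta>"
    and "approximation_property E \<delta> V Vbar" and "cover_property E \<delta> V Vbar"
    and "Mbar \<subseteq> Vbar" and "model_of_set_theory E Mbar"
    and "M = Mbar \<inter> V" and "model_of_set_theory E M"
    and "Nbar \<subseteq> Vbar" and "transitive_class E Nbar"
    and "elementary_embedding E j Mbar Nbar" and "cofinal_map E j Mbar Nbar"
    and "is_critical_point E j Mbar \<kappa>" and "E \<delta> \<kappa>"
    and "\<forall>x\<in>Vbar. ext E x \<subseteq> ext E \<delta> \<longrightarrow> x \<in> Mbar"
    and "\<forall>\<beta>. E \<beta> \<delta> \<longrightarrow> closed_under_sequences E Vbar \<beta> Mbar"
    and "closed_under_sequences E Vbar \<delta> Nbar"
    and "N = (\<Union>x\<in>M. ext E (j x))"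
  shows "j ` M \<subseteq> N \<and>
    (is_set_in E Vbar Mbar \<longrightarrow> is_set_in E V M) \<and>
    (N \<subseteq> V \<and> N = Nbar \<inter> V) \<and>
    ((amenable_map E j Mbar Vbar \<longrightarrow> amenable_map E j M V) \<and>
     (is_set_in E Vbar (graph_on E j Mbar) \<longrightarrow> is_set_in E V (graph_on E j M))) \<and>
    (\<forall>CV CVbar.
       model_with_classes E V CV \<and> model_with_classes E Vbar CVbar \<and>
       class_approximation_property E \<delta> V CV CVbar \<and>
       graph_on E j Mbar \<in> CVbar \<and> M \<in> CVbar \<longrightarrow>
       graph_on E j M \<in> CV)"
proof -
  interpret lift E V Vbar M Mbar N Nbar j \<delta> \<kappa>
    by unfold_locales (fact assms)+
  have "j ` M \<subseteq> N" using j_image_in by blast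
  moreover have "N = Nbar \<inter> V" using N_sub N_eq by blast
  ultimately show ?thesis
    using N_sub(1) M_set amenable graph_set graph_class by blast
qed

end
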